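(* For every $m\in\mathbb Z^+$, the set $\{\mathbf S_\lambda(n):\ \widetilde\lambda_1\le n,\ |\lambda|\le m\}$ is a linear basis of $\boldsymbol\zeta(n)^{(m)}$. The set $\{\mathbf S_\lambda(n):\ \widetilde\lambda_1\le n\}$ is a linear basis of the center $\boldsymbol\zeta(n)$ of $\mathbf U(gl(n))$. (Here $\lambda$ ranges over partitions.)
   Context: $\boldsymbol\zeta(n)$ is the center of $\mathbf U(gl(n))$ (over $\mathbb C$) and $\boldsymbol\zeta(n)^{(m)}$ its $m$-th filtration element with respect to the filtration induced by the standard filtration of $\mathbf U(gl(n))$. Virtual symbols. Let $\mathcal L=\{1,\dots,n\}$, and let $\mathcal A_0=\{\alpha_1,\dots,\alpha_{m_0}\}$, $\mathcal A_1=\{\beta_1,\dots,\beta_{m_1}\}$ be finite sets of auxiliary (virtual) symbols, with $m_0,m_1$ sufficiently large. Put $|a|=0\in\mathbb Z_2$ for $a\in\mathcal A_0$ and $|a|=1\in\mathbb Z_2$ for $a\in\mathcal A_1\cup\mathcal L$. Let $gl(m_0|m_1+n)$ be the complex Lie superalgebra with basis $e_{a,b}$, $a,b\in\mathcal A_0\cup\mathcal A_1\cup\mathcal L$, $|e_{a,b}|=|a|+|b|$, and superbracket $[e_{a,b},e_{c,d}]=\delta_{bc}e_{a,d}-(-1)^{(|a|+|b|)(|c|+|d|)}\delta_{ad}e_{c,b}$. Its enveloping superalgebra $\mathbf U(gl(m_0|m_1+n))$ contains $\mathbf U(gl(n))$ as the subalgebra generated by $e_{i,j}$, $i,j\in\mathcal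 L$. Devirtualization. A product $e_{a_p,b_p}\cdots e_{a_1,b_1}$ is irregular if there are $i\le p$ and a virtual symbol $\gamma\in\mathcal A_0\cup\mathcal A_1$ with $\#\{j\le i: b_j=\gamma\}>\#\{j<i: a_j=\gamma\}$. Let $\mathbf{Irr}$ be the left ideal of $\mathbf U(gl(m_0|m_1+n))$ generated by the irregular products. The sum $Virt=\mathbf U(gl(n))+\mathbf{Irr}$ is direct and is a subalgebra, in which $\mathbf{Irr}$ is a two-sided ideal; $\mathfrak p:Virt\to\mathbf U(gl(n))$ denotes the projection with kernel $\mathbf{Irr}$ (an algebra epimorphism). Tableaux. A Young tableau of shape $\lambda$ over an alphabet is any filling of the cells of the Ferrers diagram of $\lambda$ (rows of lengths $\lambda_1\ge\lambda_2\ge\cdots$). For tableaux $S,T$ of the same shape, $e_{S,T}$ is the product of the $e_{S(c),T(c)}$ over the cells $c$, read row by row from top to bottom, left to right in each row. $D^*_\lambda$ is the tableau of shape $\lambda$ whose $r$-th row is $\beta_1\beta_2\cdots\beta_{\lambda_r}$, and $C^*_\lambda$ the tableau of shape $\lambda$ whose $r$-th row is $\alpha_r\alpha_r\cdots\alpha_r$ (the $\alpha$'s and $\beta$'s being arbitrary distinct positive, resp. negative, virtual symbols). For tableaux $S,T$ of shape $\lambda$ over $\mathcal L$, the double Young-Capelli bitableau is $[\,\boxed{S\,|\,T}\,]=\mathfrak p\big(e_{S,C^*_\lambda}e_{C^*_\lambda,D^*_\lambda}e_{D^*_\lambda,C^*_\lambda}e_{C^*_\lambda,T}\big)\in\mathbf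 U(gl(n))$; the argument of $\mathfrak p$ lies in $Virt$ and the result does not depend on the choice of virtual symbols. Schur elements. $\widetilde\lambda$ is the conjugate partition and $H(\lambda)=H(\widetilde\lambda)$ the product of the hook lengths of all boxes of the Ferrers diagram. For $\widetilde\lambda_1\le n$, $\mathbf S_\lambda(n)=\frac1{H(\widetilde\lambda)}\sum_S[\,\boxed{S\,|\,S}\,]\in\boldsymbol\zeta(n)$, the sum over all tableaux $S$ of shape $\widetilde\lambda$ on $\mathcal L$ with strictly increasing rows (no condition on columns); $\mathbf S_\emptyset(n)=\mathbf 1$ for the empty partition. *)

theory Defs
  imports
    "HOL-Library.Poly_Mapping"
    "HOL-Algebra.QuotRing"
    "Jordan_Normal_Form.VS_Connect"
begin

text \<open>
  With concatenation as addition on lists, finitely supported functions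
  \<open>'a list \<Rightarrow>\<^sub>0 complex\<close> form the free associative unital
  algebra on \<open>'a\<close>; multiplication is the convolution of \<open>Poly_Mapping\<close>.
\<close>

instantiation list :: (type) monoid_add
begin

definition zero_list :: "'a list" where "zero_list = []"

definition plus_list :: "'a list \<Rightarrow> 'a list \<Rightarrow> 'a list" where "plus_list = (@)"

instance
  by standard (simp_all add: zero_list_def plus_list_def)

end


section \<open>Enveloping superalgebras of general linear Lie superalgebras\<close>

text \<open>\<open>Pos i\<close>, \<open>Neg i\<close> and \<open>Letter i\<close> stand for
  $\alpha_i$, $\beta_i$ and the proper symbol $i \in \mathcal L$.\<close>

datatype symbol = Pos nat | Neg nat | Letter nat

fun parity :: "symbol \<Rightarrow> nat" where
  "parity (Pos i) = 0"
| "parity (Neg i) = 1"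
| "parity (Letter i) = 1"

definition virtual_symbols :: "nat \<Rightarrow> nat \<Rightarrow> symbol set" where
  "virtual_symbols m0 m1 = Pos ` {1..m0} \<union> Neg ` {1..m1}"

definition proper_symbols :: "nat \<Rightarrow> symbol set" where
  "proper_symbols n = Letter ` {1..n}"

type_synonym free_alg = "(symbol \<times> symbol) list \<Rightarrow>\<^sub>0 complex"

text \<open>The free algebra on the symbols $e_{a,b}$ with $a, b \in A$, i.e. the tensor
  algebra of the vector space $gl(A)$ with this basis.\<close>

definition free_algebra :: "symbol set \<Rightarrow> free_alg ring" where
  "free_algebra A =
     \<lparr>carrier = {f. Poly_Mapping.keys f \<subseteq> lists (A \<times> A)},
      mult = (*), one = 1, zero = 0, add = (+)\<rparr>"

definition free_gen :: "symbol \<Rightarrow> symbol \<Rightarrow> free_alg" where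
  "free_gen a b = Poly_Mapping.single [(a, b)] 1"

definition free_scale :: "complex \<Rightarrow> free_alg \<Rightarrow> free_alg" where
  "free_scale c f = Poly_Mapping.map (\<lambda>x. c * x) f"

definition super_sign :: "symbol \<Rightarrow> symbol \<Rightarrow> symbol \<Rightarrow> symbol \<Rightarrow> complex" where
  "super_sign a b c d = (-1) ^ ((parity a + parity b) * (parity c + parity d))"

definition superbracket :: "symbol \<Rightarrow> symbol \<Rightarrow> symbol \<Rightarrow> symbol \<Rightarrow> free_alg" where
  "superbracket a b c d =
     (if b = c then free_gen a d else 0)
     - free_scale (super_sign a b c d) (if a = d then free_gen c b else 0)"

definition enveloping_ideal :: "symbol set \<Rightarrow> free_alg set" where
  "enveloping_ideal A =
     genideal (free_algebra A)
       {free_gen a b * free_gen c d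
          - free_scale (super_sign a b c d) (free_gen c d * free_gen a b)
          - superbracket a b c d | a b c d. {a, b, c, d} \<subseteq> A}"

text \<open>The enveloping superalgebra $\mathbf U(gl(A))$. The record \<open>module\<close> extends
  \<open>ring\<close>, so it carries both the multiplication and the scalar action.\<close>

definition enveloping :: "symbol set \<Rightarrow> (complex, free_alg set) module" where
  "enveloping A =
     ring.extend (free_algebra A Quot enveloping_ideal A)
       (module.fields
         (\<lambda>c X. enveloping_ideal A <+>\<^bsub>free_algebra A\<^esub> (free_scale c ` X)))"

definition env_gen :: "symbol set \<Rightarrow> symbol \<Rightarrow> symbol \<Rightarrow> free_alg set" where
  "env_gen A a b = enveloping_ideal A +>\<^bsub>free_algebra A\<^esub> free_gen a b"

text \<open>\<open>env_prod A [(a\<^sub>1, b\<^sub>1), \<dots>, (a\<^sub>p, b\<^sub>p)]\<close> is the product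
  $e_{a_1,b_1} \cdots e_{a_p,b_p}$ in this order.\<close>

definition env_prod :: "symbol set \<Rightarrow> (symbol \<times> symbol) list \<Rightarrow> free_alg set" where
  "env_prod A w =
     foldr (\<lambda>(a, b) x. env_gen A a b \<otimes>\<^bsub>enveloping A\<^esub> x) w \<one>\<^bsub>enveloping A\<^esub>"

definition filtration :: "symbol set \<Rightarrow> nat \<Rightarrow> free_alg set set" where
  "filtration A m =
     {enveloping_ideal A +>\<^bsub>free_algebra A\<^esub> f | f.
        f \<in> carrier (free_algebra A) \<and> (\<forall>w\<in>Poly_Mapping.keys f. length w \<le> m)}"

text \<open>All letters of \<open>proper_symbols n\<close> are odd, so every $e_{i,j}$ is even and
  \<open>enveloping (proper_symbols n)\<close> is the ordinary enveloping algebra of $gl(n)$.\<close>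

abbreviation Ugl :: "nat \<Rightarrow> (complex, free_alg set) module" where
  "Ugl n \<equiv> enveloping (proper_symbols n)"

definition gl_center :: "nat \<Rightarrow> free_alg set set" where
  "gl_center n = {z \<in> carrier (Ugl n). \<forall>x\<in>carrier (Ugl n). z \<otimes>\<^bsub>Ugl n\<^esub> x = x \<otimes>\<^bsub>Ugl n\<^esub> z}"

definition gl_center_filtration :: "nat \<Rightarrow> nat \<Rightarrow> free_alg set set" where
  "gl_center_filtration n m = gl_center n \<inter> filtration (proper_symbols n) m"


section \<open>Devirtualization\<close>

definition all_symbols :: "nat \<Rightarrow> nat \<Rightarrow> nat \<Rightarrow> symbol set" where
  "all_symbols m0 m1 n = virtual_symbols m0 m1 \<union> proper_symbols n"

text \<open>The embedding of $\mathbf U(gl(n))$ into $\mathbf U(gl(m_0|m_1+n))$ with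
  $e_{i,j} \mapsto e_{i,j}$: a residue class modulo the smaller ideal is enlarged to the
  residue class modulo the bigger one.\<close>

definition embed :: "nat \<Rightarrow> nat \<Rightarrow> nat \<Rightarrow> free_alg set \<Rightarrow> free_alg set" where
  "embed m0 m1 n X =
     enveloping_ideal (all_symbols m0 m1 n) <+>\<^bsub>free_algebra (all_symbols m0 m1 n)\<^esub> X"

text \<open>Irregularity of $e_{a_p,b_p} \cdots e_{a_1,b_1}$. The list is
  \<open>[(a\<^sub>1, b\<^sub>1), \<dots>, (a\<^sub>p, b\<^sub>p)]\<close>, read from the rightmost
  factor of the product to the leftmost, and indices start at 0.\<close>

definition irregular :: "symbol set \<Rightarrow> (symbol \<times> symbol) list \<Rightarrow> bool" where
  "irregular V ps \<longleftrightarrow>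
     (\<exists>i<length ps. \<exists>\<gamma>\<in>V.
        card {j. j \<le> i \<and> snd (ps ! j) = \<gamma>} > card {j. j < i \<and> fst (ps ! j) = \<gamma>})"

definition left_ideal :: "('a, 'b) ring_scheme \<Rightarrow> 'a set \<Rightarrow> bool" where
  "left_ideal R J \<longleftrightarrow>
     additive_subgroup J R \<and> (\<forall>r\<in>carrier R. \<forall>x\<in>J. r \<otimes>\<^bsub>R\<^esub> x \<in> J)"

definition Irr :: "nat \<Rightarrow> nat \<Rightarrow> nat \<Rightarrow> free_alg set set" where
  "Irr m0 m1 n =
     \<Inter> {J. left_ideal (enveloping (all_symbols m0 m1 n)) J \<and>
            {env_prod (all_symbols m0 m1 n) (rev ps) | ps.
               set ps \<subseteq> all_symbols m0 m1 n \<times> all_symbols m0 m1 n \<and>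
               irregular (virtual_symbols m0 m1) ps} \<subseteq> J}"

text \<open>The projection $\mathfrak p$ of $Virt = \mathbf U(gl(n)) \oplus \mathbf{Irr}$ onto
  its first summand; only its values on $Virt$ are meaningful.\<close>

definition devirt :: "nat \<Rightarrow> nat \<Rightarrow> nat \<Rightarrow> free_alg set \<Rightarrow> free_alg set" where
  "devirt m0 m1 n x =
     (THE y. y \<in> carrier (Ugl n) \<and>
        x \<ominus>\<^bsub>enveloping (all_symbols m0 m1 n)\<^esub> embed m0 m1 n y \<in> Irr m0 m1 n)"


section \<open>Partitions and tableaux\<close>

definition is_partition :: "nat list \<Rightarrow> bool" where
  "is_partition l \<longleftrightarrow> sorted_wrt (\<ge>) l \<and> 0 \<notin> set l"

definition first_part :: "nat list \<Rightarrow> nat" where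
  "first_part l = (case l of [] \<Rightarrow> 0 | r # _ \<Rightarrow> r)"

definition conj_partition :: "nat list \<Rightarrow> nat list" where
  "conj_partition l = map (\<lambda>j. card {i. i < length l \<and> j < l ! i}) [0..<first_part l]"

definition cells :: "nat list \<Rightarrow> (nat \<times> nat) set" where
  "cells l = {(i, j). i < length l \<and> j < l ! i}"

definition hook :: "nat list \<Rightarrow> nat \<Rightarrow> nat \<Rightarrow> (nat \<times> nat) set" where
  "hook l i j = {(i', j') \<in> cells l. (i' = i \<and> j \<le> j') \<or> (j' = j \<and> i \<le> i')}"

definition hook_product :: "nat list \<Rightarrow> nat" where
  "hook_product l = (\<Prod>(i, j)\<in>cells l. card (hook l i j))"

text \<open>A tableau is the list of its rows; its shape is the list of the row lengths.\<close>

definition virtual_C :: "nat list \<Rightarrow> symbol list list" where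
  "virtual_C l = map (\<lambda>r. replicate (l ! r) (Pos (Suc r))) [0..<length l]"

definition virtual_D :: "nat list \<Rightarrow> symbol list list" where
  "virtual_D l = map (\<lambda>k. map Neg [1..<Suc k]) l"

definition tableau_monomial ::
    "symbol set \<Rightarrow> symbol list list \<Rightarrow> symbol list list \<Rightarrow> free_alg set" where
  "tableau_monomial A S T = env_prod A (zip (concat S) (concat T))"

text \<open>The double Young-Capelli bitableau of two tableaux of the same shape over
  $\{1,\dots,n\}$. The symbols used are available if $m_0$ is at least the number of rows
  and $m_1$ at least the number of columns of the shape.\<close>

definition bitableau ::
    "nat \<Rightarrow> nat \<Rightarrow> nat \<Rightarrow> nat list list \<Rightarrow> nat list list \<Rightarrow> free_alg set" where
  "bitableau m0 m1 n S T =
     (let A = all_symbols m0 m1 n; U = enveloping A;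
          C = virtual_C (map length S); D = virtual_D (map length S);
          S' = map (map Letter) S; T' = map (map Letter) T
      in devirt m0 m1 n
           (tableau_monomial A S' C \<otimes>\<^bsub>U\<^esub> tableau_monomial A C D
              \<otimes>\<^bsub>U\<^esub> tableau_monomial A D C \<otimes>\<^bsub>U\<^esub> tableau_monomial A C T'))"

definition row_strict_tableaux :: "nat \<Rightarrow> nat list \<Rightarrow> nat list list set" where
  "row_strict_tableaux n l =
     {S. map length S = l \<and> (\<forall>r\<in>set S. set r \<subseteq> {1..n} \<and> sorted_wrt (<) r)}"

definition schur_element :: "nat \<Rightarrow> nat \<Rightarrow> nat \<Rightarrow> nat list \<Rightarrow> free_alg set" where
  "schur_element m0 m1 n l =
     (if l = [] then \<one>\<^bsub>Ugl n\<^esub>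
      else (1 / of_nat (hook_product (conj_partition l))) \<odot>\<^bsub>Ugl n\<^esub>
             (\<Oplus>\<^bsub>Ugl n\<^esub>S\<in>row_strict_tableaux n (conj_partition l). bitableau m0 m1 n S S))"

definition schur_index :: "nat \<Rightarrow> nat list set" where
  "schur_index n = {l. is_partition l \<and> first_part (conj_partition l) \<le> n}"

text \<open>A family \<open>s\<close> indexed by \<open>I\<close> is a basis of the subspace
  \<open>W\<close> of \<open>V\<close>. Injectivity makes this a statement about the family and
  not only about its set of values.\<close>

definition basis_of ::
    "(complex, 'v) module \<Rightarrow> 'v set \<Rightarrow> 'i set \<Rightarrow> ('i \<Rightarrow> 'v) \<Rightarrow> bool" where
  "basis_of V W I s \<longleftrightarrow>
     inj_on s I \<and> vectorspace.basis class_ring (V\<lparr>carrier := W\<rparr>) (s ` I)"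

end

theory Submission
  imports Defs "HOL-Library.Function_Algebras"
begin

text \<open>All elements act on tensors (complex functions on words of symbols) by superpolarizations. Irregular
  products kill the tensors over proper symbols, so devirtualization does not change the action
  there, and an element of degree at most \<open>m\<close> of \<open>U(gl(n))\<close> vanishes as soon as it acts by zero
  on the proper tensors of degree at most \<open>m\<close>. Every Schur element thus acts as a positive multiple of
  \<open>\<Sum>\<^sub>S X\<^sub>S\<^sup>* X\<^sub>S\<close>, where \<open>X\<^sub>S = e\<^bsub>D,C\<^esub> e\<^bsub>C,S\<^esub>\<close> and the adjoint refers to the standard
  Hermitian form.

  A central element acts on the highest weight vectors of a given weight by a scalar, and it is
  zero if all these scalars are. On highest weight vectors of weight \<open>\<mu>\<close>, \<open>X\<^sub>S\<close> can be nonzero only if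
  \<open>|\<lambda>| < |\<mu>|\<close>, or \<open>|\<lambda>| = |\<mu>|\<close> and \<open>\<Sum>\<^sub>i i \<lambda>\<^sub>i < \<Sum>\<^sub>i i \<mu>\<^sub>i\<close>, or \<open>\<lambda> = \<mu>\<close>. If \<open>\<lambda> = \<mu>\<close> and the rows of \<open>S\<close> are
  \<open>1, 2, 3, \<dots>\<close>, the operator \<open>X\<^sub>S\<close> is a sequence of odd reflections, none of which kills a highest weight
  vector. By positivity the matrix of scalars is triangular with nonzero diagonal, so the Schur
  elements of degree at most \<open>m\<close> are independent and every central element of degree at most \<open>m\<close>
  has the scalars of a unique combination of them.\<close>

section \<open>Superpolarizations of tensors\<close>

text \<open>Elements of the enveloping algebras are cosets without a normal form, so tensors serve
  as coordinates: over proper symbols the action decides membership in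
  \<open>enveloping_ideal\<close>. The same test makes \<open>devirt\<close> single valued, because
  an element of \<open>Irr\<close> coming from U(gl(n)) kills every proper tensor.

  Centrality of the Schur elements comes from the rows. The superoperators F -> e_{s,\<alpha>} F
  e_{\<alpha>,s} commute and square to zero, as \<alpha> is even and s is odd. Sums over strictly
  increasing rows are their elementary symmetric functions; the k-th is the k-th power of the first
  divided by k!, and the first is visibly invariant under gl(n).

  The adjoint of e_{a,b} is e_{b,a} with no sign, even for odd operators, since the sign of a
  replacement only involves the letters on its left. Positivity of the form then shows that highest
  weights are partitions, that the odd reflections do not kill, and that central elements act by
  scalars.

  The two factors of \<open>X\<^sub>S\<close> are two transpositions: reflections from letters to
  \<alpha>'s yield a highest weight vector of conjugate weight, from which the reflections to
  \<beta>'s start anew.\<close>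

type_synonym tensor = "symbol list \<Rightarrow> complex"

definition scl :: "complex \<Rightarrow> tensor \<Rightarrow> tensor" where
  "scl c t = (\<lambda>w. c * t w)"

lemma tensor_zero_fold [simp]: "(\<lambda>w :: symbol list. 0 :: complex) = 0"
  by (simp add: fun_eq_iff)

lemma scl_apply [simp]: "scl c t w = c * t w"
  by (simp add: scl_def)

lemma scl_simps [simp]:
  "scl 0 t = 0" "scl 1 t = t" "scl c 0 = 0" "scl c (scl d t) = scl (c * d) t"
  "scl (- c) t = - scl c t" "scl c (- t) = - scl c t"
  by (auto simp: fun_eq_iff)

lemma scl_distribs:
  "scl (c + d) t = scl c t + scl d t" "scl (c - d) t = scl c t - scl d t"
  "scl c (s + t) = scl c s + scl c t" "scl c (s - t) = scl c s - scl c t"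
  by (auto simp: fun_eq_iff algebra_simps)

lemma sum_tensor_apply: "(\<Sum>i\<in>I. (f i :: tensor)) w = (\<Sum>i\<in>I. f i w)"
  by (induction I rule: infinite_finite_induct) auto

lemma scl_sum: "scl c (\<Sum>i\<in>I. f i) = (\<Sum>i\<in>I. scl c (f i))"
  by (simp add: fun_eq_iff sum_tensor_apply sum_distrib_left)

definition lin :: "(tensor \<Rightarrow> tensor) \<Rightarrow> bool" where
  "lin F \<longleftrightarrow> (\<forall>s t. F (s + t) = F s + F t) \<and> (\<forall>c t. F (scl c t) = scl c (F t))"

lemma lin_add: "lin F \<Longrightarrow> F (s + t) = F s + F t"
  and lin_scl: "lin F \<Longrightarrow> F (scl c t) = scl c (F t)"
  by (auto simp: lin_def)

lemma lin_0: "lin F \<Longrightarrow> F 0 = 0"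
  using lin_scl[of F 0 0] by simp

lemma lin_minus: "lin F \<Longrightarrow> F (- t) = - F t"
  using lin_scl[of F "-1" t] by simp

lemma lin_diff: "lin F \<Longrightarrow> F (s - t) = F s - F t"
  using lin_add[of F s "- t"] lin_minus[of F t] by simp

lemma lin_sum: "lin F \<Longrightarrow> F (\<Sum>i\<in>I. f i) = (\<Sum>i\<in>I. F (f i))"
  by (induction I rule: infinite_finite_induct) (auto simp: lin_0 lin_add)

lemma lin_sum_list: "lin F \<Longrightarrow> F (\<Sum>x\<leftarrow>l. f x) = (\<Sum>x\<leftarrow>l. F (f x))"
  by (rule list.induct[where P = "\<lambda>l. F (\<Sum>x\<leftarrow>l. f x) = (\<Sum>x\<leftarrow>l. F (f x))"]) (auto simp: lin_0 lin_add)

lemma sum_list_tensor_apply: "(\<Sum>x\<leftarrow>l. (f x :: tensor)) w = (\<Sum>x\<leftarrow>l. f x w)"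
  by (induction l) auto

lemmas lin_simps = lin_add lin_scl lin_0 lin_minus lin_diff lin_sum

text \<open>The operator e_{a,b} replaces one letter b by a in all possible ways. A tensor is stored
  through its coefficients, so the coefficient at a word is read off by turning an a back into b.
  The power of -1 is the Koszul sign for passing the letters on the left.\<close>

fun pol :: "symbol \<Rightarrow> symbol \<Rightarrow> tensor \<Rightarrow> tensor" where
  "pol a b t [] = 0"
| "pol a b t (x # w) = (if x = a then t (b # w) else 0) +
     (-1) ^ ((parity a + parity b) * parity x) * pol a b (\<lambda>u. t (x # u)) w"

lemma pol_add: "pol a b (\<lambda>u. s u + t u) w = pol a b s w + pol a b t w"
  by (induction w arbitrary: s t) (auto simp: algebra_simps)

lemma pol_scale: "pol a b (\<lambda>u. c * t u) w = c * pol a b t w"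
  by (induction w arbitrary: t) (auto simp: algebra_simps)

lemma lin_pol [simp]: "lin (pol a b)"
  unfolding lin_def by (auto simp: fun_eq_iff plus_fun_def pol_add scl_def pol_scale)

lemmas pol_simps [simp] = lin_simps[OF lin_pol]

lemma parity_cases: "parity a = 0 \<or> parity a = 1"
  by (cases a) auto

text \<open>The superbracket relation for the tensor action. Expanding at the first letter, both
  operators act there, or exactly one of them, or none; the last case is the induction
  hypothesis.\<close>

lemma pol_pol_pointwise:
  "pol a b (pol c d t) w = super_sign a b c d * pol c d (pol a b t) w
     + (if b = c then pol a d t w else 0)
     - super_sign a b c d * (if a = d then pol c b t w else 0)"
proof (induction w arbitrary: t)
  case Nil
  show ?case by simp
next
  case (Cons x w)
  have p1: "(\<lambda>u. pol c d t (x # u)) = (\<lambda>u. (if x = c then 1 else 0) * t (d # u) +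
      (-1) ^ ((parity c + parity d) * parity x) * pol c d (\<lambda>v. t (x # v)) u)" for c d x t
    by auto
  define A where "A = (-1 :: complex) ^ ((parity a + parity b) * parity x)"
  define C where "C = (-1 :: complex) ^ ((parity c + parity d) * parity x)"
  define S where "S = super_sign a b c d"
  \<comment> \<open>If \<open>x = c\<close>, the first letter seen by \<open>pol a b\<close> is d
    instead of c, which changes its sign by exactly the super sign; \<open>s2\<close> is the mirror
    image.\<close>
  have s1: "x = c \<Longrightarrow> (-1) ^ ((parity a + parity b) * parity d) = S * A"
    unfolding A_def S_def super_sign_def
    using parity_cases[of a] parity_cases[of b] parity_cases[of c] parity_cases[of d] by auto
  have s2: "x = a \<Longrightarrow> (-1) ^ ((parity c + parity d) * parity b) = S * C"
    unfolding C_def S_def super_sign_def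
    using parity_cases[of a] parity_cases[of b] parity_cases[of c] parity_cases[of d] by auto
  have SS: "S * S = 1" unfolding S_def super_sign_def by (simp flip: power_mult_distrib)
  have s3: "b = c \<Longrightarrow> (-1) ^ ((parity a + parity d) * parity x) = A * C"
    unfolding A_def C_def
    using parity_cases[of a] parity_cases[of c] parity_cases[of d] parity_cases[of x] by auto
  have s4: "a = d \<Longrightarrow> (-1) ^ ((parity c + parity b) * parity x) = A * C"
    unfolding A_def C_def
    using parity_cases[of a] parity_cases[of c] parity_cases[of b] parity_cases[of x] by auto
  define p q r v where "p = (if x = a then 1 else 0 :: complex)" "q = (if x = c then 1 else 0 :: complex)"
    "r = (if b = c then 1 else 0 :: complex)" "v = (if a = d then 1 else 0 :: complex)"
  note pqrv = this
  define q1 q2 where "q1 = pol c d (\<lambda>v. t (b # v)) w" "q2 = pol a b (\<lambda>v. t (d # v)) w"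
  define z1 z2 where "z1 = pol a d (\<lambda>u. t (x # u)) w" "z2 = pol c b (\<lambda>u. t (x # u)) w"
  define Y where "Y = pol c d (pol a b (\<lambda>v. t (x # v))) w"
  note qz = \<open>q1 = _\<close> \<open>q2 = _\<close> \<open>z1 = _\<close> \<open>z2 = _\<close> Y_def
  have IH: "pol a b (pol c d (\<lambda>v. t (x # v))) w = S * Y + r * z1 - S * v * z2"
    unfolding pqrv qz S_def by (subst Cons.IH) (simp add: if_distrib cong: if_cong)
  have L: "pol a b (pol c d t) (x # w) =
     p * (r * t (d # w) + S * C * q1) + A * (q * q2 + C * (S * Y + r * z1 - S * v * z2))"
    unfolding IH[symmetric] using s2
    by (simp add: p1 pol_add pol_scale A_def C_def pqrv qz)
  have R: "pol c d (pol a b t) (x # w) =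
     q * (v * t (b # w) + S * A * q2) + C * (p * q1 + A * Y)"
    using s1 by (simp add: p1 pol_add pol_scale A_def C_def pqrv qz)
  have B1: "(if b = c then pol a d t (x # w) else 0) = r * (p * t (d # w) + A * C * z1)"
    using s3 by (simp add: pqrv qz)
  have B2: "(if a = d then pol c b t (x # w) else 0) = v * (q * t (b # w) + A * C * z2)"
    using s4 by (simp add: pqrv qz)
  have "S * (S * z) = z" for z using SS by (simp flip: mult.assoc)
  then show ?case unfolding L R B1 B2 S_def[symmetric] by (simp add: algebra_simps)
qed

lemma pol_pol:
  "pol a b (pol c d t) = scl (super_sign a b c d) (pol c d (pol a b t))
     + (if b = c then pol a d t else 0)
     - scl (super_sign a b c d) (if a = d then pol c b t else 0)"
proof
  fix w
  show "pol a b (pol c d t) w = (scl (super_sign a b c d) (pol c d (pol a b t))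
     + (if b = c then pol a d t else 0)
     - scl (super_sign a b c d) (if a = d then pol c b t else 0)) w"
    by (subst pol_pol_pointwise) (cases "b = c"; cases "a = d"; simp)
qed

fun wact :: "(symbol \<times> symbol) list \<Rightarrow> tensor \<Rightarrow> tensor" where
  "wact [] t = t"
| "wact (p # w) t = pol (fst p) (snd p) (wact w t)"

lemma lin_wact [simp]: "lin (wact w)"
  by (induction w) (auto simp: lin_def)

lemmas wact_simps [simp] = lin_simps[OF lin_wact]

lemma wact_append: "wact (u @ w) t = wact u (wact w t)"
  by (induction u) auto

definition act :: "free_alg \<Rightarrow> tensor \<Rightarrow> tensor" where
  "act f t = (\<Sum>w\<in>Poly_Mapping.keys f. scl (Poly_Mapping.lookup f w) (wact w t))"

lemma act_superset:
  "finite K \<Longrightarrow> Poly_Mapping.keys f \<subseteq> K \<Longrightarrow>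
     act f t = (\<Sum>w\<in>K. scl (Poly_Mapping.lookup f w) (wact w t))"
  unfolding act_def by (rule sum.mono_neutral_left) (auto simp: in_keys_iff)

lemma act_add: "act (f + g) t = act f t + act g t"
proof -
  let ?K = "Poly_Mapping.keys f \<union> Poly_Mapping.keys g"
  have "act (f + g) t = (\<Sum>w\<in>?K. scl (Poly_Mapping.lookup (f + g) w) (wact w t))"
    by (rule act_superset) (auto simp: Poly_Mapping.keys_add subsetD[OF Poly_Mapping.keys_add])
  also have "\<dots> = act f t + act g t"
    by (subst (1 2) act_superset[of ?K]) (auto simp: lookup_add scl_distribs sum.distrib)
  finally show ?thesis .
qed

lemma act_single [simp]: "act (Poly_Mapping.single w c) t = scl c (wact w t)"
  by (simp add: act_def)

lemma act_0 [simp]: "act 0 t = 0"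
  by (simp add: act_def)

lemma act_one [simp]: "act 1 t = t"
  by (simp flip: single_one add: zero_list_def)

lemma act_minus: "act (- f) t = - act f t"
  using act_add[of f "- f" t] by (simp add: eq_neg_iff_add_eq_0 add.commute)

lemma act_diff: "act (f - g) t = act f t - act g t"
  using act_add[of f "- g" t] by (simp add: act_minus)

lemma act_sum: "act (\<Sum>i\<in>I. f i) t = (\<Sum>i\<in>I. act (f i) t)"
  by (induction I rule: infinite_finite_induct) (auto simp: act_add)

lemma lin_act [simp]: "lin (act f)"
  unfolding lin_def act_def by (auto simp: scl_distribs sum.distrib scl_sum mult.commute)

lemma free_alg_expand:
  "f = (\<Sum>w\<in>Poly_Mapping.keys f. Poly_Mapping.single w (Poly_Mapping.lookup f w))"
  by (rule poly_mapping_eqI) (auto simp: lookup_sum lookup_single when_def in_keys_iff)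

lemma free_alg_induct [consumes 1, case_names zero single add]:
  assumes "Poly_Mapping.keys f \<subseteq> K"
    and "P 0"
    and "\<And>w c. w \<in> K \<Longrightarrow> P (Poly_Mapping.single w c)"
    and "\<And>f g. P f \<Longrightarrow> P g \<Longrightarrow> P (f + g)"
  shows "P (f :: 'a \<Rightarrow>\<^sub>0 'b::comm_monoid_add)"
proof -
  have "finite S \<Longrightarrow> S \<subseteq> K \<Longrightarrow> P (\<Sum>w\<in>S. Poly_Mapping.single w (Poly_Mapping.lookup f w))" for S
    by (induction S rule: finite_induct) (auto intro: assms)
  from this[of "Poly_Mapping.keys f"] assms(1) show ?thesis
    by (simp flip: free_alg_expand)
qed

lemma act_mult: "act (f * g) t = act f (act g t)"
proof -
  have 1: "act (Poly_Mapping.single w c * g) t = scl c (wact w (act g t))" for w c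
  proof (rule free_alg_induct[of g UNIV "\<lambda>g. act (Poly_Mapping.single w c * g) t = scl c (wact w (act g t))"])
    fix u d
    show "act (Poly_Mapping.single w c * Poly_Mapping.single u d) t =
      scl c (wact w (act (Poly_Mapping.single u d) t))"
      by (simp add: mult_single plus_list_def wact_append mult.commute)
  next
    fix g h assume "act (Poly_Mapping.single w c * g) t = scl c (wact w (act g t))"
      "act (Poly_Mapping.single w c * h) t = scl c (wact w (act h t))"
    then show "act (Poly_Mapping.single w c * (g + h)) t = scl c (wact w (act (g + h) t))"
      by (simp add: distrib_left act_add scl_distribs)
  qed auto
  show ?thesis
    by (rule free_alg_induct[of f UNIV]) (auto simp: distrib_right act_add 1)
qed

lemma act_free_scale: "act (free_scale c f) t = scl c (act f t)"
  unfolding free_scale_def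
  using mult_map_scale_conv_mult[of c f] by (simp add: act_mult zero_list_def)

lemma act_free_gen [simp]: "act (free_gen a b) t = pol a b t"
  by (simp add: free_gen_def)

section \<open>The contravariant form\<close>

text \<open>Tensors live on words over all symbols at once, so alphabet and degree become conditions
  on the support. One action then serves every \<open>enveloping A\<close>.\<close>

definition Vec :: "symbol set \<Rightarrow> nat \<Rightarrow> tensor set" where
  "Vec B k = {t. \<forall>w. t w \<noteq> 0 \<longrightarrow> set w \<subseteq> B \<and> length w = k}"

lemma Vec_closed [simp, intro]:
  "0 \<in> Vec B k"
  "s \<in> Vec B k \<Longrightarrow> t \<in> Vec B k \<Longrightarrow> s + t \<in> Vec B k"
  "s \<in> Vec B k \<Longrightarrow> t \<in> Vec B k \<Longrightarrow> s - t \<in> Vec B k"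
  "t \<in> Vec B k \<Longrightarrow> scl c t \<in> Vec B k"
proof -
  show "0 \<in> Vec B k" by (simp add: Vec_def)
  show "scl c t \<in> Vec B k" if "t \<in> Vec B k" using that by (simp add: Vec_def)
  have *: "x + y \<noteq> 0 \<Longrightarrow> x \<noteq> 0 \<or> y \<noteq> 0" "x - y \<noteq> 0 \<Longrightarrow> x \<noteq> 0 \<or> y \<noteq> 0" for x y :: complex
    by auto
  show "s + t \<in> Vec B k" "s - t \<in> Vec B k" if "s \<in> Vec B k" "t \<in> Vec B k"
    using that *(1)[of "s _" "t _"] *(2)[of "s _" "t _"] unfolding Vec_def by (simp, blast)+
qed

lemma Vec_sum: "(\<And>i. i \<in> I \<Longrightarrow> f i \<in> Vec B k) \<Longrightarrow> (\<Sum>i\<in>I. f i) \<in> Vec B k"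
  by (induction I rule: infinite_finite_induct) auto

lemma Vec_mono: "B \<subseteq> B' \<Longrightarrow> Vec B k \<subseteq> Vec B' k"
  unfolding Vec_def by blast

lemma pol_supp:
  assumes "pol a b t w \<noteq> 0"
  shows "\<exists>i<length w. w ! i = a \<and> t (w[i := b]) \<noteq> 0"
  using assms
proof (induction w arbitrary: t)
  case (Cons x w)
  then consider "x = a" "t (b # w) \<noteq> 0" | "pol a b (\<lambda>u. t (x # u)) w \<noteq> 0"
    by (cases "pol a b (\<lambda>u. t (x # u)) w = 0") (auto split: if_splits)
  then show ?case
  proof cases
    case 1
    then show ?thesis by (intro exI[of _ 0]) auto
  next
    case 2
    from Cons.IH[OF this] obtain i where "i < length w" "w ! i = a" "t (x # w[i := b]) \<noteq> 0" by auto
    then show ?thesis by (intro exI[of _ "Suc i"]) auto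
  qed
qed auto

lemma pol_Vec:
  assumes "t \<in> Vec B k" "a \<in> B"
  shows "pol a b t \<in> Vec B k"
  unfolding Vec_def
proof (safe)
  fix w assume "pol a b t w \<noteq> 0"
  then obtain i where i: "i < length w" "w ! i = a" "t (w[i := b]) \<noteq> 0" using pol_supp by blast
  then have *: "set (w[i := b]) \<subseteq> B" "length w = k" using assms(1) unfolding Vec_def by auto
  show "length w = k" by fact
  fix x assume "x \<in> set w"
  then obtain j where j: "j < length w" "w ! j = x" by (auto simp: in_set_conv_nth)
  show "x \<in> B"
  proof (cases "j = i")
    case True then show ?thesis using i j assms by auto
  next
    case False
    then have "w[i := b] ! j = x" using j by simp
    then show ?thesis using * j by (metis length_list_update nth_mem subsetD)
  qed
qed

lemma wact_Vec: "t \<in> Vec B k \<Longrightarrow> fst ` set w \<subseteq> B \<Longrightarrow> wact w t \<in> Vec B k"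
  by (induction w) (auto intro: pol_Vec)

lemma act_Vec: "t \<in> Vec B k \<Longrightarrow> Poly_Mapping.keys f \<subseteq> lists (B \<times> C) \<Longrightarrow> act f t \<in> Vec B k"
  unfolding act_def by (intro Vec_sum Vec_closed wact_Vec) fastforce+

text \<open>The standard Hermitian form, for which the words of length k over B are orthonormal,
  unfolded at the first letter to match the recursion of \<open>pol\<close>.\<close>

primrec ip :: "symbol set \<Rightarrow> nat \<Rightarrow> tensor \<Rightarrow> tensor \<Rightarrow> complex" where
  "ip B 0 s t = s [] * cnj (t [])"
| "ip B (Suc k) s t = (\<Sum>x\<in>B. ip B k (\<lambda>w. s (x # w)) (\<lambda>w. t (x # w)))"

lemma ip_add_ptw: "ip B k (\<lambda>w. s w + t w) u = ip B k s u + ip B k t u"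
  by (induction k arbitrary: s t u) (auto simp: algebra_simps sum.distrib)

lemma ip_scale_ptw: "ip B k (\<lambda>w. c * t w) u = c * ip B k t u"
  by (induction k arbitrary: t u) (auto simp: algebra_simps sum_distrib_left)

lemma ip_cnj: "ip B k s t = cnj (ip B k t s)"
proof (induction k arbitrary: s t)
  case (Suc k)
  show ?case unfolding ip.simps cnj_sum by (intro sum.cong refl Suc)
qed simp

lemma ip_add [simp]: "ip B k (s + t) u = ip B k s u + ip B k t u"
  using ip_add_ptw by (simp add: plus_fun_def)

lemma ip_scl [simp]: "ip B k (scl c t) u = c * ip B k t u"
  using ip_scale_ptw by (simp add: scl_def)

lemma ip_add_right [simp]: "ip B k u (s + t) = ip B k u s + ip B k u t"
  by (metis complex_cnj_add ip_add ip_cnj)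

lemma ip_scl_right [simp]: "ip B k u (scl c t) = cnj c * ip B k u t"
  by (metis complex_cnj_mult ip_scl ip_cnj)

lemma ip_0 [simp]: "ip B k 0 u = 0" "ip B k u 0 = 0"
  using ip_scl[of B k 0 0 u] ip_scl_right[of B k u 0 0] by auto

lemma ip_minus [simp]: "ip B k (- t) u = - ip B k t u" "ip B k u (- t) = - ip B k u t"
  using ip_scl[of B k "-1" t u] ip_scl_right[of B k u "-1" t] by auto

lemma ip_diff [simp]: "ip B k (s - t) u = ip B k s u - ip B k t u"
  "ip B k u (s - t) = ip B k u s - ip B k u t"
  using ip_add[of B k s "- t" u] ip_add_right[of B k u s "- t"] by auto

lemma ip_sum: "ip B k (\<Sum>i\<in>I. f i) u = (\<Sum>i\<in>I. ip B k (f i) u)"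
  by (rule infinite_finite_induct[where P = "\<lambda>I. ip B k (\<Sum>i\<in>I. f i) u = (\<Sum>i\<in>I. ip B k (f i) u)"]) auto

lemma ip_pos: "finite B \<Longrightarrow> ip B k t t = complex_of_real (Re (ip B k t t)) \<and> Re (ip B k t t) \<ge> 0"
proof (induction k arbitrary: t)
  case 0
  show ?case by (simp add: complex_mult_cnj flip: complex_norm_square)
next
  case (Suc k)
  have "(\<Sum>x\<in>B. ip B k (\<lambda>w. t (x # w)) (\<lambda>w. t (x # w))) =
     (\<Sum>x\<in>B. complex_of_real (Re (ip B k (\<lambda>w. t (x # w)) (\<lambda>w. t (x # w)))))"
    using Suc by (intro sum.cong) auto
  then show ?case using Suc by (auto intro!: sum_nonneg)
qed

lemma ip_definite_ptw:
  "finite B \<Longrightarrow> ip B k t t = 0 \<Longrightarrow> set w \<subseteq> B \<Longrightarrow> length w = k \<Longrightarrow> t w = 0"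
proof (induction k arbitrary: t w)
  case (Suc k)
  then obtain x u where w: "w = x # u" by (cases w) auto
  have "(\<Sum>x\<in>B. Re (ip B k (\<lambda>w. t (x # w)) (\<lambda>w. t (x # w)))) = 0"
    using arg_cong[OF Suc.prems(2), of Re] by simp
  then have "\<forall>x\<in>B. Re (ip B k (\<lambda>w. t (x # w)) (\<lambda>w. t (x # w))) = 0"
    using Suc.prems(1) ip_pos by (subst (asm) sum_nonneg_eq_0_iff) auto
  then have "ip B k (\<lambda>w. t (x # w)) (\<lambda>w. t (x # w)) = 0"
    using Suc.prems w ip_pos[of B k "\<lambda>w. t (x # w)"] by auto
  from Suc.IH[OF _ this, of u] show ?case using Suc.prems w by auto
qed auto

lemma ip_definite:
  assumes "finite B" "ip B k t t = 0" "t \<in> Vec B k"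
  shows "t = 0"
proof
  fix w
  show "t w = 0 w" using ip_definite_ptw[OF assms(1,2), of w] assms(3) by (auto simp: Vec_def)
qed

text \<open>The Koszul sign depends only on the letters before the changed position. These are the
  same for e_{a,b} and e_{b,a}, so the adjunction holds without sign for odd operators too.\<close>

lemma ip_pol:
  assumes "finite B" "a \<in> B" "b \<in> B"
  shows "ip B k (pol a b s) t = ip B k s (pol b a t)"
proof (induction k arbitrary: s t)
  case (Suc k)
  let ?e = "\<lambda>x. (-1 :: complex) ^ ((parity a + parity b) * parity x)"
  have l: "(\<lambda>w. pol a b s (x # w)) = scl (if x = a then 1 else 0) (\<lambda>w. s (b # w)) +
     scl (?e x) (pol a b (\<lambda>w. s (x # w)))" for x
    by (auto simp: fun_eq_iff)
  have r: "(\<lambda>w. pol b a t (x # w)) = scl (if x = b then 1 else 0) (\<lambda>w. t (a # w)) +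
     scl (?e x) (pol b a (\<lambda>w. t (x # w)))" for x
    by (auto simp: fun_eq_iff add.commute)
  have d: "(\<Sum>x\<in>B. (if x = y then 1 else 0) * g x) = g y" if "y \<in> B" for y and g :: "symbol \<Rightarrow> complex"
    using that assms by (simp add: if_distrib[of "\<lambda>c. c * _"] cong: if_cong)
  have "ip B (Suc k) (pol a b s) t = ip B k (\<lambda>w. s (b # w)) (\<lambda>w. t (a # w)) +
     (\<Sum>x\<in>B. ?e x * ip B k (\<lambda>w. s (x # w)) (pol b a (\<lambda>w. t (x # w))))"
    by (simp only: ip.simps l ip_add ip_scl sum.distrib d[OF assms(2)] Suc)
  also have "\<dots> = ip B (Suc k) s (pol b a t)"
    by (simp only: ip.simps r ip_add_right ip_scl_right sum.distrib)
       (simp add: if_distrib[of "\<lambda>c. c * _"] assms if_distrib[of cnj] cong: if_cong)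
  finally show ?case .
qed simp

lemma ip_wact:
  assumes "finite B" "fst ` set w \<subseteq> B" "snd ` set w \<subseteq> B"
  shows "ip B k (wact w s) t = ip B k s (wact (rev (map prod.swap w)) t)"
  using assms(2,3) by (induction w arbitrary: t) (auto simp: ip_pol[OF assms(1)] wact_append)

text \<open>Words are reversed, their indices swapped and the coefficients conjugated. The adjoint
  is again given by an element of the free algebra, so results on central elements can be applied to
  it.\<close>

lemma act_adjoint_exists:
  assumes "finite B" "Poly_Mapping.keys f \<subseteq> lists (B \<times> B)"
  shows "\<exists>g. Poly_Mapping.keys g \<subseteq> lists (B \<times> B) \<and>
     (\<forall>k s t. ip B k (act f s) t = ip B k s (act g t))"
proof (rule free_alg_induct[OF assms(2), of "\<lambda>f. \<exists>g. Poly_Mapping.keys g \<subseteq> lists (B \<times> B) \<and>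
     (\<forall>k s t. ip B k (act f s) t = ip B k s (act g t))"])
  show "\<exists>g. Poly_Mapping.keys g \<subseteq> lists (B \<times> B) \<and>
     (\<forall>k s t. ip B k (act 0 s) t = ip B k s (act g t))"
    by (intro exI[of _ 0]) auto
next
  fix w c assume w: "w \<in> lists (B \<times> B)"
  then have "fst ` set w \<subseteq> B" "snd ` set w \<subseteq> B" by fastforce+
  moreover have "rev (map prod.swap w) \<in> lists (B \<times> B)" using w by fastforce
  ultimately show "\<exists>g. Poly_Mapping.keys g \<subseteq> lists (B \<times> B) \<and>
     (\<forall>k s t. ip B k (act (Poly_Mapping.single w c) s) t = ip B k s (act g t))"
    using ip_wact[OF assms(1), of w]
    by (intro exI[of _ "Poly_Mapping.single (rev (map prod.swap w)) (cnj c)"]) simp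
next
  fix f g
  assume "\<exists>g. Poly_Mapping.keys g \<subseteq> lists (B \<times> B) \<and>
     (\<forall>k s t. ip B k (act f s) t = ip B k s (act g t))"
   "\<exists>g'. Poly_Mapping.keys g' \<subseteq> lists (B \<times> B) \<and>
     (\<forall>k s t. ip B k (act g s) t = ip B k s (act g' t))"
  then obtain f' g' where *:
    "Poly_Mapping.keys f' \<subseteq> lists (B \<times> B)" "\<And>k s t. ip B k (act f s) t = ip B k s (act f' t)"
    "Poly_Mapping.keys g' \<subseteq> lists (B \<times> B)" "\<And>k s t. ip B k (act g s) t = ip B k s (act g' t)" by auto
  show "\<exists>g'. Poly_Mapping.keys g' \<subseteq> lists (B \<times> B) \<and>
     (\<forall>k s t. ip B k (act (f + g) s) t = ip B k s (act g' t))"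
  proof (intro exI[of _ "f' + g'"] conjI allI)
    show "Poly_Mapping.keys (f' + g') \<subseteq> lists (B \<times> B)"
      using *(1,3) Poly_Mapping.keys_add[of f' g'] by blast
  qed (simp add: act_add *(2,4))
qed

section \<open>Enveloping superalgebras as quotients of free algebras\<close>

definition free_carrier :: "symbol set \<Rightarrow> free_alg set" where
  "free_carrier A = {f. Poly_Mapping.keys f \<subseteq> lists (A \<times> A)}"

lemma free_carrier_iff: "f \<in> free_carrier A \<longleftrightarrow> Poly_Mapping.keys f \<subseteq> lists (A \<times> A)"
  by (simp add: free_carrier_def)

lemma free_algebra_simps [simp]:
  "carrier (free_algebra A) = free_carrier A"
  "mult (free_algebra A) = (*)"
  "one (free_algebra A) = 1"
  "zero (free_algebra A) = 0"
  "add (free_algebra A) = (+)"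
  by (simp_all add: free_algebra_def free_carrier_def)

lemma free_carrier_add: "f \<in> free_carrier A \<Longrightarrow> g \<in> free_carrier A \<Longrightarrow> f + g \<in> free_carrier A"
  using Poly_Mapping.keys_add[of f g] unfolding free_carrier_iff by blast

lemma free_carrier_uminus: "f \<in> free_carrier A \<Longrightarrow> - f \<in> free_carrier A"
  by (simp add: free_carrier_iff)

lemma free_carrier_diff: "f \<in> free_carrier A \<Longrightarrow> g \<in> free_carrier A \<Longrightarrow> f - g \<in> free_carrier A"
  using free_carrier_add[of f A "- g"] free_carrier_uminus by simp

lemma free_carrier_mult: "f \<in> free_carrier A \<Longrightarrow> g \<in> free_carrier A \<Longrightarrow> f * g \<in> free_carrier A"
  using keys_mult[of f g] unfolding free_carrier_iff by (fastforce simp: plus_list_def)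

lemma free_carrier_single: "w \<in> lists (A \<times> A) \<Longrightarrow> Poly_Mapping.single w c \<in> free_carrier A"
  by (simp add: free_carrier_iff)

lemma free_carrier_0: "0 \<in> free_carrier A"
  by (simp add: free_carrier_iff)

lemma free_carrier_1: "1 \<in> free_carrier A"
  by (simp flip: single_one add: zero_list_def free_carrier_iff)

lemma free_scale_eq: "free_scale c f = Poly_Mapping.single [] c * f"
  unfolding free_scale_def by (simp add: mult_map_scale_conv_mult zero_list_def)

lemma free_carrier_scale: "f \<in> free_carrier A \<Longrightarrow> free_scale c f \<in> free_carrier A"
  unfolding free_scale_eq by (intro free_carrier_mult free_carrier_single) auto

lemma free_carrier_gen: "a \<in> A \<Longrightarrow> b \<in> A \<Longrightarrow> free_gen a b \<in> free_carrier A"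
  by (simp add: free_gen_def free_carrier_iff)

lemma free_carrier_sum: "(\<And>i. i \<in> I \<Longrightarrow> f i \<in> free_carrier A) \<Longrightarrow> (\<Sum>i\<in>I. f i) \<in> free_carrier A"
  by (induction I rule: infinite_finite_induct) (simp_all add: free_carrier_add free_carrier_0)

lemmas free_carrier_intros [intro] = free_carrier_add free_carrier_uminus free_carrier_diff
  free_carrier_mult free_carrier_single free_carrier_0 free_carrier_1 free_carrier_scale
  free_carrier_gen free_carrier_sum

lemma single_Nil_commute: "Poly_Mapping.single [] c * f = f * Poly_Mapping.single [] (c :: complex)"
  for f :: free_alg
  by (rule free_alg_induct[of f UNIV "\<lambda>f. Poly_Mapping.single [] c * f = f * Poly_Mapping.single [] c"])
     (auto simp: mult_single plus_list_def distrib_left distrib_right mult.commute)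

lemma free_scale_simps:
  "free_scale c (f + g) = free_scale c f + free_scale c g"
  "free_scale (c + d) f = free_scale c f + free_scale d f"
  "free_scale c (free_scale d f) = free_scale (c * d) f"
  "free_scale 1 f = f"
  "free_scale c (f - g) = free_scale c f - free_scale c g"
  "free_scale c f * g = free_scale c (f * g)"
  "f * free_scale c g = free_scale c (f * g)"
proof -
  have 1: "Poly_Mapping.single [] 1 = (1 :: free_alg)"
    by (simp flip: single_one add: zero_list_def)
  have 2: "f * (Poly_Mapping.single [] c * g) = Poly_Mapping.single [] c * (f * g)"
    by (metis mult.assoc single_Nil_commute)
  show "free_scale c (f + g) = free_scale c f + free_scale c g"
    "free_scale (c + d) f = free_scale c f + free_scale d f"
    "free_scale c (free_scale d f) = free_scale (c * d) f"
    "free_scale 1 f = f"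
    "free_scale c (f - g) = free_scale c f - free_scale c g"
    "free_scale c f * g = free_scale c (f * g)"
    "f * free_scale c g = free_scale c (f * g)"
    unfolding free_scale_eq 2
    by (simp_all add: distrib_left distrib_right right_diff_distrib single_add 1 mult.assoc)
       (simp add: mult_single plus_list_def flip: mult.assoc)
qed

lemma ring_free_algebra: "ring (free_algebra A)"
proof (rule ringI)
  show "abelian_group (free_algebra A)"
  proof (rule abelian_groupI)
    fix x assume x: "x \<in> carrier (free_algebra A)"
    then show "\<exists>y\<in>carrier (free_algebra A). y \<oplus>\<^bsub>free_algebra A\<^esub> x = \<zero>\<^bsub>free_algebra A\<^esub>"
      by (intro bexI[of _ "- x"]) (auto simp: free_carrier_uminus)
  qed (auto simp: add.assoc add.commute)
  show "monoid (free_algebra A)"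
    by (rule monoidI) (auto simp: mult.assoc)
qed (auto simp: distrib_left distrib_right)

definition env_relations :: "symbol set \<Rightarrow> free_alg set" where
  "env_relations A =
       {free_gen a b * free_gen c d
          - free_scale (super_sign a b c d) (free_gen c d * free_gen a b)
          - superbracket a b c d | a b c d. {a, b, c, d} \<subseteq> A}"

lemma superbracket_carrier: "{a, b, c, d} \<subseteq> A \<Longrightarrow> superbracket a b c d \<in> free_carrier A"
  unfolding superbracket_def by auto

lemma env_relations_carrier: "env_relations A \<subseteq> free_carrier A"
  unfolding env_relations_def by (auto intro!: free_carrier_intros superbracket_carrier)

lemma enveloping_ideal_ideal: "ideal (enveloping_ideal A) (free_algebra A)"
  unfolding enveloping_ideal_def env_relations_def[symmetric]
  by (rule ring.genideal_ideal[OF ring_free_algebra]) (simp add: env_relations_carrier)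

lemma env_relations_ideal: "env_relations A \<subseteq> enveloping_ideal A"
  unfolding enveloping_ideal_def env_relations_def[symmetric]
  by (rule ring.genideal_self[OF ring_free_algebra]) (simp add: env_relations_carrier)

lemma enveloping_ideal_minimal:
  "ideal J (free_algebra A) \<Longrightarrow> env_relations A \<subseteq> J \<Longrightarrow> enveloping_ideal A \<subseteq> J"
  unfolding enveloping_ideal_def env_relations_def[symmetric]
  by (rule ring.genideal_minimal[OF ring_free_algebra])

lemma ideal_carrier: "f \<in> enveloping_ideal A \<Longrightarrow> f \<in> free_carrier A"
  using ideal.Icarr[OF enveloping_ideal_ideal, of f A] by simp

lemma ideal_add: "f \<in> enveloping_ideal A \<Longrightarrow> g \<in> enveloping_ideal A \<Longrightarrow> f + g \<in> enveloping_ideal A"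
  using additive_subgroup.a_closed[OF ideal.axioms(1)[OF enveloping_ideal_ideal], of f A g] by simp

lemma ideal_0: "0 \<in> enveloping_ideal A"
  using additive_subgroup.zero_closed[OF ideal.axioms(1)[OF enveloping_ideal_ideal], of A] by simp

lemma ideal_mult_left: "f \<in> enveloping_ideal A \<Longrightarrow> g \<in> free_carrier A \<Longrightarrow> g * f \<in> enveloping_ideal A"
  using ideal.I_l_closed[OF enveloping_ideal_ideal, of f A g] by simp

lemma ideal_mult_right: "f \<in> enveloping_ideal A \<Longrightarrow> g \<in> free_carrier A \<Longrightarrow> f * g \<in> enveloping_ideal A"
  using ideal.I_r_closed[OF enveloping_ideal_ideal, of f A g] by simp

lemma ideal_scale: "f \<in> enveloping_ideal A \<Longrightarrow> free_scale c f \<in> enveloping_ideal A"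
  unfolding free_scale_eq by (intro ideal_mult_left) auto

lemma ideal_uminus: "f \<in> enveloping_ideal A \<Longrightarrow> - f \<in> enveloping_ideal A"
  using ideal_mult_left[of f A "-1"] free_carrier_uminus[OF free_carrier_1, of A] by simp

lemma ideal_diff: "f \<in> enveloping_ideal A \<Longrightarrow> g \<in> enveloping_ideal A \<Longrightarrow> f - g \<in> enveloping_ideal A"
  using ideal_add[of f A "- g"] ideal_uminus by simp

text \<open>The elements that act by zero on all tensors form an ideal, and \<open>pol_pol\<close>
  puts the defining relations into it.\<close>

lemma enveloping_ideal_act:
  assumes "f \<in> enveloping_ideal A"
  shows "act f t = 0"
proof -
  let ?J = "{f \<in> free_carrier A. \<forall>t. act f t = 0}"
  have "ideal ?J (free_algebra A)"
  proof (rule idealI[OF ring_free_algebra])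
    show "subgroup ?J (add_monoid (free_algebra A))"
    proof
      fix x assume "x \<in> ?J"
      moreover have "inv\<^bsub>add_monoid (free_algebra A)\<^esub> x = - x" if "x \<in> free_carrier A"
        using abelian_group.minus_equality[OF ring.is_abelian_group[OF ring_free_algebra], of A "- x" x] that
        unfolding a_inv_def by (simp del: monoid_record_simps add: free_carrier_uminus)
      ultimately show "inv\<^bsub>add_monoid (free_algebra A)\<^esub> x \<in> ?J"
        by (auto simp: act_minus)
    qed (auto simp: act_add)
  qed (auto simp: act_mult lin_0)
  moreover have "env_relations A \<subseteq> ?J"
  proof
    fix x assume x: "x \<in> env_relations A"
    then obtain a b c d where "x = free_gen a b * free_gen c d
          - free_scale (super_sign a b c d) (free_gen c d * free_gen a b)
          - superbracket a b c d" unfolding env_relations_def by blast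
    then have "act x t = 0" for t
      unfolding \<open>x = _\<close> act_diff act_mult act_free_scale superbracket_def act_free_gen pol_pol[of a b c d]
      by (simp add: act_free_scale if_distrib[of "\<lambda>f. act f t"])
    then show "x \<in> ?J" using x env_relations_carrier by blast
  qed
  ultimately have "enveloping_ideal A \<subseteq> ?J" by (rule enveloping_ideal_minimal)
  then show ?thesis using assms by blast
qed

section \<open>Computing with cosets through representatives\<close>

definition cl :: "symbol set \<Rightarrow> free_alg \<Rightarrow> free_alg set" where
  "cl A f = enveloping_ideal A +>\<^bsub>free_algebra A\<^esub> f"

lemma cl_explicit: "cl A f = {g + f | g. g \<in> enveloping_ideal A}"
  unfolding cl_def a_r_coset_def' by auto

lemma mem_cl: "x \<in> cl A f \<longleftrightarrow> x - f \<in> enveloping_ideal A"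
  unfolding cl_explicit by (auto intro!: exI[of _ "x - f"])

lemma mem_set_add: "x \<in> H <+>\<^bsub>free_algebra A\<^esub> K \<longleftrightarrow> (\<exists>h\<in>H. \<exists>k\<in>K. x = h + k)"
  unfolding set_add_def' by auto

lemma cl_eqI: "f - g \<in> enveloping_ideal A \<Longrightarrow> cl A f = cl A g"
  unfolding cl_explicit
proof safe
  fix h assume "f - g \<in> enveloping_ideal A" "h \<in> enveloping_ideal A"
  then show "\<exists>k. h + f = k + g \<and> k \<in> enveloping_ideal A" "\<exists>k. h + g = k + f \<and> k \<in> enveloping_ideal A"
    using ideal_add[of h A "f - g"] ideal_diff[of h A "f - g"]
    by (force intro: exI[of _ "h + (f - g)"] exI[of _ "h - (f - g)"])+
qed

lemma cl_eq_iff: "cl A f = cl A g \<longleftrightarrow> f - g \<in> enveloping_ideal A"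
proof
  assume "cl A f = cl A g"
  moreover have "f \<in> cl A f" unfolding cl_explicit using ideal_0[of A] by force
  ultimately obtain k where "f = k + g" "k \<in> enveloping_ideal A" unfolding cl_explicit by blast
  then show "f - g \<in> enveloping_ideal A" by simp
qed (rule cl_eqI)

lemma enveloping_fields:
  "carrier (enveloping A) = a_rcosets\<^bsub>free_algebra A\<^esub> (enveloping_ideal A)"
  "mult (enveloping A) = rcoset_mult (free_algebra A) (enveloping_ideal A)"
  "one (enveloping A) = enveloping_ideal A +>\<^bsub>free_algebra A\<^esub> 1"
  "zero (enveloping A) = enveloping_ideal A"
  "add (enveloping A) = set_add (free_algebra A)"
  "c \<odot>\<^bsub>enveloping A\<^esub> X = enveloping_ideal A <+>\<^bsub>free_algebra A\<^esub> (free_scale c ` X)"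
  by (simp_all add: enveloping_def ring.defs module.defs FactRing_def)

lemma carrier_enveloping: "carrier (enveloping A) = cl A ` free_carrier A"
  unfolding enveloping_fields A_RCOSETS_def' cl_def by auto

lemma cl_carrier [intro]: "f \<in> free_carrier A \<Longrightarrow> cl A f \<in> carrier (enveloping A)"
  by (auto simp: carrier_enveloping)

lemma cl_mult: "f \<in> free_carrier A \<Longrightarrow> g \<in> free_carrier A \<Longrightarrow>
    cl A f \<otimes>\<^bsub>enveloping A\<^esub> cl A g = cl A (f * g)"
  unfolding enveloping_fields cl_def
  using ideal.rcoset_mult_add[OF enveloping_ideal_ideal, of f A g] by simp

lemma cl_add: "cl A f \<oplus>\<^bsub>enveloping A\<^esub> cl A g = cl A (f + g)"
proof (rule Set.set_eqI)
  fix x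
  have "x - (f + g) \<in> enveloping_ideal A \<longleftrightarrow>
     (\<exists>h k. h - f \<in> enveloping_ideal A \<and> k - g \<in> enveloping_ideal A \<and> x = h + k)"
  proof
    assume "x - (f + g) \<in> enveloping_ideal A"
    then show "\<exists>h k. h - f \<in> enveloping_ideal A \<and> k - g \<in> enveloping_ideal A \<and> x = h + k"
      by (intro exI[of _ "x - g"] exI[of _ g]) (simp add: ideal_0 algebra_simps)
  next
    assume "\<exists>h k. h - f \<in> enveloping_ideal A \<and> k - g \<in> enveloping_ideal A \<and> x = h + k"
    then obtain h k where "h - f \<in> enveloping_ideal A" "k - g \<in> enveloping_ideal A" "x = h + k" by blast
    then show "x - (f + g) \<in> enveloping_ideal A"
      using ideal_add[of "h - f" A "k - g"] by (simp add: algebra_simps)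
  qed
  then show "x \<in> cl A f \<oplus>\<^bsub>enveloping A\<^esub> cl A g \<longleftrightarrow> x \<in> cl A (f + g)"
    unfolding enveloping_fields mem_set_add Bex_def image_iff mem_cl by blast
qed

lemma cl_one: "\<one>\<^bsub>enveloping A\<^esub> = cl A 1"
  by (simp add: enveloping_fields cl_def)

lemma cl_zero: "\<zero>\<^bsub>enveloping A\<^esub> = cl A 0"
  by (simp add: enveloping_fields cl_explicit)

lemma cl_smult: "c \<odot>\<^bsub>enveloping A\<^esub> cl A f = cl A (free_scale c f)"
proof (rule Set.set_eqI)
  fix x
  have "x - free_scale c f \<in> enveloping_ideal A \<longleftrightarrow>
     (\<exists>h k. h \<in> enveloping_ideal A \<and> k - f \<in> enveloping_ideal A \<and> x = h + free_scale c k)"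
  proof
    assume "x - free_scale c f \<in> enveloping_ideal A"
    then show "\<exists>h k. h \<in> enveloping_ideal A \<and> k - f \<in> enveloping_ideal A \<and> x = h + free_scale c k"
      by (intro exI[of _ "x - free_scale c f"] exI[of _ f]) (simp add: ideal_0)
  next
    assume "\<exists>h k. h \<in> enveloping_ideal A \<and> k - f \<in> enveloping_ideal A \<and> x = h + free_scale c k"
    then obtain h k where "h \<in> enveloping_ideal A" "k - f \<in> enveloping_ideal A" "x = h + free_scale c k" by blast
    then show "x - free_scale c f \<in> enveloping_ideal A"
      using ideal_add[of h A "free_scale c (k - f)"] ideal_scale[of "k - f" A c]
      by (simp add: free_scale_simps algebra_simps)
  qed
  then show "x \<in> c \<odot>\<^bsub>enveloping A\<^esub> cl A f \<longleftrightarrow> x \<in> cl A (free_scale c f)"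
    unfolding enveloping_fields mem_set_add Bex_def image_iff mem_cl by blast
qed

lemma enveloping_cases [consumes 1]:
  assumes "x \<in> carrier (enveloping A)"
  obtains f where "f \<in> free_carrier A" "x = cl A f"
  using assms by (auto simp: carrier_enveloping)

lemma ring_enveloping: "ring (enveloping A)"
proof (rule ringI)
  show "abelian_group (enveloping A)"
  proof (rule abelian_groupI)
    fix x assume "x \<in> carrier (enveloping A)"
    then show "\<exists>y\<in>carrier (enveloping A). y \<oplus>\<^bsub>enveloping A\<^esub> x = \<zero>\<^bsub>enveloping A\<^esub>"
    proof (cases rule: enveloping_cases)
      case (1 f)
      then show ?thesis
        by (intro bexI[of _ "cl A (- f)"] cl_carrier free_carrier_uminus) (simp_all add: cl_add cl_zero)
    qed
  qed (auto simp: cl_add cl_zero add_ac intro!: cl_carrier elim!: enveloping_cases)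
  show "monoid (enveloping A)"
    by (rule monoidI)
       (auto simp: cl_mult cl_one free_carrier_intros mult.assoc intro!: cl_carrier elim!: enveloping_cases)
qed (auto simp: cl_add cl_mult free_carrier_intros distrib_left distrib_right elim!: enveloping_cases)

lemma cl_minus:
  assumes "f \<in> free_carrier A" "g \<in> free_carrier A"
  shows "cl A f \<ominus>\<^bsub>enveloping A\<^esub> cl A g = cl A (f - g)"
proof -
  interpret ring "enveloping A" by (rule ring_enveloping)
  have "\<ominus>\<^bsub>enveloping A\<^esub> cl A g = cl A (- g)"
    by (rule minus_equality) (use assms in \<open>auto simp: cl_add cl_zero\<close>)
  then show ?thesis by (simp add: a_minus_def cl_add)
qed

lemma cl_finsum:
  assumes "\<And>i. i \<in> I \<Longrightarrow> f i \<in> free_carrier A"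
  shows "(\<Oplus>\<^bsub>enveloping A\<^esub>i\<in>I. cl A (f i)) = cl A (\<Sum>i\<in>I. f i)"
proof -
  interpret ring "enveloping A" by (rule ring_enveloping)
  show ?thesis using assms
  proof (induction I rule: infinite_finite_induct)
    case (insert x F)
    then have "cl A (f x) \<in> carrier (enveloping A)" "\<And>i. i \<in> F \<Longrightarrow> cl A (f i) \<in> carrier (enveloping A)"
      by auto
    then show ?case using insert by (simp add: finsum_insert Pi_def cl_add)
  qed (simp_all add: cl_zero finsum_infinite)
qed

text \<open>The ideal of the larger alphabet, cut down to the smaller free algebra, is an ideal
  containing the smaller relations. Hence \<open>embed\<close> may be computed on
  representatives.\<close>

lemma enveloping_ideal_mono:
  assumes "A \<subseteq> B"
  shows "enveloping_ideal A \<subseteq> enveloping_ideal B"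
proof -
  let ?J = "enveloping_ideal B \<inter> free_carrier A"
  have "ideal ?J (free_algebra A)"
  proof (rule idealI[OF ring_free_algebra])
    show "subgroup ?J (add_monoid (free_algebra A))"
    proof
      fix x assume "x \<in> ?J"
      moreover have "inv\<^bsub>add_monoid (free_algebra A)\<^esub> x = - x" if "x \<in> free_carrier A"
        using abelian_group.minus_equality[OF ring.is_abelian_group[OF ring_free_algebra], of A "- x" x] that
        unfolding a_inv_def by (simp del: monoid_record_simps add: free_carrier_uminus)
      ultimately show "inv\<^bsub>add_monoid (free_algebra A)\<^esub> x \<in> ?J"
        by (auto simp: ideal_uminus)
    next
      fix x y assume "x \<in> ?J" "y \<in> ?J"
      then show "x \<otimes>\<^bsub>add_monoid (free_algebra A)\<^esub> y \<in> ?J"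
        using free_carrier_add[of x A y] by (auto intro: ideal_add)
    qed (auto simp: ideal_0)
    have le: "free_carrier A \<subseteq> free_carrier B" using assms unfolding free_carrier_def by fastforce
    fix a x assume "a \<in> ?J" "x \<in> carrier (free_algebra A)"
    then show "x \<otimes>\<^bsub>free_algebra A\<^esub> a \<in> ?J" "a \<otimes>\<^bsub>free_algebra A\<^esub> x \<in> ?J"
      using free_carrier_mult[of x A a] free_carrier_mult[of a A x] le ideal_mult_left[of a B x]
        ideal_mult_right[of a B x] by auto
  qed
  moreover have "env_relations A \<subseteq> ?J"
    using env_relations_carrier[of A] env_relations_ideal[of B] assms
    by (fastforce simp: env_relations_def)
  ultimately show ?thesis using enveloping_ideal_minimal by blast
qed

lemma embed_cl:
  assumes "f \<in> free_carrier (proper_symbols n)"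
  shows "embed m0 m1 n (cl (proper_symbols n) f) = cl (all_symbols m0 m1 n) f"
proof -
  have le: "enveloping_ideal (proper_symbols n) \<subseteq> enveloping_ideal (all_symbols m0 m1 n)"
    by (rule enveloping_ideal_mono) (auto simp: all_symbols_def)
  show ?thesis
  proof (rule Set.set_eqI)
    fix x
    have "x - f \<in> enveloping_ideal (all_symbols m0 m1 n) \<longleftrightarrow>
       (\<exists>h k. h \<in> enveloping_ideal (all_symbols m0 m1 n) \<and> k - f \<in> enveloping_ideal (proper_symbols n) \<and> x = h + k)"
    proof
      assume "x - f \<in> enveloping_ideal (all_symbols m0 m1 n)"
      then show "\<exists>h k. h \<in> enveloping_ideal (all_symbols m0 m1 n) \<and> k - f \<in> enveloping_ideal (proper_symbols n) \<and> x = h + k"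
        by (intro exI[of _ "x - f"] exI[of _ f]) (simp add: ideal_0)
    next
      assume "\<exists>h k. h \<in> enveloping_ideal (all_symbols m0 m1 n) \<and> k - f \<in> enveloping_ideal (proper_symbols n) \<and> x = h + k"
      then obtain h k where "h \<in> enveloping_ideal (all_symbols m0 m1 n)"
        "k - f \<in> enveloping_ideal (proper_symbols n)" "x = h + k" by blast
      then show "x - f \<in> enveloping_ideal (all_symbols m0 m1 n)"
        using ideal_add[of h "all_symbols m0 m1 n" "k - f"] le by (auto simp: algebra_simps)
    qed
    then show "x \<in> embed m0 m1 n (cl (proper_symbols n) f) \<longleftrightarrow> x \<in> cl (all_symbols m0 m1 n) f"
      unfolding embed_def mem_set_add Bex_def image_iff mem_cl by blast
  qed
qed

abbreviation mono :: "(symbol \<times> symbol) list \<Rightarrow> free_alg" where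
  "mono w \<equiv> Poly_Mapping.single w 1"

lemma env_prod_cl: "set w \<subseteq> A \<times> A \<Longrightarrow> env_prod A w = cl A (mono w)"
proof (induction w)
  case Nil
  show ?case by (simp add: env_prod_def cl_one flip: single_one) (simp add: zero_list_def)
next
  case (Cons p w)
  obtain a b where p: "p = (a, b)" by (cases p)
  have w: "w \<in> lists (A \<times> A)" using Cons by auto
  have "env_prod A (p # w) = cl A (free_gen a b) \<otimes>\<^bsub>enveloping A\<^esub> env_prod A w"
    by (simp add: env_prod_def p env_gen_def cl_def)
  also have "\<dots> = cl A (free_gen a b * mono w)"
    using Cons w p by (subst Cons.IH) (auto intro!: cl_mult)
  finally show ?case by (simp add: free_gen_def mult_single plus_list_def p)
qed

section \<open>Faithfulness on tensors\<close>

definition basis_tensor :: "symbol list \<Rightarrow> tensor" where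
  "basis_tensor s = (\<lambda>u. if u = s then 1 else 0)"

lemma basis_tensor_Vec: "set s \<subseteq> B \<Longrightarrow> basis_tensor s \<in> Vec B (length s)"
  by (auto simp: basis_tensor_def Vec_def split: if_splits)

text \<open>All ways to distribute the letters of a word, in order, over two tensor factors: the
  coproduct of a product of primitive elements. \<open>proper_splits\<close> omits the way that
  leaves the first factor untouched.\<close>

fun splits :: "'a list \<Rightarrow> ('a list \<times> 'a list) list" where
  "splits [] = [([], [])]"
| "splits (p # w) = map (\<lambda>(u, v). (p # u, v)) (splits w) @ map (\<lambda>(u, v). (u, p # v)) (splits w)"

fun proper_splits :: "'a list \<Rightarrow> ('a list \<times> 'a list) list" where
  "proper_splits [] = []"
| "proper_splits (p # w) = map (\<lambda>(u, v). (p # u, v)) (splits w) @ map (\<lambda>(u, v). (u, p # v)) (proper_splits w)"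

lemma sum_list_splits:
  "sum_list (map f (splits w)) = (f ([], w) :: 'b :: comm_monoid_add) + sum_list (map f (proper_splits w))"
  by (induction w arbitrary: f) (simp_all add: comp_def case_prod_unfold add_ac)

lemma length_splits: "x \<in> set (splits w) \<Longrightarrow> length (fst x) + length (snd x) = length w"
  by (induction w arbitrary: x) auto

lemma length_proper_splits: "x \<in> set (proper_splits w) \<Longrightarrow> length (snd x) < length w"
proof (induction w arbitrary: x)
  case (Cons p w)
  then show ?case using length_splits[of _ w] by fastforce
qed auto

text \<open>The (i, j) entry of the product of the matrix units in the word, i.e. its action on
  tensors of degree 1.\<close>

fun path_coeff :: "symbol \<Rightarrow> (symbol \<times> symbol) list \<Rightarrow> symbol \<Rightarrow> complex" where
  "path_coeff i [] j = (if i = j then 1 else 0)"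
| "path_coeff i (p # w) j = (if i = fst p then path_coeff (snd p) w j else 0)"

definition matrix_coeff :: "(symbol \<times> symbol) list \<Rightarrow> symbol list \<Rightarrow> symbol list \<Rightarrow> complex" where
  "matrix_coeff w s t = wact w (basis_tensor t) s"

definition odd_symbols :: "symbol set" where
  "odd_symbols = {x. parity x = 1}"

text \<open>Between odd symbols every e_{a,b} is even, so no sign occurs and the first letter and
  the remaining ones are acted on through the plain coproduct.\<close>

lemma slice_wact:
  assumes "set w \<subseteq> odd_symbols \<times> odd_symbols"
  shows "wact w (basis_tensor (j # t)) (i # s) =
     (\<Sum>x\<leftarrow>splits w. path_coeff i (fst x) j * wact (snd x) (basis_tensor t) s)"
  using assms
proof (induction w arbitrary: i s)
  case Nil
  then show ?case by (auto simp: basis_tensor_def)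
next
  case (Cons p w)
  obtain a b where p: "p = (a, b)" by (cases p)
  have par: "parity a = 1" "parity b = 1" using Cons p by (auto simp: odd_symbols_def)
  have IH: "(\<lambda>s. wact w (basis_tensor (j # t)) (i # s)) =
     (\<Sum>x\<leftarrow>splits w. scl (path_coeff i (fst x) j) (wact (snd x) (basis_tensor t)))" for i
    using Cons by (simp add: fun_eq_iff sum_list_tensor_apply)
  have e: "pol a b F (i # s) = (if i = a then F (b # s) else 0) + pol a b (\<lambda>u. F (i # u)) s" for F
    by (simp add: par)
  have "wact (p # w) (basis_tensor (j # t)) (i # s) =
     (if i = a then \<Sum>x\<leftarrow>splits w. path_coeff b (fst x) j * wact (snd x) (basis_tensor t) s else 0) +
     (\<Sum>x\<leftarrow>splits w. path_coeff i (fst x) j * pol a b (wact (snd x) (basis_tensor t)) s)"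
    using fun_cong[OF IH, of b s]
    by (simp only: wact.simps p fst_conv snd_conv e IH lin_sum_list[OF lin_pol])
       (simp add: sum_list_tensor_apply)
  then show ?case by (simp add: p comp_def case_prod_unfold)
qed

fun probe :: "(symbol \<times> symbol) list \<Rightarrow> (complex \<times> symbol list \<times> symbol list) list" where
  "probe [] = [(1, [], [])]"
| "probe (p # ps) = map (\<lambda>(k, s, t). (k, fst p # s, snd p # t)) (probe ps) @
     map (\<lambda>(k, s, t). (if fst p = snd p then - k else 0, s, t)) (probe ps)"

text \<open>The matrix coefficient of \<open>w\<close> with row and column indices read off \<open>ps\<close>, from which \<open>probe\<close>
  removes, by inclusion and exclusion, the terms where some tensor factor is left untouched. Words
  shorter than \<open>ps\<close> contribute zero, and words of the same length only through their multiset of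
  letters.\<close>

definition symbol_coeff :: "(symbol \<times> symbol) list \<Rightarrow> (symbol \<times> symbol) list \<Rightarrow> complex" where
  "symbol_coeff w ps = (\<Sum>x\<leftarrow>probe ps. fst x * matrix_coeff w (fst (snd x)) (snd (snd x)))"

lemma probe_length:
  "x \<in> set (probe ps) \<Longrightarrow> length (fst (snd x)) = length (snd (snd x)) \<and> length (snd (snd x)) \<le> length ps
     \<and> set (snd (snd x)) \<subseteq> snd ` set ps"
  by (induction ps arbitrary: x) force+

lemma symbol_coeff_Nil: "symbol_coeff w [] = (if w = [] then 1 else 0)"
  by (cases w) (auto simp: symbol_coeff_def matrix_coeff_def basis_tensor_def)

text \<open>The term that \<open>probe\<close> subtracts is the splitting with empty first
  component, whose path coefficient is 1 or 0 according to whether the two indices agree. The proper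
  splittings remain.\<close>

lemma symbol_coeff_Cons:
  assumes "set w \<subseteq> odd_symbols \<times> odd_symbols"
  shows "symbol_coeff w (p # ps) =
     (\<Sum>x\<leftarrow>proper_splits w. path_coeff (fst p) (fst x) (snd p) * symbol_coeff (snd x) ps)"
proof -
  have m: "matrix_coeff w (i # s) (j # t) = (if i = j then matrix_coeff w s t else 0) +
     (\<Sum>x\<leftarrow>proper_splits w. path_coeff i (fst x) j * matrix_coeff (snd x) s t)" for i j s t
    unfolding matrix_coeff_def using slice_wact[OF assms, of j t i s]
    by (simp add: sum_list_splits)
  have swap: "(\<Sum>x\<leftarrow>l. c x * (\<Sum>y\<leftarrow>l'. d y * F x y)) = (\<Sum>y\<leftarrow>l'. d y * (\<Sum>x\<leftarrow>l. c x * F x y))"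
    for l :: "'x list" and l' :: "'y list" and c d and F :: "'x \<Rightarrow> 'y \<Rightarrow> complex"
    by (induction l) (auto simp: distrib_left sum_list_const_mult sum_list_addf mult_ac)
  have "symbol_coeff w (p # ps) = (\<Sum>y\<leftarrow>probe ps. fst y *
      (matrix_coeff w (fst p # fst (snd y)) (snd p # snd (snd y)) -
       (if fst p = snd p then matrix_coeff w (fst (snd y)) (snd (snd y)) else 0)))"
  proof -
    have "(\<Sum>x\<leftarrow>map (\<lambda>(k, s, t). (k, fst p # s, snd p # t)) l @
        map (\<lambda>(k, s, t). (if fst p = snd p then - k else 0, s, t)) l.
        fst x * matrix_coeff w (fst (snd x)) (snd (snd x))) =
      (\<Sum>y\<leftarrow>l. fst y *
      (matrix_coeff w (fst p # fst (snd y)) (snd p # snd (snd y)) -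
       (if fst p = snd p then matrix_coeff w (fst (snd y)) (snd (snd y)) else 0)))" for l
      by (induction l) (auto simp: algebra_simps)
    then show ?thesis unfolding symbol_coeff_def probe.simps .
  qed
  also have "\<dots> = (\<Sum>y\<leftarrow>probe ps. fst y * (\<Sum>x\<leftarrow>proper_splits w. path_coeff (fst p) (fst x) (snd p) *
      matrix_coeff (snd x) (fst (snd y)) (snd (snd y))))"
    by (simp add: m)
  also have "\<dots> = (\<Sum>x\<leftarrow>proper_splits w. path_coeff (fst p) (fst x) (snd p) * symbol_coeff (snd x) ps)"
    unfolding symbol_coeff_def by (rule swap)
  finally show ?thesis .
qed

lemma set_splits:
  "x \<in> set (splits w) \<Longrightarrow> set (snd x) \<subseteq> set w"
  "x \<in> set (proper_splits w) \<Longrightarrow> set (snd x) \<subseteq> set w"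
proof (induction w arbitrary: x)
  case (Cons p w)
  { case 1 then show ?case using Cons by fastforce }
  { case 2 then show ?case using Cons by fastforce }
qed auto

text \<open>Every letter of \<open>ps\<close> consumes at least one letter of \<open>w\<close>, by
  the recursion over proper splittings.\<close>

lemma symbol_coeff_short:
  assumes "set w \<subseteq> odd_symbols \<times> odd_symbols" "length w < length ps"
  shows "symbol_coeff w ps = 0"
  using assms
proof (induction ps arbitrary: w)
  case (Cons p ps)
  have "symbol_coeff (snd x) ps = 0" if "x \<in> set (proper_splits w)" for x
    using Cons length_proper_splits[OF that] set_splits(2)[OF that] by (intro Cons.IH) auto
  then show ?case unfolding symbol_coeff_Cons[OF Cons.prems(1)]
    by (simp cong: map_cong)
qed auto

text \<open>Splittings that take out two or more letters are annihilated by \<open>G\<close>; for a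
  single letter the path coefficient tests whether it is \<open>(i, j)\<close>.\<close>

lemma sum_proper_splits_single:
  assumes "\<And>v. Suc (length v) < length w \<Longrightarrow> set v \<subseteq> set w \<Longrightarrow> G v = 0"
  shows "(\<Sum>x\<leftarrow>proper_splits w. path_coeff i (fst x) j * G (snd x)) =
     (\<Sum>k<length w. if w ! k = (i, j) then G (take k w @ drop (Suc k) w) else 0)"
  using assms
proof (induction w arbitrary: G)
  case (Cons p w)
  have "(\<Sum>x\<leftarrow>proper_splits w. path_coeff i (fst x) j * G (p # snd x)) =
     (\<Sum>k<length w. if w ! k = (i, j) then G (p # take k w @ drop (Suc k) w) else 0)"
    by (rule Cons.IH) (auto intro!: Cons.prems)
  moreover have "G (snd x) = 0" if "x \<in> set (proper_splits w)" for x
    using length_proper_splits[OF that] set_splits(2)[OF that] by (intro Cons.prems) auto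
  then have "(\<Sum>x\<leftarrow>splits w. path_coeff i (p # fst x) j * G (snd x)) = path_coeff i [p] j * G w"
    by (simp add: sum_list_splits cong: map_cong)
  ultimately show ?case
    by (cases p) (auto simp: comp_def case_prod_unfold sum.lessThan_Suc_shift simp del: sum.lessThan_Suc cong: if_cong)
qed simp

text \<open>The product of the factorials of the multiplicities, i.e. the number of permutations of
  positions that fix the list.\<close>

fun orbit_weight :: "'a list \<Rightarrow> nat" where
  "orbit_weight [] = 1"
| "orbit_weight (p # ps) = count (mset (p # ps)) p * orbit_weight ps"

lemma orbit_weight_pos: "orbit_weight ps > 0"
  by (induction ps) auto

lemma card_nth_eq: "card {k. k < length w \<and> w ! k = p} = count (mset w) p"
  by (simp add: count_mset count_list_eq_length_filter length_filter_conv_card eq_commute[of p])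

text \<open>With equal lengths each letter of \<open>ps\<close> consumes exactly one letter of
  \<open>w\<close>, so the coefficient counts the bijections between equal letters.\<close>

lemma symbol_coeff_full:
  assumes "set w \<subseteq> odd_symbols \<times> odd_symbols" "length w = length ps"
  shows "symbol_coeff w ps = (if mset w = mset ps then of_nat (orbit_weight ps) else 0)"
  using assms
proof (induction ps arbitrary: w)
  case Nil
  then show ?case by (simp add: symbol_coeff_Nil)
next
  case (Cons p ps)
  let ?d = "\<lambda>k. take k w @ drop (Suc k) w"
  have d: "mset w = add_mset (w ! k) (mset (?d k))" "length (?d k) = length ps"
    "set (?d k) \<subseteq> odd_symbols \<times> odd_symbols" if "k < length w" for k
  proof -
    show "mset w = add_mset (w ! k) (mset (?d k))"
      using id_take_nth_drop[OF that] by (metis mset_append union_mset_add_mset_right mset.simps(2))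
    show "length (?d k) = length ps" using that Cons.prems by simp
    show "set (?d k) \<subseteq> odd_symbols \<times> odd_symbols"
      using Cons.prems(1) set_take_subset[of k w] set_drop_subset[of "Suc k" w] by auto
  qed
  have "symbol_coeff w (p # ps) = (\<Sum>k<length w. if w ! k = p then symbol_coeff (?d k) ps else 0)"
    unfolding symbol_coeff_Cons[OF Cons.prems(1)] using Cons.prems
    by (subst sum_proper_splits_single) (auto intro!: symbol_coeff_short)
  also have "\<dots> = (\<Sum>k<length w. if w ! k = p then
      (if mset w = mset (p # ps) then of_nat (orbit_weight ps) else 0) else 0)"
    by (intro sum.cong refl) (use d Cons.IH in auto)
  also have "\<dots> = (if mset w = mset (p # ps) then of_nat (orbit_weight ps * card {k. k < length w \<and> w ! k = p}) else 0)"
    by (simp flip: sum.inter_filter add: lessThan_def)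
  finally show ?case by (simp add: card_nth_eq mult.commute)
qed

text \<open>The bound is strict, so that \<open>short A 0\<close> is the zero space and inductions
  on the degree can start there. Degree at most m is \<open>short A (Suc m)\<close>.\<close>

definition short :: "symbol set \<Rightarrow> nat \<Rightarrow> free_alg set" where
  "short A k = {f \<in> free_carrier A. \<forall>w\<in>Poly_Mapping.keys f. length w < k}"

lemma short_0: "short A 0 = {0}"
  by (auto simp: short_def free_carrier_0 keys_eq_empty[symmetric] simp del: keys_eq_empty)

lemma short_add: "f \<in> short A k \<Longrightarrow> g \<in> short A k \<Longrightarrow> f + g \<in> short A k"
  using Poly_Mapping.keys_add[of f g] unfolding short_def by fastforce

lemma short_zero: "0 \<in> short A k"
  by (auto simp: short_def free_carrier_0)

lemma short_sum: "(\<And>i. i \<in> I \<Longrightarrow> f i \<in> short A k) \<Longrightarrow> (\<Sum>i\<in>I. f i) \<in> short A k"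
  by (induction I rule: infinite_finite_induct) (auto simp: short_add short_zero)

lemma short_mono: "f \<in> short A k \<Longrightarrow> k \<le> l \<Longrightarrow> f \<in> short A l"
  unfolding short_def by force

lemma short_mult: "f \<in> short A (Suc k) \<Longrightarrow> g \<in> short A (Suc l) \<Longrightarrow> f * g \<in> short A (Suc (k + l))"
proof -
  assume *: "f \<in> short A (Suc k)" "g \<in> short A (Suc l)"
  have "length w < Suc (k + l)" if "w \<in> Poly_Mapping.keys (f * g)" for w
  proof -
    from that obtain a b where "w = a + b" "a \<in> Poly_Mapping.keys f" "b \<in> Poly_Mapping.keys g"
      using keys_mult[of f g] by blast
    then show ?thesis using * unfolding short_def by (fastforce simp: plus_list_def)
  qed
  then show ?thesis using * unfolding short_def by auto
qed

lemma short_mult': "f \<in> short A (Suc k) \<Longrightarrow> g \<in> short A l \<Longrightarrow> f * g \<in> short A (k + l)"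
  using short_mult[of f A k g "l - 1"] by (cases l) (auto simp: short_0 short_zero)

lemma short_single: "set w \<subseteq> A \<times> A \<Longrightarrow> length w < k \<Longrightarrow> Poly_Mapping.single w c \<in> short A k"
  by (auto simp: short_def free_carrier_iff)

lemma short_scale: "f \<in> short A k \<Longrightarrow> free_scale c f \<in> short A k"
  using short_mult'[of "Poly_Mapping.single [] c" A 0 f k] short_single[of "[]" A 1 c]
  by (simp add: free_scale_eq)

lemma short_uminus: "f \<in> short A k \<Longrightarrow> - f \<in> short A k"
  by (auto simp: short_def)

section \<open>Reordering words modulo lower degree\<close>

definition reducible :: "symbol set \<Rightarrow> nat \<Rightarrow> free_alg \<Rightarrow> bool" where
  "reducible A k f \<longleftrightarrow> (\<exists>g\<in>short A k. f - g \<in> enveloping_ideal A)"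

lemma reducible_add: "reducible A k f \<Longrightarrow> reducible A k g \<Longrightarrow> reducible A k (f + g)"
  unfolding reducible_def
proof safe
  fix f' g' assume "f' \<in> short A k" "g' \<in> short A k" "f - f' \<in> enveloping_ideal A" "g - g' \<in> enveloping_ideal A"
  then show "\<exists>h\<in>short A k. f + g - h \<in> enveloping_ideal A"
    using ideal_add[of "f - f'" A "g - g'"] by (intro bexI[of _ "f' + g'"] short_add) (auto simp: algebra_simps)
qed

lemma reducible_zero: "reducible A k 0"
  unfolding reducible_def using short_zero ideal_0 by (intro bexI[of _ 0]) auto

lemma reducible_short: "f \<in> short A k \<Longrightarrow> reducible A k f"
  unfolding reducible_def using ideal_0 by (intro bexI[of _ f]) auto

lemma reducible_scale: "reducible A k f \<Longrightarrow> reducible A k (free_scale c f)"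
  unfolding reducible_def
proof safe
  fix g assume "g \<in> short A k" "f - g \<in> enveloping_ideal A"
  then show "\<exists>h\<in>short A k. free_scale c f - h \<in> enveloping_ideal A"
    using short_scale[of g A k c] ideal_scale[of "f - g" A c] by (auto simp: free_scale_simps)
qed

lemma reducible_sum: "(\<And>i. i \<in> I \<Longrightarrow> reducible A k (f i)) \<Longrightarrow> reducible A k (\<Sum>i\<in>I. f i)"
  by (induction I rule: infinite_finite_induct) (auto simp: reducible_zero reducible_add)

lemma reducible_gen_mult:
  "a \<in> A \<Longrightarrow> b \<in> A \<Longrightarrow> reducible A k f \<Longrightarrow> reducible A (Suc k) (free_gen a b * f)"
  unfolding reducible_def
proof safe
  fix g assume "a \<in> A" "b \<in> A" "g \<in> short A k" "f - g \<in> enveloping_ideal A"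
  moreover from this have "free_gen a b \<in> short A (Suc 1)" unfolding free_gen_def by (intro short_single) auto
  ultimately show "\<exists>h\<in>short A (Suc k). free_gen a b * f - h \<in> enveloping_ideal A"
    using short_mult'[of "free_gen a b" A 1 g k] ideal_mult_left[of "f - g" A "free_gen a b"]
      free_carrier_gen[of a A b]
    by (intro bexI[of _ "free_gen a b * g"]) (auto simp: right_diff_distrib)
qed

lemma mono_Cons: "mono (p # w) = free_gen (fst p) (snd p) * mono w"
  by (simp add: free_gen_def mult_single plus_list_def)

text \<open>Even letters commute up to their bracket, which is one letter shorter than the
  product.\<close>

lemma swap_reducible:
  assumes "{a, b, c, d} \<subseteq> A" "A \<subseteq> odd_symbols" "set w \<subseteq> A \<times> A"
  shows "reducible A (Suc (Suc (length w))) (mono ((a, b) # (c, d) # w) - mono ((c, d) # (a, b) # w))"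
proof -
  have "parity a = 1" "parity b = 1" "parity c = 1" "parity d = 1"
    using assms by (auto simp: odd_symbols_def)
  then have sgn: "super_sign a b c d = 1" by (simp add: super_sign_def)
  let ?r = "free_gen a b * free_gen c d
          - free_scale (super_sign a b c d) (free_gen c d * free_gen a b) - superbracket a b c d"
  have "?r \<in> enveloping_ideal A"
    using env_relations_ideal[of A] assms(1) unfolding env_relations_def by blast
  then have "?r * mono w \<in> enveloping_ideal A"
    by (rule ideal_mult_right) (use assms(3) in \<open>auto simp: free_carrier_iff\<close>)
  moreover have "?r * mono w = mono ((a, b) # (c, d) # w) - mono ((c, d) # (a, b) # w) - superbracket a b c d * mono w"
    by (simp add: mono_Cons sgn free_scale_simps left_diff_distrib mult.assoc)
  moreover have "superbracket a b c d \<in> short A (Suc 1)"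
  proof -
    have g: "free_gen x y \<in> short A (Suc 1)" if "x \<in> A" "y \<in> A" for x y
      using that unfolding free_gen_def by (intro short_single) auto
    have "free_scale e (if a = d then free_gen c b else 0) \<in> short A (Suc 1)" for e
      using g assms(1) by (intro short_scale) (auto simp: short_zero)
    from short_uminus[OF this] show ?thesis
      unfolding superbracket_def using g assms(1)
      by (subst diff_conv_add_uminus) (intro short_add, auto simp: short_zero)
  qed
  then have "superbracket a b c d * mono w \<in> short A (Suc (1 + length w))"
    by (rule short_mult) (use assms(3) in \<open>intro short_single, auto\<close>)
  ultimately show ?thesis unfolding reducible_def by auto
qed

lemma move_reducible:
  assumes "p \<in> A \<times> A" "A \<subseteq> odd_symbols" "set (u @ v) \<subseteq> A \<times> A"
  shows "reducible A (Suc (length (u @ v))) (mono (p # u @ v) - mono (u @ p # v))"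
  using assms(3)
proof (induction u)
  case Nil
  then show ?case by (simp add: reducible_zero)
next
  case (Cons q u)
  have 1: "reducible A (Suc (Suc (length (u @ v)))) (mono (p # q # u @ v) - mono (q # p # u @ v))"
    using swap_reducible[of "fst p" "snd p" "fst q" "snd q" A "u @ v"] assms Cons by auto
  have "reducible A (Suc (Suc (length (u @ v))))
     (free_gen (fst q) (snd q) * (mono (p # u @ v) - mono (u @ p # v)))"
    using Cons by (intro reducible_gen_mult) auto
  then have "reducible A (Suc (Suc (length (u @ v)))) (mono (q # p # u @ v) - mono (q # u @ p # v))"
    unfolding mono_Cons[of q] right_diff_distrib .
  from reducible_add[OF 1 this] show ?case by simp
qed

text \<open>Sorting by adjacent exchanges. This is the spanning half of the Poincare-Birkhoff-Witt
  theorem; \<open>symbol_coeff_full\<close> supplies the independence.\<close>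

lemma mset_reducible:
  assumes "A \<subseteq> odd_symbols" "set w \<subseteq> A \<times> A" "mset w = mset u"
  shows "reducible A (length w) (mono w - mono u)"
  using assms(2,3)
proof (induction w arbitrary: u)
  case Nil
  then show ?case by (simp add: reducible_zero)
next
  case (Cons p w)
  then have "p \<in> set u" by (metis list.set_intros(1) set_mset_mset)
  then obtain u1 u2 where u: "u = u1 @ p # u2" by (meson split_list)
  then have m: "mset w = mset (u1 @ u2)" using Cons by simp
  then have l: "length w = length (u1 @ u2)" and st: "set (u1 @ u2) \<subseteq> A \<times> A"
    using Cons.prems by (metis size_mset, metis set_mset_mset set_subset_Cons subset_trans)
  have "reducible A (Suc (length w)) (free_gen (fst p) (snd p) * (mono w - mono (u1 @ u2)))"
    using Cons m by (intro reducible_gen_mult) auto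
  then have "reducible A (Suc (length w)) (mono (p # w) - mono (p # u1 @ u2))"
    by (simp add: mono_Cons right_diff_distrib)
  moreover have "reducible A (Suc (length w)) (mono (p # u1 @ u2) - mono (u1 @ p # u2))"
    using move_reducible[of p A u1 u2] st assms(1) Cons.prems l by simp
  ultimately have "reducible A (Suc (length w)) (mono (p # w) - mono (p # u1 @ u2) + (mono (p # u1 @ u2) - mono (u1 @ p # u2)))"
    by (rule reducible_add)
  then show ?case by (simp add: u)
qed

lemma free_scale_single: "free_scale c (Poly_Mapping.single w d) = Poly_Mapping.single w (c * d)"
  by (simp add: free_scale_eq mult_single plus_list_def)

text \<open>The top-degree part of an element acting by zero sums to zero over every class of
  rearrangements of a word, so it can be rewritten modulo the relations into lower degree.\<close>

lemma faithful:
  assumes "A \<subseteq> odd_symbols" "f \<in> short A k"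
    and "\<And>j t. j < k \<Longrightarrow> t \<in> Vec A j \<Longrightarrow> act f t = 0"
  shows "f \<in> enveloping_ideal A"
  using assms(2,3)
proof (induction k arbitrary: f)
  case 0
  then show ?case by (simp add: short_0 ideal_0)
next
  case (Suc k)
  let ?T = "{w \<in> Poly_Mapping.keys f. length w = k}"
  let ?L = "{w \<in> Poly_Mapping.keys f. length w < k}"
  let ?c = "Poly_Mapping.lookup f"
  define canon where "canon M = (SOME w. mset w = M)" for M :: "(symbol \<times> symbol) multiset"
  have canon: "mset (canon M) = M" for M unfolding canon_def by (rule someI_ex) (rule ex_mset)
  have keys: "Poly_Mapping.keys f = ?T \<union> ?L" "?T \<inter> ?L = {}" "finite ?T" "finite ?L"
    using Suc.prems(1) by (auto simp: short_def less_Suc_eq)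
  have st: "set w \<subseteq> A \<times> A" if "w \<in> Poly_Mapping.keys f" for w
    using Suc.prems(1) that unfolding short_def free_carrier_iff by auto
  have odd: "set w \<subseteq> odd_symbols \<times> odd_symbols" if "w \<in> Poly_Mapping.keys f" for w
    using st[OF that] assms(1) by auto
  \<comment> \<open>Pair the vanishing action with the probes of one word of the class. Shorter
    words contribute zero, and among the words of length \<open>k\<close> exactly the rearrangements
    survive, all with the same nonzero weight.\<close>
  have zero: "(\<Sum>w | w \<in> ?T \<and> mset w = M. ?c w) = 0" if "M \<in> mset ` ?T" for M
  proof -
    obtain ps where ps: "mset ps = M" "ps \<in> ?T" using \<open>M \<in> mset ` ?T\<close> by auto
    have "(\<Sum>w\<in>Poly_Mapping.keys f. ?c w * matrix_coeff w (fst (snd x)) (snd (snd x))) = 0"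
      if "x \<in> set (probe ps)" for x
    proof -
      from probe_length[OF that] ps have "length (snd (snd x)) < Suc k" by simp
      moreover have "set (snd (snd x)) \<subseteq> A" using probe_length[OF that] st[of ps] ps by fastforce
      ultimately have "act f (basis_tensor (snd (snd x))) = 0"
        using Suc.prems(2) basis_tensor_Vec by blast
      from fun_cong[OF this, of "fst (snd x)"] show ?thesis
        by (simp add: act_def sum_tensor_apply matrix_coeff_def)
    qed
    then have "(\<Sum>x\<leftarrow>probe ps. fst x * (\<Sum>w\<in>Poly_Mapping.keys f. ?c w * matrix_coeff w (fst (snd x)) (snd (snd x)))) = 0"
      by (simp cong: map_cong)
    moreover have "(\<Sum>x\<leftarrow>l. fst x * (\<Sum>w\<in>Poly_Mapping.keys f. ?c w * matrix_coeff w (fst (snd x)) (snd (snd x)))) =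
      (\<Sum>w\<in>Poly_Mapping.keys f. ?c w * (\<Sum>x\<leftarrow>l. fst x * matrix_coeff w (fst (snd x)) (snd (snd x))))" for l
      by (induction l) (auto simp: sum_distrib_left sum.distrib algebra_simps)
    ultimately have "(\<Sum>w\<in>Poly_Mapping.keys f. ?c w * symbol_coeff w ps) = 0"
      by (simp add: symbol_coeff_def)
    moreover have "(\<Sum>w\<in>Poly_Mapping.keys f. ?c w * symbol_coeff w ps) =
      (\<Sum>w\<in>?T. ?c w * symbol_coeff w ps) + (\<Sum>w\<in>?L. ?c w * symbol_coeff w ps)"
      by (subst keys(1)) (rule sum.union_disjoint[OF keys(3,4,2)])
    moreover have "(\<Sum>w\<in>?L. ?c w * symbol_coeff w ps) = 0"
      using ps odd by (intro sum.neutral) (auto simp: symbol_coeff_short)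
    moreover have "(\<Sum>w\<in>?T. ?c w * symbol_coeff w ps) =
      (\<Sum>w\<in>?T. if mset w = M then ?c w * of_nat (orbit_weight ps) else 0)"
      using ps odd by (intro sum.cong) (auto simp: symbol_coeff_full)
    moreover have "\<dots> = (\<Sum>w | w \<in> ?T \<and> mset w = M. ?c w) * of_nat (orbit_weight ps)"
      using keys(3) by (simp add: sum_distrib_right flip: sum.inter_filter)
    ultimately show ?thesis using orbit_weight_pos[of ps] by simp
  qed
  \<comment> \<open>Once every word of length \<open>k\<close> is replaced by the chosen member of
    its class, the top-degree part cancels.\<close>
  have "(\<Sum>w\<in>?T. Poly_Mapping.single (canon (mset w)) (?c w)) =
     (\<Sum>M\<in>mset ` ?T. \<Sum>w | w \<in> ?T \<and> mset w = M. Poly_Mapping.single (canon (mset w)) (?c w))"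
    by (rule sum.image_gen[OF keys(3)])
  also have "\<dots> = (\<Sum>M\<in>mset ` ?T. Poly_Mapping.single (canon M) (\<Sum>w | w \<in> ?T \<and> mset w = M. ?c w))"
  proof (intro sum.cong refl)
    fix M
    have "(\<Sum>w\<in>S. Poly_Mapping.single (canon M) (?c w)) = Poly_Mapping.single (canon M) (\<Sum>w\<in>S. ?c w)" for S
      by (induction S rule: infinite_finite_induct) (auto simp: single_add)
    then show "(\<Sum>w | w \<in> ?T \<and> mset w = M. Poly_Mapping.single (canon (mset w)) (?c w)) =
      Poly_Mapping.single (canon M) (\<Sum>w | w \<in> ?T \<and> mset w = M. ?c w)" by simp
  qed
  also have "\<dots> = 0" using zero by simp
  finally have can0: "(\<Sum>w\<in>?T. Poly_Mapping.single (canon (mset w)) (?c w)) = 0" .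
  have "f = (\<Sum>w\<in>?T. Poly_Mapping.single w (?c w)) + (\<Sum>w\<in>?L. Poly_Mapping.single w (?c w))"
    using free_alg_expand[of f] sum.union_disjoint[OF keys(3,4,2), of "\<lambda>w. Poly_Mapping.single w (?c w)"] keys(1)
    by simp
  then have f: "f = (\<Sum>w\<in>?T. free_scale (?c w) (mono w - mono (canon (mset w)))) + (\<Sum>w\<in>?L. Poly_Mapping.single w (?c w))"
    using can0 by (simp add: free_scale_simps free_scale_single sum_subtractf)
  have "reducible A k ((\<Sum>w\<in>?T. free_scale (?c w) (mono w - mono (canon (mset w)))) + (\<Sum>w\<in>?L. Poly_Mapping.single w (?c w)))"
  proof (intro reducible_add reducible_sum reducible_scale)
    fix w assume "w \<in> ?T"
    then show "reducible A k (mono w - mono (canon (mset w)))"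
      using mset_reducible[OF assms(1) st, of w "canon (mset w)"] canon by auto
  next
    fix w assume "w \<in> ?L"
    then show "reducible A k (Poly_Mapping.single w (?c w))"
      using st by (intro reducible_short short_single) auto
  qed
  then have "reducible A k f" by (simp flip: f)
  then obtain g where g: "g \<in> short A k" "f - g \<in> enveloping_ideal A" unfolding reducible_def by blast
  \<comment> \<open>The remainder differs from \<open>f\<close> by an element of the ideal, so it
    acts in the same way, and it is shorter.\<close>
  have "g \<in> enveloping_ideal A"
  proof (rule Suc.IH[OF g(1)])
    fix j t assume "j < k" "t \<in> Vec A j"
    have "act g t = act f t - act (f - g) t" by (simp add: act_diff)
    also have "\<dots> = 0" using Suc.prems(2)[of j t] enveloping_ideal_act[OF g(2), of t] \<open>j < k\<close> \<open>t \<in> Vec A j\<close> by simp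
    finally show "act g t = 0" .
  qed
  with g(2) show ?case using ideal_add[of "f - g" A g] by simp
qed

lemma proper_odd: "proper_symbols n \<subseteq> odd_symbols"
  by (auto simp: proper_symbols_def odd_symbols_def)

lemma short_exists: "f \<in> free_carrier A \<Longrightarrow> \<exists>k. f \<in> short A k"
  by (intro exI[of _ "Suc (Max (length ` Poly_Mapping.keys f))"]) (auto simp: short_def less_Suc_eq_le)

text \<open>U(gl(n)) acts faithfully on proper tensors. Identities in U(gl(n)) may from here on be
  checked as identities of operators.\<close>

lemma proper_ideal_iff:
  assumes "f \<in> free_carrier (proper_symbols n)"
  shows "f \<in> enveloping_ideal (proper_symbols n) \<longleftrightarrow>
    (\<forall>k. \<forall>t\<in>Vec (proper_symbols n) k. act f t = 0)"
  using short_exists[OF assms] faithful[OF proper_odd] enveloping_ideal_act by blast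

section \<open>Devirtualization on tensors\<close>

lemma count_list_update:
  "i < length w \<Longrightarrow> int (count_list (w[i := b]) x) =
     int (count_list w x) + (if b = x then 1 else 0) - (if w ! i = x then 1 else 0)"
proof (induction w arbitrary: i)
  case (Cons a w)
  show ?case
  proof (cases i)
    case (Suc j)
    then have "int (count_list (w[j := b]) x) =
      int (count_list w x) + (if b = x then 1 else 0) - (if w ! j = x then 1 else 0)"
      using Cons by simp
    then show ?thesis using Suc by (simp split: if_splits)
  qed simp
qed simp

lemma pol_count:
  assumes "pol a b t w \<noteq> 0"
  obtains u where "t u \<noteq> 0" "b \<in> set u"
    "\<And>x. int (count_list u x) = int (count_list w x) + (if b = x then 1 else 0) - (if a = x then 1 else 0)"
proof -
  obtain i where i: "i < length w" "w ! i = a" "t (w[i := b]) \<noteq> 0" using pol_supp[OF assms] by blast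
  show ?thesis
    by (rule that[OF i(3)]) (use i in \<open>auto simp: count_list_update set_update_memI\<close>)
qed

text \<open>Weight bookkeeping: every factor e_{a,b} trades one b for one a. Integers are used
  because the differences need not be natural numbers at intermediate stages.\<close>

lemma wact_count:
  assumes "wact v t w \<noteq> 0"
  obtains u where "t u \<noteq> 0"
    "\<And>x. int (count_list w x) = int (count_list u x) + int (count_list (map fst v) x) - int (count_list (map snd v) x)"
  using assms
proof (induction v arbitrary: w thesis)
  case (Cons p v)
  from Cons.prems(2) have "pol (fst p) (snd p) (wact v t) w \<noteq> 0" by simp
  then obtain u where u: "wact v t u \<noteq> 0"
    "\<And>x. int (count_list u x) = int (count_list w x) + (if snd p = x then 1 else 0) - (if fst p = x then 1 else 0)"
    using pol_count by metis
  from Cons.IH[OF _ u(1)] obtain u' where "t u' \<noteq> 0"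
    "\<And>x. int (count_list u x) = int (count_list u' x) + int (count_list (map fst v) x) - int (count_list (map snd v) x)"
    by blast
  note u' = this
  show ?case
  proof (rule Cons.prems(1)[OF u'(1)])
    fix x
    show "int (count_list w x) = int (count_list u' x) + int (count_list (map fst (p # v)) x) -
      int (count_list (map snd (p # v)) x)"
      using u(2)[of x] u'(2)[of x] by (simp split: if_splits)
  qed
qed auto

lemma card_index_count: "i \<le> length ps \<Longrightarrow> card {j. j < i \<and> f (ps ! j) = x} = count_list (map f (take i ps)) x"
proof (induction i)
  case (Suc i)
  then have "{j. j < Suc i \<and> f (ps ! j) = x} = {j. j < i \<and> f (ps ! j) = x} \<union> (if f (ps ! i) = x then {i} else {})"
    by (auto simp: less_Suc_eq)
  with Suc show ?case by (auto simp: take_Suc_conv_app_nth card_insert_if)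
qed simp

text \<open>Apply the factors from the right to a word without virtual symbols. At the offending
  factor more copies of \<gamma> would have been consumed than produced, so \<gamma> would occur a
  negative number of times.\<close>

lemma irregular_wact:
  assumes "irregular V ps" "t \<in> Vec P k" "V \<inter> P = {}"
  shows "wact (rev ps) t = 0"
proof -
  obtain i \<gamma> where i: "i < length ps" "\<gamma> \<in> V"
    "card {j. j \<le> i \<and> snd (ps ! j) = \<gamma>} > card {j. j < i \<and> fst (ps ! j) = \<gamma>}"
    using assms(1) unfolding irregular_def by blast
  have c: "count_list (map snd (take (Suc i) ps)) \<gamma> > count_list (map fst (take i ps)) \<gamma>"
    using i card_index_count[of "Suc i" ps snd \<gamma>] card_index_count[of i ps fst \<gamma>]
    by (simp add: less_Suc_eq_le)
  obtain a b where p: "ps ! i = (a, b)" by (cases "ps ! i")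
  have z: "pol a b (wact (rev (take i ps)) t) = 0"
  proof (rule ext, rule ccontr)
    fix w assume "pol a b (wact (rev (take i ps)) t) w \<noteq> 0 w"
    then have "pol a b (wact (rev (take i ps)) t) w \<noteq> 0" by simp
    then obtain u where u: "wact (rev (take i ps)) t u \<noteq> 0" "b \<in> set u" using pol_count by metis
    obtain v where v: "t v \<noteq> 0" "\<And>x. int (count_list u x) = int (count_list v x) +
        int (count_list (map fst (rev (take i ps))) x) - int (count_list (map snd (rev (take i ps))) x)"
      using wact_count[OF u(1)] by metis
    have "\<gamma> \<notin> set v" using v(1) assms(2,3) i(2) unfolding Vec_def by blast
    then have "count_list v \<gamma> = 0" by (simp add: count_list_0_iff)
    moreover have "count_list u \<gamma> \<ge> (if b = \<gamma> then 1 else 0)"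
      using u(2) count_list_0_iff[of u b] by (cases "b = \<gamma>") auto
    moreover have "count_list (map snd (take (Suc i) ps)) \<gamma> = count_list (map snd (take i ps)) \<gamma> + (if b = \<gamma> then 1 else 0)"
      using i(1) p by (simp add: take_Suc_conv_app_nth)
    ultimately show False using v(2)[of \<gamma>] c
      by (auto simp flip: rev_map split: if_splits)
  qed
  have "rev ps = rev (drop (Suc i) ps) @ [(a, b)] @ rev (take i ps)"
    using id_take_nth_drop[OF i(1)] p by (metis append.assoc append_Cons append_Nil rev.simps(2) rev_append)
  then show ?thesis using z by (simp add: wact_append)
qed

lemma virtual_proper_disjoint: "virtual_symbols m0 m1 \<inter> proper_symbols n = {}"
  by (auto simp: virtual_symbols_def proper_symbols_def)

text \<open>The preimage of \<open>Irr\<close> in the free algebra. As \<open>Irr\<close> is an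
  intersection of left ideals, products are controlled under left multiplication, and this dictates
  the direction of the reductions below.\<close>

definition irr :: "nat \<Rightarrow> nat \<Rightarrow> nat \<Rightarrow> free_alg set" where
  "irr m0 m1 n = {f \<in> free_carrier (all_symbols m0 m1 n). cl (all_symbols m0 m1 n) f \<in> Irr m0 m1 n}"

lemma left_idealI:
  assumes "\<And>f. f \<in> K \<Longrightarrow> f \<in> free_carrier A"
    and "enveloping_ideal A \<subseteq> K"
    and "\<And>f g. f \<in> K \<Longrightarrow> g \<in> K \<Longrightarrow> f + g \<in> K"
    and "\<And>f g. f \<in> K \<Longrightarrow> g \<in> free_carrier A \<Longrightarrow> g * f \<in> K"
  shows "left_ideal (enveloping A) (cl A ` K)"
proof -
  interpret ring "enveloping A" by (rule ring_enveloping)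
  have neg: "- f \<in> K" if "f \<in> K" for f
    using assms(4)[OF that, of "- 1"] by (simp add: free_carrier_1 free_carrier_uminus)
  show ?thesis
    unfolding left_ideal_def
  proof (intro conjI ballI)
    show "additive_subgroup (cl A ` K) (enveloping A)"
    proof (rule additive_subgroup.intro, rule add.subgroupI)
      show "cl A ` K \<subseteq> carrier (enveloping A)" using assms(1) by auto
      show "cl A ` K \<noteq> {}" using assms(2) ideal_0[of A] by auto
      fix x assume "x \<in> cl A ` K"
      then obtain f where f: "f \<in> K" "x = cl A f" by auto
      have "\<ominus>\<^bsub>enveloping A\<^esub> cl A f = cl A (- f)"
        by (rule minus_equality) (use f assms(1) in \<open>auto simp: cl_add cl_zero\<close>)
      then show "\<ominus>\<^bsub>enveloping A\<^esub> x \<in> cl A ` K" using f neg by auto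
    qed (use assms(3) in \<open>auto simp: cl_add\<close>)
    fix r x assume "r \<in> carrier (enveloping A)" "x \<in> cl A ` K"
    then show "r \<otimes>\<^bsub>enveloping A\<^esub> x \<in> cl A ` K"
      using assms(1,4) by (auto elim!: enveloping_cases simp: cl_mult)
  qed
qed

text \<open>The elements that kill all proper tensors form a left ideal, and irregular products
  belong to it.\<close>

lemma irr_act:
  assumes "f \<in> irr m0 m1 n" "t \<in> Vec (proper_symbols n) k"
  shows "act f t = 0"
proof -
  let ?A = "all_symbols m0 m1 n"
  let ?K = "{f \<in> free_carrier ?A. \<forall>k. \<forall>t\<in>Vec (proper_symbols n) k. act f t = 0}"
  have "left_ideal (enveloping ?A) (cl ?A ` ?K)"
    by (rule left_idealI)
       (auto simp: act_add act_mult lin_0 enveloping_ideal_act dest: ideal_carrier)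
  moreover have "{env_prod ?A (rev ps) | ps. set ps \<subseteq> ?A \<times> ?A \<and> irregular (virtual_symbols m0 m1) ps} \<subseteq> cl ?A ` ?K"
  proof safe
    fix ps assume ps: "set ps \<subseteq> ?A \<times> ?A" "irregular (virtual_symbols m0 m1) ps"
    then have "mono (rev ps) \<in> ?K"
      using irregular_wact[OF ps(2) _ virtual_proper_disjoint] by (auto simp: free_carrier_iff)
    with ps show "env_prod ?A (rev ps) \<in> cl ?A ` ?K" by (simp add: env_prod_cl)
  qed
  ultimately have "cl ?A f \<in> cl ?A ` ?K" using assms(1) unfolding irr_def Irr_def by blast
  then obtain g where g: "g \<in> ?K" "cl ?A f = cl ?A g" by auto
  then have "f - g \<in> enveloping_ideal ?A" by (simp add: cl_eq_iff)
  from enveloping_ideal_act[OF this, of t] g assms(2) show ?thesis by (simp add: act_diff)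
qed

lemma left_ideal_add: "left_ideal (enveloping (all_symbols m0 m1 n)) J \<Longrightarrow> f \<in> J \<Longrightarrow> g \<in> J \<Longrightarrow>
    f \<oplus>\<^bsub>enveloping (all_symbols m0 m1 n)\<^esub> g \<in> J"
  unfolding left_ideal_def using additive_subgroup.a_closed[of J "enveloping (all_symbols m0 m1 n)" f g] by simp

lemma irr_add: "f \<in> irr m0 m1 n \<Longrightarrow> g \<in> irr m0 m1 n \<Longrightarrow> f + g \<in> irr m0 m1 n"
proof -
  assume *: "f \<in> irr m0 m1 n" "g \<in> irr m0 m1 n"
  then have "cl (all_symbols m0 m1 n) f \<oplus>\<^bsub>enveloping (all_symbols m0 m1 n)\<^esub> cl (all_symbols m0 m1 n) g \<in> Irr m0 m1 n"
    unfolding irr_def Irr_def by (auto intro: left_ideal_add)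
  with * show ?thesis by (auto simp: irr_def cl_add)
qed

lemma irr_mult:
  assumes "f \<in> irr m0 m1 n" "g \<in> free_carrier (all_symbols m0 m1 n)"
  shows "g * f \<in> irr m0 m1 n"
proof -
  let ?A = "all_symbols m0 m1 n"
  have "cl ?A g \<otimes>\<^bsub>enveloping ?A\<^esub> cl ?A f \<in> Irr m0 m1 n"
    using assms unfolding irr_def Irr_def left_ideal_def by auto
  with assms show ?thesis by (auto simp: irr_def cl_mult)
qed

lemma irr_ideal: "enveloping_ideal (all_symbols m0 m1 n) \<subseteq> irr m0 m1 n"
proof
  let ?A = "all_symbols m0 m1 n"
  fix f assume f: "f \<in> enveloping_ideal ?A"
  then have "cl ?A f = \<zero>\<^bsub>enveloping ?A\<^esub>" by (simp add: cl_zero cl_eq_iff)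
  moreover have "\<zero>\<^bsub>enveloping ?A\<^esub> \<in> Irr m0 m1 n"
    unfolding Irr_def left_ideal_def using additive_subgroup.zero_closed by blast
  ultimately show "f \<in> irr m0 m1 n" using f ideal_carrier by (auto simp: irr_def)
qed

lemma irr_zero: "0 \<in> irr m0 m1 n"
  using irr_ideal ideal_0 by blast

lemma irr_uminus: "f \<in> irr m0 m1 n \<Longrightarrow> - f \<in> irr m0 m1 n"
  using irr_mult[of f m0 m1 n "- 1"] by (simp add: free_carrier_1 free_carrier_uminus)

lemma irr_scale: "f \<in> irr m0 m1 n \<Longrightarrow> free_scale c f \<in> irr m0 m1 n"
  unfolding free_scale_eq by (intro irr_mult) auto

text \<open>One factor with virtual second index is already irregular, so \<open>irr\<close>
  contains every product with such a factor at its right end.\<close>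

lemma irr_generator:
  assumes "a \<in> all_symbols m0 m1 n" "\<gamma> \<in> virtual_symbols m0 m1"
  shows "mono [(a, \<gamma>)] \<in> irr m0 m1 n"
proof -
  let ?A = "all_symbols m0 m1 n"
  have g: "\<gamma> \<in> ?A" using assms by (simp add: all_symbols_def)
  have "irregular (virtual_symbols m0 m1) [(a, \<gamma>)]"
    unfolding irregular_def using assms(2) by (intro exI[of _ 0]) (auto simp: card_gt_0_iff intro!: bexI[of _ \<gamma>])
  then have "env_prod ?A (rev [(a, \<gamma>)]) \<in> Irr m0 m1 n"
    unfolding Irr_def
  proof (intro InterI)
    fix J
    assume "J \<in> {J. left_ideal (enveloping ?A) J \<and> {env_prod ?A (rev ps) | ps.
      set ps \<subseteq> ?A \<times> ?A \<and> irregular (virtual_symbols m0 m1) ps} \<subseteq> J}"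
    moreover have "env_prod ?A (rev [(a, \<gamma>)]) \<in> {env_prod ?A (rev ps) | ps.
      set ps \<subseteq> ?A \<times> ?A \<and> irregular (virtual_symbols m0 m1) ps}"
      using \<open>irregular _ _\<close> assms(1) g by (intro CollectI exI[of _ "[(a, \<gamma>)]"]) simp
    ultimately show "env_prod ?A (rev [(a, \<gamma>)]) \<in> J" by blast
  qed
  moreover have "env_prod ?A (rev [(a, \<gamma>)]) = cl ?A (mono [(a, \<gamma>)])"
    using env_prod_cl[of "rev [(a, \<gamma>)]" ?A] assms g by simp
  ultimately show ?thesis using assms g by (auto simp: irr_def free_carrier_iff)
qed

text \<open>A letter with virtual second index is moved to the right through a word whose second indices
  are proper until it disappears or reaches the right end, where the product is irregular. This
  preserves the weight in the virtual symbols, so a word of weight zero reduces to words without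
  virtual symbols.\<close>

definition vweight :: "(symbol \<times> symbol) list \<Rightarrow> symbol \<Rightarrow> int" where
  "vweight w x = int (count_list (map fst w) x) - int (count_list (map snd w) x)"

definition reduced :: "nat \<Rightarrow> nat \<Rightarrow> nat \<Rightarrow> (symbol \<Rightarrow> int) \<Rightarrow> nat \<Rightarrow> free_alg set" where
  "reduced m0 m1 n \<delta> k = {f \<in> free_carrier (all_symbols m0 m1 n). \<forall>w\<in>Poly_Mapping.keys f.
     snd ` set w \<subseteq> proper_symbols n \<and> length w \<le> k \<and> (\<forall>x\<in>virtual_symbols m0 m1. vweight w x = \<delta> x)}"

definition reduces :: "nat \<Rightarrow> nat \<Rightarrow> nat \<Rightarrow> (symbol \<Rightarrow> int) \<Rightarrow> nat \<Rightarrow> free_alg \<Rightarrow> bool" where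
  "reduces m0 m1 n \<delta> k f \<longleftrightarrow> (\<exists>g\<in>reduced m0 m1 n \<delta> k. f - g \<in> irr m0 m1 n)"

lemma reduced_add: "f \<in> reduced m0 m1 n \<delta> k \<Longrightarrow> g \<in> reduced m0 m1 n \<delta> k \<Longrightarrow> f + g \<in> reduced m0 m1 n \<delta> k"
  using Poly_Mapping.keys_add[of f g] unfolding reduced_def by blast

lemma reduced_zero: "0 \<in> reduced m0 m1 n \<delta> k"
  by (auto simp: reduced_def)

lemma reduced_scale: "f \<in> reduced m0 m1 n \<delta> k \<Longrightarrow> free_scale c f \<in> reduced m0 m1 n \<delta> k"
proof -
  have "Poly_Mapping.keys (free_scale c f) \<subseteq> Poly_Mapping.keys f"
    using keys_mult[of "Poly_Mapping.single [] c" f] by (auto simp: free_scale_eq plus_list_def split: if_splits)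
  then show "f \<in> reduced m0 m1 n \<delta> k \<Longrightarrow> ?thesis" unfolding reduced_def by blast
qed

lemma reduces_add: "reduces m0 m1 n \<delta> k f \<Longrightarrow> reduces m0 m1 n \<delta> k g \<Longrightarrow> reduces m0 m1 n \<delta> k (f + g)"
  unfolding reduces_def
proof safe
  fix f' g' assume "f' \<in> reduced m0 m1 n \<delta> k" "g' \<in> reduced m0 m1 n \<delta> k" "f - f' \<in> irr m0 m1 n" "g - g' \<in> irr m0 m1 n"
  then show "\<exists>h\<in>reduced m0 m1 n \<delta> k. f + g - h \<in> irr m0 m1 n"
    using irr_add[of "f - f'" m0 m1 n "g - g'"] by (intro bexI[of _ "f' + g'"] reduced_add) (auto simp: algebra_simps)
qed

lemma reduces_irr: "f \<in> irr m0 m1 n \<Longrightarrow> reduces m0 m1 n \<delta> k f"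
  unfolding reduces_def using reduced_zero by (intro bexI[of _ 0]) auto

lemma reduces_reduced: "f \<in> reduced m0 m1 n \<delta> k \<Longrightarrow> reduces m0 m1 n \<delta> k f"
  unfolding reduces_def using irr_zero by (intro bexI[of _ f]) auto

lemma reduces_scale: "reduces m0 m1 n \<delta> k f \<Longrightarrow> reduces m0 m1 n \<delta> k (free_scale c f)"
  unfolding reduces_def
proof safe
  fix g assume "g \<in> reduced m0 m1 n \<delta> k" "f - g \<in> irr m0 m1 n"
  then show "\<exists>h\<in>reduced m0 m1 n \<delta> k. free_scale c f - h \<in> irr m0 m1 n"
    using reduced_scale[of g m0 m1 n \<delta> k c] irr_scale[of "f - g" m0 m1 n c] by (auto simp: free_scale_simps)
qed

lemma reduces_uminus: "reduces m0 m1 n \<delta> k f \<Longrightarrow> reduces m0 m1 n \<delta> k (- f)"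
proof -
  have "free_scale (- 1) f = - f" using free_scale_simps(2)[of 1 "-1" f] free_scale_simps(4)[of f]
    by (simp add: free_scale_eq eq_neg_iff_add_eq_0 add.commute)
  then show "reduces m0 m1 n \<delta> k f \<Longrightarrow> ?thesis" using reduces_scale[of m0 m1 n \<delta> k f "- 1"] by simp
qed

lemma reduces_sum: "(\<And>i. i \<in> I \<Longrightarrow> reduces m0 m1 n \<delta> k (f i)) \<Longrightarrow> reduces m0 m1 n \<delta> k (\<Sum>i\<in>I. f i)"
  by (induction I rule: infinite_finite_induct) (auto simp: reduces_add reduces_irr irr_zero)

lemma reduces_cong:
  "reduces m0 m1 n \<delta> k f \<Longrightarrow> (\<And>x. x \<in> virtual_symbols m0 m1 \<Longrightarrow> \<delta> x = \<delta>' x) \<Longrightarrow> k \<le> k' \<Longrightarrow> reduces m0 m1 n \<delta>' k' f"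
  unfolding reduces_def reduced_def by fastforce

lemma reduces_mod: "reduces m0 m1 n \<delta> k f \<Longrightarrow> g - f \<in> irr m0 m1 n \<Longrightarrow> reduces m0 m1 n \<delta> k g"
  using reduces_add[OF _ reduces_irr, of m0 m1 n \<delta> k f "g - f"] by simp

lemma vweight_Cons: "vweight (p # w) x = vweight w x + (if fst p = x then 1 else 0) - (if snd p = x then 1 else 0)"
  by (simp add: vweight_def)

lemma reduced_single:
  "set w \<subseteq> all_symbols m0 m1 n \<times> all_symbols m0 m1 n \<Longrightarrow> snd ` set w \<subseteq> proper_symbols n \<Longrightarrow> length w \<le> k \<Longrightarrow>
   (\<And>x. x \<in> virtual_symbols m0 m1 \<Longrightarrow> vweight w x = \<delta> x) \<Longrightarrow> mono w \<in> reduced m0 m1 n \<delta> k"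
  by (auto simp: reduced_def free_carrier_iff)

lemma reduces_gen_mult:
  assumes "reduces m0 m1 n \<delta> k f" "a \<in> all_symbols m0 m1 n" "d \<in> proper_symbols n"
  shows "reduces m0 m1 n (\<lambda>x. \<delta> x + (if a = x then 1 else 0)) (Suc k) (free_gen a d * f)"
proof -
  obtain g where g: "g \<in> reduced m0 m1 n \<delta> k" "f - g \<in> irr m0 m1 n" using assms(1) unfolding reduces_def by blast
  have d: "d \<in> all_symbols m0 m1 n" "d \<notin> virtual_symbols m0 m1"
    using assms(3) virtual_proper_disjoint[of m0 m1 n] by (auto simp: all_symbols_def)
  have gen: "free_gen a d \<in> free_carrier (all_symbols m0 m1 n)" using assms d by auto
  have "free_gen a d * g \<in> reduced m0 m1 n (\<lambda>x. \<delta> x + (if a = x then 1 else 0)) (Suc k)"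
    unfolding reduced_def
  proof (intro CollectI conjI)
    show "free_gen a d * g \<in> free_carrier (all_symbols m0 m1 n)" using gen g by (auto simp: reduced_def)
    show "\<forall>w\<in>Poly_Mapping.keys (free_gen a d * g). snd ` set w \<subseteq> proper_symbols n \<and> length w \<le> Suc k \<and>
      (\<forall>x\<in>virtual_symbols m0 m1. vweight w x = \<delta> x + (if a = x then 1 else 0))"
    proof
      fix w assume "w \<in> Poly_Mapping.keys (free_gen a d * g)"
      then obtain u where "w = (a, d) # u" "u \<in> Poly_Mapping.keys g"
        using keys_mult[of "free_gen a d" g] by (auto simp: free_gen_def plus_list_def)
      then show "snd ` set w \<subseteq> proper_symbols n \<and> length w \<le> Suc k \<and>
        (\<forall>x\<in>virtual_symbols m0 m1. vweight w x = \<delta> x + (if a = x then 1 else 0))"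
        using g(1) d assms(3) by (auto simp: reduced_def vweight_Cons)
    qed
  qed
  moreover have "free_gen a d * f - free_gen a d * g \<in> irr m0 m1 n"
    using irr_mult[OF g(2) gen] by (simp add: right_diff_distrib)
  ultimately show ?thesis unfolding reduces_def by blast
qed

text \<open>\<open>irr\<close> contains the whole two-sided ideal \<open>enveloping_ideal\<close>,
  so a defining relation may be used in front of an arbitrary tail.\<close>

lemma relation_irr:
  assumes "{a, b, c, d} \<subseteq> all_symbols m0 m1 n" "set u \<subseteq> all_symbols m0 m1 n \<times> all_symbols m0 m1 n"
  shows "mono ((a, b) # (c, d) # u) -
    (free_scale (super_sign a b c d) (free_gen c d * mono ((a, b) # u)) + (if b = c then mono ((a, d) # u) else 0)
     + - free_scale (super_sign a b c d) (if a = d then mono ((c, b) # u) else 0)) \<in> irr m0 m1 n"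
    (is "?l - ?r \<in> _")
proof -
  let ?A = "all_symbols m0 m1 n"
  let ?e = "free_gen a b * free_gen c d
          - free_scale (super_sign a b c d) (free_gen c d * free_gen a b) - superbracket a b c d"
  have "?e \<in> enveloping_ideal ?A"
    using env_relations_ideal[of ?A] assms(1) unfolding env_relations_def by blast
  then have "?e * mono u \<in> enveloping_ideal ?A"
    by (rule ideal_mult_right) (use assms(2) in \<open>auto simp: free_carrier_iff\<close>)
  moreover have "?e * mono u = ?l - ?r"
    by (simp add: mono_Cons superbracket_def free_scale_simps left_diff_distrib mult.assoc)
  ultimately have "?l - ?r \<in> enveloping_ideal ?A" by (simp only:)
  then show ?thesis using irr_ideal by (rule rev_subsetD)
qed

text \<open>A word leaves this process only by a merge of two letters or by becoming irregular, so
  at least one letter is lost; hence the bound \<open>length u\<close>. A merged letter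
  \<open>(c, \<gamma>)\<close> still has a virtual second index, which is why the induction
  generalizes the indices.\<close>

lemma reduces_virtual:
  assumes "a \<in> all_symbols m0 m1 n" "\<gamma> \<in> virtual_symbols m0 m1"
    and "set u \<subseteq> all_symbols m0 m1 n \<times> all_symbols m0 m1 n" "snd ` set u \<subseteq> proper_symbols n"
  shows "reduces m0 m1 n (vweight ((a, \<gamma>) # u)) (length u) (mono ((a, \<gamma>) # u))"
  using assms
proof (induction u arbitrary: a \<gamma>)
  case Nil
  then show ?case by (intro reduces_irr irr_generator)
next
  case (Cons p u)
  let ?A = "all_symbols m0 m1 n"
  obtain c d where p: "p = (c, d)" by (cases p)
  have cd: "c \<in> ?A" "d \<in> ?A" "d \<in> proper_symbols n" "\<gamma> \<in> ?A" "d \<notin> virtual_symbols m0 m1"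
    using Cons.prems p virtual_proper_disjoint[of m0 m1 n] by (auto simp: all_symbols_def)
  have u: "set u \<subseteq> ?A \<times> ?A" "snd ` set u \<subseteq> proper_symbols n" using Cons.prems by auto
  have "reduces m0 m1 n (\<lambda>x. vweight ((a, \<gamma>) # u) x + (if c = x then 1 else 0)) (Suc (length u))
      (free_gen c d * mono ((a, \<gamma>) # u))"
    using Cons.IH[OF Cons.prems(1,2) u] cd by (intro reduces_gen_mult)
  then have 1: "reduces m0 m1 n (vweight ((a, \<gamma>) # p # u)) (Suc (length u)) (free_gen c d * mono ((a, \<gamma>) # u))"
    by (rule reduces_cong) (use cd in \<open>auto simp: vweight_Cons p\<close>)
  have 2: "reduces m0 m1 n (vweight ((a, \<gamma>) # p # u)) (Suc (length u)) (if \<gamma> = c then mono ((a, d) # u) else 0)"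
  proof (cases "\<gamma> = c")
    case True
    have "mono ((a, d) # u) \<in> reduced m0 m1 n (vweight ((a, \<gamma>) # p # u)) (Suc (length u))"
      by (rule reduced_single) (use cd Cons.prems(1) u True in \<open>auto simp: vweight_Cons p\<close>)
    then show ?thesis using True by (simp add: reduces_reduced)
  qed (simp add: reduces_irr irr_zero)
  have 3: "reduces m0 m1 n (vweight ((a, \<gamma>) # p # u)) (Suc (length u)) (if a = d then mono ((c, \<gamma>) # u) else 0)"
  proof (cases "a = d")
    case True
    have "reduces m0 m1 n (vweight ((c, \<gamma>) # u)) (length u) (mono ((c, \<gamma>) # u))"
      using Cons.IH[OF cd(1) Cons.prems(2) u] .
    then have "reduces m0 m1 n (vweight ((a, \<gamma>) # p # u)) (Suc (length u)) (mono ((c, \<gamma>) # u))"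
      by (rule reduces_cong) (use cd True in \<open>auto simp: vweight_Cons p\<close>)
    then show ?thesis using True by simp
  qed (simp add: reduces_irr irr_zero)
  have "{a, \<gamma>, c, d} \<subseteq> ?A" using Cons.prems cd by auto
  from relation_irr[OF this u(1)] show ?case
    unfolding p length_Cons
    by (rule reduces_mod[rotated]) (intro reduces_add reduces_scale reduces_uminus 1[unfolded p] 2[unfolded p] 3[unfolded p])
qed

text \<open>Letters with virtual second index are used up by the reduction, so this number bounds
  the degree of what survives.\<close>

definition proper_count :: "nat \<Rightarrow> (symbol \<times> symbol) list \<Rightarrow> nat" where
  "proper_count n w = length (filter (\<lambda>p. snd p \<in> proper_symbols n) w)"

text \<open>The word is processed from its right end: the error made in reducing a suffix stays in
  \<open>irr\<close> when further letters are multiplied on from the left.\<close>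

lemma reduces_word:
  assumes "set w \<subseteq> all_symbols m0 m1 n \<times> all_symbols m0 m1 n"
  shows "reduces m0 m1 n (vweight w) (proper_count n w) (mono w)"
  using assms
proof (induction w)
  case Nil
  then show ?case by (intro reduces_reduced reduced_single) auto
next
  case (Cons p w)
  let ?A = "all_symbols m0 m1 n"
  obtain a b where p: "p = (a, b)" by (cases p)
  have ab: "a \<in> ?A" "b \<in> ?A" using Cons.prems p by auto
  have IH: "reduces m0 m1 n (vweight w) (proper_count n w) (mono w)" using Cons by simp
  show ?case
  proof (cases "b \<in> proper_symbols n")
    case True
    then have "b \<notin> virtual_symbols m0 m1" using virtual_proper_disjoint[of m0 m1 n] by auto
    have "reduces m0 m1 n (\<lambda>x. vweight w x + (if a = x then 1 else 0)) (Suc (proper_count n w)) (mono (p # w))"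
      using reduces_gen_mult[OF IH ab(1) True] by (simp add: mono_Cons p)
    then show ?thesis
      by (rule reduces_cong) (use True \<open>b \<notin> _\<close> in \<open>auto simp: vweight_Cons p proper_count_def\<close>)
  next
    case False
    then have b: "b \<in> virtual_symbols m0 m1" using ab by (simp add: all_symbols_def)
    obtain g where g: "g \<in> reduced m0 m1 n (vweight w) (proper_count n w)" "mono w - g \<in> irr m0 m1 n"
      using IH unfolding reduces_def by blast
    have gen: "free_gen a b \<in> free_carrier ?A" using ab by auto
    have "free_gen a b * g = (\<Sum>u\<in>Poly_Mapping.keys g. free_scale (Poly_Mapping.lookup g u) (mono (p # u)))"
      by (subst (1) free_alg_expand[of g])
         (simp add: sum_distrib_left mono_Cons p free_scale_simps(7)[symmetric] free_scale_single)
    moreover have "reduces m0 m1 n (vweight (p # w)) (proper_count n (p # w)) \<dots>"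
    proof (intro reduces_sum reduces_scale)
      fix u assume u: "u \<in> Poly_Mapping.keys g"
      then have "set u \<subseteq> ?A \<times> ?A" "snd ` set u \<subseteq> proper_symbols n" "length u \<le> proper_count n w"
        "\<And>x. x \<in> virtual_symbols m0 m1 \<Longrightarrow> vweight u x = vweight w x"
        using g(1) by (auto simp: reduced_def free_carrier_iff)
      then show "reduces m0 m1 n (vweight (p # w)) (proper_count n (p # w)) (mono (p # u))"
        using reduces_cong[OF reduces_virtual[OF ab(1) b, of u], of "vweight (p # w)" "proper_count n (p # w)"] False
        by (simp add: p vweight_Cons proper_count_def)
    qed
    ultimately have "reduces m0 m1 n (vweight (p # w)) (proper_count n (p # w)) (free_gen a b * g)" by simp
    moreover have "mono (p # w) - free_gen a b * g \<in> irr m0 m1 n"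
      using irr_mult[OF g(2) gen] by (simp add: mono_Cons p right_diff_distrib)
    ultimately show ?thesis by (rule reduces_mod)
  qed
qed

text \<open>After the reduction no second index is virtual. The weight in the virtual symbols is
  zero, so no first index is virtual either.\<close>

lemma virt_word:
  assumes "set w \<subseteq> all_symbols m0 m1 n \<times> all_symbols m0 m1 n"
    and "\<And>x. x \<in> virtual_symbols m0 m1 \<Longrightarrow> count_list (map fst w) x = count_list (map snd w) x"
  shows "\<exists>g\<in>short (proper_symbols n) (Suc (proper_count n w)). mono w - g \<in> irr m0 m1 n"
proof -
  obtain g where g: "g \<in> reduced m0 m1 n (vweight w) (proper_count n w)" "mono w - g \<in> irr m0 m1 n"
    using reduces_word[OF assms(1)] unfolding reduces_def by blast
  have "set u \<subseteq> proper_symbols n \<times> proper_symbols n" if u: "u \<in> Poly_Mapping.keys g" for u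
  proof -
    have *: "set u \<subseteq> all_symbols m0 m1 n \<times> all_symbols m0 m1 n" "snd ` set u \<subseteq> proper_symbols n"
      "\<And>x. x \<in> virtual_symbols m0 m1 \<Longrightarrow> vweight u x = 0"
      using u g(1) assms(2) by (auto simp: reduced_def free_carrier_iff vweight_def)
    have "x \<notin> fst ` set u" if x: "x \<in> virtual_symbols m0 m1" for x
    proof -
      have "x \<notin> set (map snd u)" using x *(2) virtual_proper_disjoint[of m0 m1 n] by auto
      then have "count_list (map fst u) x = 0" using *(3)[OF x] by (simp add: vweight_def count_list_0_iff[symmetric] del: count_list_0_iff)
      then show ?thesis by (simp add: count_list_0_iff)
    qed
    moreover have "fst ` set u \<subseteq> all_symbols m0 m1 n" using *(1) by auto
    ultimately have "fst ` set u \<subseteq> proper_symbols n" unfolding all_symbols_def by blast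
    then show ?thesis using *(2) by (auto simp: image_subset_iff)
  qed
  then have "g \<in> short (proper_symbols n) (Suc (proper_count n w))"
    using g(1) unfolding short_def reduced_def free_carrier_iff by (simp add: less_Suc_eq_le subset_iff lists_eq_set)
  with g(2) show ?thesis by blast
qed

lemma proper_subset_all: "proper_symbols n \<subseteq> all_symbols m0 m1 n"
  by (auto simp: all_symbols_def)

lemma free_carrier_mono: "f \<in> free_carrier A \<Longrightarrow> A \<subseteq> B \<Longrightarrow> f \<in> free_carrier B"
  unfolding free_carrier_iff by fastforce

text \<open>The hypothesis supplies a value. Two values differ by an element of \<open>irr\<close>
  over proper symbols; it kills the proper tensors and is zero by \<open>proper_ideal_iff\<close>.
  This is the directness of the sum of U(gl(n)) and \<open>Irr\<close>.\<close>

lemma devirt_cl: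
  assumes "f \<in> free_carrier (all_symbols m0 m1 n)" "g \<in> free_carrier (proper_symbols n)"
    and "f - g \<in> irr m0 m1 n"
  shows "devirt m0 m1 n (cl (all_symbols m0 m1 n) f) = cl (proper_symbols n) g"
  unfolding devirt_def
proof (rule the_equality)
  let ?A = "all_symbols m0 m1 n"
  have up: "h \<in> free_carrier ?A" if "h \<in> free_carrier (proper_symbols n)" for h
    using free_carrier_mono[OF that proper_subset_all] .
  show "cl (proper_symbols n) g \<in> carrier (Ugl n) \<and>
    cl ?A f \<ominus>\<^bsub>enveloping ?A\<^esub> embed m0 m1 n (cl (proper_symbols n) g) \<in> Irr m0 m1 n"
    using assms up by (auto simp: embed_cl cl_minus irr_def)
  fix y
  assume "y \<in> carrier (Ugl n) \<and> cl ?A f \<ominus>\<^bsub>enveloping ?A\<^esub> embed m0 m1 n y \<in> Irr m0 m1 n"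
  then obtain h where h: "h \<in> free_carrier (proper_symbols n)" "y = cl (proper_symbols n) h"
    "cl ?A f \<ominus>\<^bsub>enveloping ?A\<^esub> embed m0 m1 n (cl (proper_symbols n) h) \<in> Irr m0 m1 n"
    by (auto elim: enveloping_cases)
  then have "f - h \<in> irr m0 m1 n" using assms up[OF h(1)] by (auto simp: embed_cl cl_minus irr_def)
  from irr_add[OF this irr_uminus[OF assms(3)]] have gh: "g - h \<in> irr m0 m1 n" by (simp add: algebra_simps)
  have "h - g \<in> enveloping_ideal (proper_symbols n)"
    using irr_act[OF irr_uminus[OF gh]] h assms(2) by (subst proper_ideal_iff) auto
  then show "y = cl (proper_symbols n) g" using h by (simp add: cl_eq_iff)
qed

section \<open>The words of the Young-Capelli bitableaux and their action\<close>

definition capelli_word :: "nat list \<Rightarrow> nat list list \<Rightarrow> (symbol \<times> symbol) list" where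
  "capelli_word l S = (let s = map Letter (concat S); c = concat (virtual_C l); d = concat (virtual_D l)
     in zip s c @ zip c d @ zip d c @ zip c s)"

lemma length_virtual_C: "length (concat (virtual_C l)) = sum_list l"
  by (simp add: virtual_C_def length_concat comp_def map_nth)

lemma length_virtual_D: "length (concat (virtual_D l)) = sum_list l"
  by (induction l) (auto simp: virtual_D_def)

lemma set_virtual_C: "length l \<le> m0 \<Longrightarrow> set (concat (virtual_C l)) \<subseteq> virtual_symbols m0 m1"
  by (auto simp: virtual_C_def virtual_symbols_def split: if_splits)

lemma set_virtual_D: "(\<And>k. k \<in> set l \<Longrightarrow> k \<le> m1) \<Longrightarrow> set (concat (virtual_D l)) \<subseteq> virtual_symbols m0 m1"
  by (fastforce simp: virtual_D_def virtual_symbols_def)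

lemma set_zip_le: "set xs \<subseteq> A \<Longrightarrow> set ys \<subseteq> B \<Longrightarrow> set (zip xs ys) \<subseteq> A \<times> B"
  by (auto dest: set_zip_leftD set_zip_rightD)

text \<open>Every virtual symbol occurs equally often as first and as second index, so
  \<open>virt_word\<close> applies. Of the four factors only the last one has proper second indices,
  so the degree is at most the number of cells.\<close>

lemma bitableau_act:
  assumes "map length S = l" "\<And>r. r \<in> set S \<Longrightarrow> set r \<subseteq> {1..n}"
    and "length l \<le> m0" "\<And>k. k \<in> set l \<Longrightarrow> k \<le> m1"
  shows "\<exists>g\<in>short (proper_symbols n) (Suc (sum_list l)).
     bitableau m0 m1 n S S = cl (proper_symbols n) g \<and>
     (\<forall>k. \<forall>t\<in>Vec (proper_symbols n) k. act g t = wact (capelli_word l S) t)"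
proof -
  let ?A = "all_symbols m0 m1 n" and ?w = "capelli_word l S"
  define s where "s = map Letter (concat S)"
  define c where "c = concat (virtual_C l)"
  define d where "d = concat (virtual_D l)"
  have len: "length s = sum_list l" "length c = sum_list l" "length d = sum_list l"
    using assms(1) length_virtual_C[of l] length_virtual_D[of l]
    by (simp_all add: s_def c_def d_def length_concat)
  have w: "?w = zip s c @ zip c d @ zip d c @ zip c s"
    by (simp add: capelli_word_def s_def c_def d_def Let_def)
  have sets: "set s \<subseteq> proper_symbols n" "set c \<subseteq> virtual_symbols m0 m1" "set d \<subseteq> virtual_symbols m0 m1"
    using assms(2) set_virtual_C[OF assms(3)] set_virtual_D[OF assms(4), of l m0]
    by (auto simp: s_def c_def d_def proper_symbols_def)
  then have sA: "set s \<subseteq> ?A" "set c \<subseteq> ?A" "set d \<subseteq> ?A" by (auto simp: all_symbols_def)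
  note z = set_zip_le[OF sA(1,2)] set_zip_le[OF sA(2,3)] set_zip_le[OF sA(3,2)] set_zip_le[OF sA(2,1)]
  have wA: "set ?w \<subseteq> ?A \<times> ?A" unfolding w using z by simp
  have fs: "map fst ?w = s @ c @ d @ c" "map snd ?w = c @ d @ c @ s"
    unfolding w using len by simp_all
  have "filter (\<lambda>p. snd p \<in> proper_symbols n) (zip x y) = []" if "set y \<subseteq> virtual_symbols m0 m1" for x y :: "symbol list"
    using that virtual_proper_disjoint[of m0 m1 n] by (fastforce simp: filter_empty_conv dest: set_zip_rightD)
  then have "proper_count n ?w = length (filter (\<lambda>p. snd p \<in> proper_symbols n) (zip c s))"
    unfolding proper_count_def w using sets by simp
  also have "filter (\<lambda>p. snd p \<in> proper_symbols n) (zip c s) = zip c s"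
    using sets by (intro filter_True) (auto dest: set_zip_rightD)
  finally have pc: "proper_count n ?w = sum_list l" using len by simp
  obtain g where g: "g \<in> short (proper_symbols n) (Suc (sum_list l))" "mono ?w - g \<in> irr m0 m1 n"
    using virt_word[OF wA] fs pc by auto
  have gc: "g \<in> free_carrier (proper_symbols n)" using g by (simp add: short_def)
  have mw: "mono ?w \<in> free_carrier ?A" using wA by (auto simp: free_carrier_iff)
  have cs: "concat (map (map Letter) S) = s" by (simp add: s_def map_concat)
  have zc: "mono (zip s c) \<in> free_carrier ?A" "mono (zip c d) \<in> free_carrier ?A"
     "mono (zip d c) \<in> free_carrier ?A" "mono (zip c s) \<in> free_carrier ?A"
    using z by (auto simp: free_carrier_iff)
  have "bitableau m0 m1 n S S = devirt m0 m1 n (env_prod ?A (zip s c) \<otimes>\<^bsub>enveloping ?A\<^esub> env_prod ?A (zip c d)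
     \<otimes>\<^bsub>enveloping ?A\<^esub> env_prod ?A (zip d c) \<otimes>\<^bsub>enveloping ?A\<^esub> env_prod ?A (zip c s))"
    by (simp add: bitableau_def Let_def tableau_monomial_def assms(1) cs flip: c_def d_def)
  also have "\<dots> = devirt m0 m1 n (cl ?A (mono ?w))"
    unfolding env_prod_cl[OF z(1)] env_prod_cl[OF z(2)] env_prod_cl[OF z(3)] env_prod_cl[OF z(4)]
    using zc by (simp only: cl_mult free_carrier_mult) (simp add: mult_single plus_list_def w)
  also have "\<dots> = cl (proper_symbols n) g" by (rule devirt_cl[OF mw gc g(2)])
  finally have "bitableau m0 m1 n S S = cl (proper_symbols n) g" .
  moreover have "act g t = wact ?w t" if "t \<in> Vec (proper_symbols n) k" for t k
    using irr_act[OF g(2) that] by (simp add: act_diff)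
  ultimately show ?thesis using g(1) by blast
qed

lemma finite_row_strict_tableaux: "finite (row_strict_tableaux n l)"
proof -
  have *: "S \<in> row_strict_tableaux n l \<Longrightarrow> set S \<subseteq> {r. set r \<subseteq> {1..n} \<and> length r \<le> Max (insert 0 (set l))}
     \<and> length S \<le> length l" for S
    unfolding row_strict_tableaux_def by auto
  have "row_strict_tableaux n l \<subseteq> {S. set S \<subseteq> {r. set r \<subseteq> {1..n} \<and> length r \<le> Max (insert 0 (set l))}
     \<and> length S \<le> length l}"
    using * by blast
  then show ?thesis by (rule finite_subset) (intro finite_lists_length_le finite_atLeastAtMost)
qed

definition schur_op :: "nat \<Rightarrow> nat list \<Rightarrow> tensor \<Rightarrow> tensor" where
  "schur_op n l t = (\<Sum>S\<in>row_strict_tableaux n (conj_partition l). wact (capelli_word (conj_partition l) S) t)"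

lemma schur_element_act:
  assumes "length (conj_partition l) \<le> m0" "\<And>k. k \<in> set (conj_partition l) \<Longrightarrow> k \<le> m1"
  shows "\<exists>g\<in>short (proper_symbols n) (Suc (sum_list (conj_partition l))).
     schur_element m0 m1 n l = cl (proper_symbols n) g \<and>
     (\<forall>k. \<forall>t\<in>Vec (proper_symbols n) k. act g t = scl (1 / of_nat (hook_product (conj_partition l))) (schur_op n l t))"
proof (cases "l = []")
  case True
  \<comment> \<open>The empty shape has one tableau and hook product 1, so the general formula
    agrees with the separate definition of the unit.\<close>
  have "row_strict_tableaux n [] = {[]}" by (auto simp: row_strict_tableaux_def)
  moreover have "conj_partition [] = []" by (simp add: conj_partition_def first_part_def)
  moreover have "(1 :: free_alg) \<in> short A (Suc 0)" for A
    using short_single[of "[]" A 1 1] by (simp flip: single_one add: zero_list_def)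
  ultimately show ?thesis using True
    by (intro bexI[of _ 1]) (auto simp: schur_element_def cl_one schur_op_def capelli_word_def virtual_C_def
        virtual_D_def hook_product_def cells_def)
next
  case False
  let ?l = "conj_partition l" and ?P = "proper_symbols n"
  let ?R = "row_strict_tableaux n ?l"
  have "\<forall>S\<in>?R. \<exists>g. g\<in>short ?P (Suc (sum_list ?l)) \<and>
     bitableau m0 m1 n S S = cl ?P g \<and> (\<forall>k. \<forall>t\<in>Vec ?P k. act g t = wact (capelli_word ?l S) t)"
    using bitableau_act[OF _ _ assms] unfolding row_strict_tableaux_def by (simp add: Bex_def)
  then obtain G where G: "\<And>S. S \<in> ?R \<Longrightarrow> G S \<in> short ?P (Suc (sum_list ?l))"
    "\<And>S. S \<in> ?R \<Longrightarrow> bitableau m0 m1 n S S = cl ?P (G S)"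
    "\<And>S k t. S \<in> ?R \<Longrightarrow> t \<in> Vec ?P k \<Longrightarrow> act (G S) t = wact (capelli_word ?l S) t"
    by metis
  interpret ring "Ugl n" by (rule ring_enveloping)
  let ?c = "1 / of_nat (hook_product ?l)"
  let ?g = "free_scale ?c (\<Sum>S\<in>?R. G S)"
  have "(\<Oplus>\<^bsub>Ugl n\<^esub>S\<in>?R. bitableau m0 m1 n S S) = (\<Oplus>\<^bsub>Ugl n\<^esub>S\<in>?R. cl ?P (G S))"
    by (rule finsum_cong') (use G in \<open>auto simp: short_def\<close>)
  also have "\<dots> = cl ?P (\<Sum>S\<in>?R. G S)" by (rule cl_finsum) (use G(1) in \<open>auto simp: short_def\<close>)
  finally have "schur_element m0 m1 n l = cl ?P ?g" using False by (simp add: schur_element_def cl_smult)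
  moreover have "?g \<in> short ?P (Suc (sum_list ?l))" using G(1) by (intro short_scale short_sum)
  moreover have "act ?g t = scl ?c (schur_op n l t)" if "t \<in> Vec ?P k" for t k
    using G(3)[OF _ that] by (simp add: act_free_scale act_sum schur_op_def)
  ultimately show ?thesis by blast
qed

section \<open>Anticommuting polarizations\<close>

definition anti :: "(symbol \<times> symbol) \<Rightarrow> (symbol \<times> symbol) \<Rightarrow> bool" where
  "anti p q \<longleftrightarrow> (\<forall>t. pol (fst p) (snd p) (pol (fst q) (snd q) t) = - pol (fst q) (snd q) (pol (fst p) (snd p) t))"

definition anti_word :: "(symbol \<times> symbol) list \<Rightarrow> bool" where
  "anti_word w \<longleftrightarrow> (\<forall>p\<in>set w. \<forall>q\<in>set w. anti p q)"

lemma antiI: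
  assumes "parity a \<noteq> parity b" "parity c \<noteq> parity d" "b \<noteq> c" "a \<noteq> d"
  shows "anti (a, b) (c, d)"
proof -
  have "super_sign a b c d = - 1"
    using assms(1,2) parity_cases[of a] parity_cases[of b] parity_cases[of c] parity_cases[of d]
    by (auto simp: super_sign_def)
  then show ?thesis using assms unfolding anti_def by (simp add: pol_pol[of a b c d])
qed

text \<open>No first index equals a second one, so all superbrackets vanish and the odd letters
  anticommute.\<close>

lemma anti_wordI:
  assumes "set w \<subseteq> U \<times> V" "U \<inter> V = {}" "\<And>u v. u \<in> U \<Longrightarrow> v \<in> V \<Longrightarrow> parity u \<noteq> parity v"
  shows "anti_word w"
  unfolding anti_word_def
proof (intro ballI)
  fix p q assume "p \<in> set w" "q \<in> set w"
  then have "fst p \<in> U" "snd p \<in> V" "fst q \<in> U" "snd q \<in> V" using assms(1) by auto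
  then show "anti p q" using assms(2,3) antiI[of "fst p" "snd p" "fst q" "snd q"]
    by (metis disjoint_iff prod.collapse)
qed

lemma anti_word_subset: "anti_word w \<Longrightarrow> set u \<subseteq> set w \<Longrightarrow> anti_word u"
  unfolding anti_word_def by blast

lemma anti_move:
  "(\<And>q. q \<in> set w \<Longrightarrow> anti q p) \<Longrightarrow>
   wact w (pol (fst p) (snd p) t) = scl ((-1) ^ length w) (pol (fst p) (snd p) (wact w t))"
  by (induction w) (auto simp: anti_def)

text \<open>The sign (-1)^(k(k-1)/2) of the reversal of k letters.\<close>

primrec rev_sign :: "nat \<Rightarrow> complex" where
  "rev_sign 0 = 1"
| "rev_sign (Suc k) = (-1) ^ k * rev_sign k"

lemma rev_sign_square: "rev_sign k * rev_sign k = 1"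
proof (induction k)
  case (Suc k)
  have "rev_sign (Suc k) * rev_sign (Suc k) = ((-1) ^ k * (-1) ^ k) * (rev_sign k * rev_sign k)"
    by (simp add: mult_ac)
  then show ?case using Suc by (simp flip: power_mult_distrib)
qed simp

lemma wact_rev: "anti_word w \<Longrightarrow> wact (rev w) t = scl (rev_sign (length w)) (wact w t)"
proof (induction w arbitrary: t)
  case (Cons p w)
  have aw: "anti_word w" using Cons.prems by (auto simp: anti_word_def)
  have IH: "wact (rev w) t = scl (rev_sign (length w)) (wact w t)" for t by (rule Cons.IH[OF aw])
  have "wact (rev (p # w)) t = scl (rev_sign (length w)) (wact w (pol (fst p) (snd p) t))"
    by (simp add: wact_append IH)
  moreover have "wact w (pol (fst p) (snd p) t) = scl ((-1) ^ length w) (pol (fst p) (snd p) (wact w t))"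
    using Cons.prems by (intro anti_move) (auto simp: anti_word_def)
  ultimately show "wact (rev (p # w)) t = scl (rev_sign (length (p # w))) (wact (p # w) t)"
    by (simp add: mult.commute)
qed simp

lemma anti_word_kill:
  assumes "anti_word w" "p \<in> set w" "pol (fst p) (snd p) t = 0"
  shows "wact w t = 0"
proof -
  obtain u v where w: "w = u @ p # v" using split_list[OF assms(2)] by blast
  have "scl ((-1) ^ length v) (pol (fst p) (snd p) (wact v t)) = wact v (pol (fst p) (snd p) t)"
    using assms(1) w by (intro anti_move[symmetric]) (auto simp: anti_word_def)
  then have "scl ((-1) ^ length v) (scl ((-1) ^ length v) (pol (fst p) (snd p) (wact v t))) = 0"
    using assms(3) by simp
  then have "pol (fst p) (snd p) (wact v t) = 0" by (simp flip: power_mult_distrib)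
  then show ?thesis by (simp add: w wact_append)
qed

text \<open>A letter that anticommutes with itself squares to zero, and one of its two occurrences
  can be moved next to the other at the cost of a sign.\<close>

lemma anti_word_repeat:
  assumes "anti_word w" "\<not> distinct w"
  shows "wact w t = 0"
proof -
  obtain u v x p where w: "w = u @ [p] @ v @ [p] @ x" using not_distinct_decomp[OF assms(2)] by blast
  have "pol (fst p) (snd p) (pol (fst p) (snd p) s) = 0" for s
  proof -
    have "anti p p" using assms(1) w by (auto simp: anti_word_def)
    then have e: "pol (fst p) (snd p) (pol (fst p) (snd p) s) = - pol (fst p) (snd p) (pol (fst p) (snd p) s)"
      unfolding anti_def by blast
    show ?thesis
    proof
      fix z show "pol (fst p) (snd p) (pol (fst p) (snd p) s) z = 0 z" using fun_cong[OF e, of z] by simp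
    qed
  qed
  then have "pol (fst p) (snd p) (pol (fst p) (snd p) (wact x t)) = 0" .
  moreover have "anti_word (u @ [p] @ v)" by (rule anti_word_subset[OF assms(1)]) (auto simp: w)
  ultimately have "wact (u @ [p] @ v) (pol (fst p) (snd p) (wact x t)) = 0"
    by (intro anti_word_kill[of "u @ [p] @ v" p]) auto
  moreover have "wact w t = wact (u @ [p] @ v) (pol (fst p) (snd p) (wact x t))"
    by (simp add: w wact_append)
  ultimately show ?thesis by simp
qed

lemma anti_word_perm:
  assumes "anti_word w" "mset w = mset u"
  shows "wact w t = wact u t \<or> wact w t = - wact u t"
  using assms
proof (induction w arbitrary: u)
  case (Cons p w)
  then have "p \<in> set u" by (metis list.set_intros(1) set_mset_mset)
  then obtain u1 u2 where u: "u = u1 @ p # u2" by (meson split_list)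
  have m: "mset w = mset (u1 @ u2)" using Cons.prems u by simp
  have aw: "anti_word w" using Cons.prems by (auto simp: anti_word_def)
  have su: "set u = set (p # w)" using Cons.prems by (metis set_mset_mset)
  have "wact u t = wact u1 (pol (fst p) (snd p) (wact u2 t))" by (simp add: u wact_append)
  also have "\<dots> = scl ((-1) ^ length u1) (pol (fst p) (snd p) (wact (u1 @ u2) t))"
    using Cons.prems(1) su u by (subst anti_move) (auto simp: anti_word_def wact_append)
  finally have "wact u t = pol (fst p) (snd p) (wact (u1 @ u2) t) \<or> wact u t = - pol (fst p) (snd p) (wact (u1 @ u2) t)"
    by (cases "even (length u1)") auto
  moreover have "wact w t = wact (u1 @ u2) t \<or> wact w t = - wact (u1 @ u2) t" by (rule Cons.IH[OF aw m])
  ultimately show "wact (p # w) t = wact u t \<or> wact (p # w) t = - wact u t" by auto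
qed simp

text \<open>The Leibniz rule for the commutator with an even e_{c,d}: in each letter of the word a
  first index d becomes c, and, with a minus sign, a second index c becomes d.\<close>

lemma pol_wact_even:
  assumes "parity c = parity d"
  shows "pol c d (wact w t) = wact w (pol c d t) +
    (\<Sum>p<length w. (if fst (w ! p) = d then wact (w[p := (c, snd (w ! p))]) t else 0)
       - (if snd (w ! p) = c then wact (w[p := (fst (w ! p), d)]) t else 0))"
proof (induction w)
  case (Cons q w)
  obtain a b where q: "q = (a, b)" by (cases q)
  have sgn: "super_sign c d a b = 1" using assms by (simp add: super_sign_def flip: mult_2)
  have "pol c d (wact (q # w) t) = pol a b (pol c d (wact w t))
     + (if a = d then pol c b (wact w t) else 0) - (if b = c then pol a d (wact w t) else 0)"
    by (simp add: q pol_pol[of c d a b] sgn eq_commute)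
  moreover have "pol a b (pol c d (wact w t)) = wact (q # w) (pol c d t) +
    (\<Sum>p<length w. (if fst (w ! p) = d then wact (q # w[p := (c, snd (w ! p))]) t else 0)
       - (if snd (w ! p) = c then wact (q # w[p := (fst (w ! p), d)]) t else 0))"
  proof -
    have IH: "pol c d (wact w t) = wact w (pol c d t) +
      (\<Sum>p<length w. (if fst (w ! p) = d then wact (w[p := (c, snd (w ! p))]) t else 0)
       - (if snd (w ! p) = c then wact (w[p := (fst (w ! p), d)]) t else 0))" by (rule Cons.IH)
    show ?thesis unfolding IH by (simp add: q if_distrib[of "pol a b"] cong: if_cong)
  qed
  ultimately show "pol c d (wact (q # w) t) = wact (q # w) (pol c d t) +
    (\<Sum>p<length (q # w). (if fst ((q # w) ! p) = d then wact ((q # w)[p := (c, snd ((q # w) ! p))]) t else 0)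
       - (if snd ((q # w) ! p) = c then wact ((q # w)[p := (fst ((q # w) ! p), d)]) t else 0))"
    by (simp add: sum.lessThan_Suc_shift q algebra_simps del: sum.lessThan_Suc cong: if_cong)
qed simp

lemma pol_diag: "pol x x t w = of_nat (count_list w x) * t w"
proof (induction w arbitrary: t)
  case (Cons y w)
  have "(-1 :: complex) ^ ((parity x + parity x) * parity y) = 1"
    by (metis dvd_mult2 even_add even_power power_minus_even power_one uminus_power_if)
  then show ?case using Cons by (simp add: algebra_simps)
qed simp

lemma pol_absent: "(\<And>w. t w \<noteq> 0 \<Longrightarrow> b \<notin> set w) \<Longrightarrow> pol a b t = 0"
  by (rule ext, rule ccontr) (metis pol_count zero_fun_apply)

section \<open>Odd reflections\<close>

definition hwt :: "(nat \<Rightarrow> symbol) \<Rightarrow> nat \<Rightarrow> (nat \<Rightarrow> nat) \<Rightarrow> tensor \<Rightarrow> bool" where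
  "hwt a N \<mu> v \<longleftrightarrow> (\<forall>i j. 1 \<le> i \<and> i < j \<and> j \<le> N \<longrightarrow> pol (a i) (a j) v = 0) \<and>
     (\<forall>i w. 1 \<le> i \<and> i \<le> N \<and> v w \<noteq> 0 \<longrightarrow> count_list w (a i) = \<mu> i)"

definition lacks :: "symbol \<Rightarrow> tensor \<Rightarrow> bool" where
  "lacks x v \<longleftrightarrow> (\<forall>w. v w \<noteq> 0 \<longrightarrow> x \<notin> set w)"

lemma lacks_wact: "lacks x v \<Longrightarrow> x \<notin> fst ` set u \<Longrightarrow> lacks x (wact u v)"
  unfolding lacks_def
proof (intro allI impI)
  fix w assume *: "\<forall>w. v w \<noteq> 0 \<longrightarrow> x \<notin> set w" "x \<notin> fst ` set u" "wact u v w \<noteq> 0"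
  obtain z where z: "v z \<noteq> 0"
    "\<And>x. int (count_list w x) = int (count_list z x) + int (count_list (map fst u) x) - int (count_list (map snd u) x)"
    using wact_count[OF *(3)] by blast
  have "count_list z x = 0" "count_list (map fst u) x = 0" using *(1,2) z(1) by (auto simp: count_list_0_iff)
  with z(2)[of x] have "count_list w x = 0" by simp
  then show "x \<notin> set w" by (simp add: count_list_0_iff)
qed

lemma lacks_pol: "lacks b t \<Longrightarrow> pol a b t = 0"
  unfolding lacks_def by (rule pol_absent) blast

lemma diag_scl: "(\<And>w. t w \<noteq> 0 \<Longrightarrow> count_list w x = m) \<Longrightarrow> pol x x t = scl (of_nat m) t"
  by (rule ext) (auto simp: pol_diag)

text \<open>Applying \<open>e\<^bsub>\<beta>,a(h)\<^esub>\<close>, then \<open>e\<^bsub>\<beta>,a(h-1)\<^esub>\<close>, down to \<open>e\<^bsub>\<beta>,a(1)\<^esub>\<close> removes the first column of the weight.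
  Before the step with \<open>e\<^bsub>\<beta>,a(s)\<^esub>\<close> the vector is annihilated by \<open>e\<^bsub>a(s),\<beta>\<^esub>\<close>, so the anticommutator
  \<open>e\<^bsub>a(s),a(s)\<^esub> + e\<^bsub>\<beta>,\<beta>\<^esub>\<close>, which acts by a positive number, shows that the step is injective.\<close>

locale odd_row =
  fixes a :: "nat \<Rightarrow> symbol" and N h :: nat and \<beta> :: symbol and B :: "symbol set" and k :: nat
    and v :: tensor and \<mu> :: "nat \<Rightarrow> nat"
  assumes inj: "inj a" and parity: "\<And>i. parity (a i) \<noteq> parity \<beta>"
    and hw: "hwt a N \<mu> v" and h: "h \<le> N" "\<And>i. 1 \<le> i \<Longrightarrow> i \<le> N \<Longrightarrow> \<mu> i > 0 \<longleftrightarrow> i \<le> h"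
    and v: "v \<noteq> 0" "v \<in> Vec B k" "lacks \<beta> v"
    and B: "finite B" "\<beta> \<in> B" "\<And>i. 1 \<le> i \<Longrightarrow> i \<le> N \<Longrightarrow> a i \<in> B"
begin

definition row :: "nat \<Rightarrow> (symbol \<times> symbol) list" where
  "row s = map (\<lambda>i. (\<beta>, a i)) [s..<Suc h]"

lemma parity_eq: "parity (a i) = parity (a j)"
  using parity[of i] parity[of j] parity_cases[of "a i"] parity_cases[of "a j"] parity_cases[of \<beta>] by auto

lemma neq: "a i \<noteq> \<beta>" "\<beta> \<noteq> a i"
  using parity[of i] by auto

lemma anti_rows: "set w \<subseteq> {\<beta>} \<times> range a \<Longrightarrow> anti_word w"
  by (rule anti_wordI[of _ "{\<beta>}" "range a"]) (auto simp: neq parity[symmetric])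

text \<open>The commutator with e_{a(i),a(j)} turns the letter \<open>(\<beta>, a i)\<close> into
  \<open>(\<beta>, a j)\<close>. For \<open>j \<le> h\<close> this letter then occurs twice; for
  \<open>j > h\<close> the symbol \<open>a j\<close> is absent from \<open>v\<close>.\<close>

lemma row_hw:
  assumes "1 \<le> i" "i < j" "j \<le> N"
  shows "pol (a i) (a j) (wact (row s) v) = 0"
proof -
  let ?R = "row s"
  have R: "fst (?R ! p) = \<beta>" "snd (?R ! p) = a (s + p)" "s + p < Suc h" if "p < length ?R" for p
    using that by (auto simp: row_def simp del: upt_Suc)
  have "wact (?R[p := (\<beta>, a j)]) v = 0" if p: "p < length ?R" "snd (?R ! p) = a i" for p
  proof -
    let ?R' = "?R[p := (\<beta>, a j)]"
    have i: "i = s + p" using p R[OF p(1)] inj by (auto dest: injD)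
    have aw: "anti_word ?R'"
      by (rule anti_rows) (use set_update_subset_insert[of ?R p "(\<beta>, a j)"] in \<open>auto simp: row_def\<close>)
    show ?thesis
    proof (cases "j \<le> h")
      case True
      define q where "q = j - s"
      have q: "q < length ?R" "q \<noteq> p" "?R ! q = (\<beta>, a j)"
        using True assms i by (auto simp: q_def row_def nth_append simp del: upt_Suc)
      then have "?R' ! p = ?R' ! q" "p < length ?R'" "q < length ?R'" using p(1) by auto
      then have "\<not> distinct ?R'" using q(2) nth_eq_iff_index_eq by blast
      with aw show ?thesis by (rule anti_word_repeat)
    next
      case False
      have "lacks (a j) v" unfolding lacks_def
      proof (intro allI impI)
        fix w assume "v w \<noteq> 0"
        then have "count_list w (a j) = \<mu> j" using hw assms unfolding hwt_def by auto
        also have "\<dots> = 0" using h(2)[of j] False assms by auto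
        finally show "a j \<notin> set w" by (simp add: count_list_0_iff)
      qed
      then have "pol \<beta> (a j) v = 0" by (rule lacks_pol)
      then show ?thesis using anti_word_kill[OF aw, of "(\<beta>, a j)"] p(1) set_update_memI[of p ?R] by simp
    qed
  qed
  then have "(\<Sum>p<length ?R. (if fst (?R ! p) = a j then wact (?R[p := (a i, snd (?R ! p))]) v else 0)
       - (if snd (?R ! p) = a i then wact (?R[p := (fst (?R ! p), a j)]) v else 0)) = 0"
    using R neq by (intro sum.neutral) auto
  moreover have "pol (a i) (a j) v = 0" using hw assms unfolding hwt_def by auto
  ultimately show ?thesis using pol_wact_even[OF parity_eq[of i j], of ?R v] by simp
qed

lemma row_step: "s \<le> h \<Longrightarrow> row s = (\<beta>, a s) # row (Suc s)"
  by (simp add: row_def upt_rec)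

lemma row_count:
  assumes "wact (row s) v w \<noteq> 0" "1 \<le> s"
  shows "1 \<le> i \<Longrightarrow> i \<le> N \<Longrightarrow> count_list w (a i) = \<mu> i - (if s \<le> i \<and> i \<le> h then 1 else 0)"
    and "count_list w \<beta> = Suc h - s"
proof -
  obtain u where u: "v u \<noteq> 0"
    "\<And>x. int (count_list w x) = int (count_list u x) + int (count_list (map fst (row s)) x) - int (count_list (map snd (row s)) x)"
    using wact_count[OF assms(1)] by blast
  have f: "map fst (row s) = replicate (Suc h - s) \<beta>"
    by (simp add: row_def comp_def map_replicate_const del: upt_Suc)
  have g: "map snd (row s) = map a [s..<Suc h]" by (simp add: row_def comp_def del: upt_Suc)
  have "\<beta> \<notin> set u" using v(3) u(1) by (auto simp: lacks_def)
  then have "count_list u \<beta> = 0" by (simp add: count_list_0_iff)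
  moreover have "\<beta> \<notin> set (map a [s..<Suc h])" using neq by auto
  then have "count_list (map a [s..<Suc h]) \<beta> = 0" by (simp add: count_list_0_iff del: upt_Suc)
  moreover have "count_list (replicate m \<beta>) \<beta> = m" for m by (induction m) auto
  ultimately show "count_list w \<beta> = Suc h - s" using u(2)[of \<beta>] unfolding f g by simp
  assume i: "1 \<le> i" "i \<le> N"
  have c1: "count_list u (a i) = \<mu> i" using hw u(1) i unfolding hwt_def by auto
  have "a i \<notin> set (replicate m \<beta>)" for m using neq by auto
  then have c2: "count_list (replicate m \<beta>) (a i) = 0" for m by (simp add: count_list_0_iff)
  have c3: "count_list (map a [s..<m]) (a i) = (if s \<le> i \<and> i < m then 1 else 0)" for m
    using inj by (induction m) (auto dest: injD simp: less_Suc_eq)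
  show "count_list w (a i) = \<mu> i - (if s \<le> i \<and> i \<le> h then 1 else 0)"
    using u(2)[of "a i"] unfolding f g c1 c2 c3 by (auto split: if_splits)
qed

lemma row_Vec: "wact (row s) v \<in> Vec B k"
  using v(2) B(2) by (intro wact_Vec) (auto simp: row_def)

lemma row_nonzero:
  assumes "1 \<le> s" "s \<le> Suc h"
  shows "wact (row s) v \<noteq> 0 \<and> (\<forall>i. 1 \<le> i \<and> i < s \<longrightarrow> pol (a i) \<beta> (wact (row s) v) = 0)"
  using assms(2,1)
proof (induction rule: inc_induct)
  case base
  have "row (Suc h) = []" by (simp add: row_def)
  then show ?case using v lacks_pol by auto
next
  case (step s)
  let ?u = "wact (row (Suc s)) v"
  have IH: "?u \<noteq> 0" "\<And>i. 1 \<le> i \<Longrightarrow> i < Suc s \<Longrightarrow> pol (a i) \<beta> ?u = 0" using step by auto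
  have sh: "s \<le> h" "1 \<le> s" "s \<le> N" using step h by auto
  have r: "wact (row s) v = pol \<beta> (a s) ?u" using row_step[OF sh(1)] by simp
  have sgn: "super_sign (a i) \<beta> \<beta> (a s) = - 1" for i
    using parity[of i] parity[of s] parity_cases[of "a i"] parity_cases[of "a s"] parity_cases[of \<beta>]
    by (auto simp: super_sign_def)
  \<comment> \<open>By the induction hypothesis e_{a(i),\<beta>} kills \<open>?u\<close>, so only
    the superbracket remains.\<close>
  have com: "pol (a i) \<beta> (pol \<beta> (a s) ?u) = pol (a i) (a s) ?u + (if i = s then pol \<beta> \<beta> ?u else 0)"
    if "1 \<le> i" "i < Suc s" for i
    using IH(2)[OF that] inj by (auto simp: pol_pol[of "a i" \<beta> \<beta> "a s"] sgn dest: injD)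
  have "pol (a s) (a s) ?u = scl (of_nat (\<mu> s)) ?u"
    using row_count(1)[of "Suc s" _ s] sh by (intro diag_scl) auto
  moreover have "pol \<beta> \<beta> ?u = scl (of_nat (h - s)) ?u"
    using row_count(2)[of "Suc s"] sh by (intro diag_scl) auto
  ultimately have "pol (a s) \<beta> (pol \<beta> (a s) ?u) = scl (of_nat (\<mu> s + (h - s))) ?u"
    using com[OF sh(2)] by (simp add: scl_distribs)
  \<comment> \<open>Adjointness turns the anticommutator into a comparison of squared norms. The
    factor is positive because \<open>\<mu> s > 0\<close> for \<open>s \<le> h\<close>.\<close>
  then have "ip B k (pol \<beta> (a s) ?u) (pol \<beta> (a s) ?u) = of_nat (\<mu> s + (h - s)) * ip B k ?u ?u"
    using ip_pol[OF B(1) B(3)[OF sh(2,3)] B(2), of k "pol \<beta> (a s) ?u" ?u] by simp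
  moreover have "ip B k ?u ?u \<noteq> 0" using ip_definite[OF B(1) _ row_Vec] IH(1) by blast
  moreover have "complex_of_nat (\<mu> s + (h - s)) \<noteq> 0" using h(2)[of s] sh unfolding of_nat_eq_0_iff by auto
  ultimately have "ip B k (wact (row s) v) (wact (row s) v) \<noteq> 0" by (simp add: r del: of_nat_add)
  then have "wact (row s) v \<noteq> 0" by auto
  moreover have "pol (a i) \<beta> (wact (row s) v) = 0" if "1 \<le> i" "i < s" for i
    using com[of i] row_hw[of i s "Suc s"] that sh r by auto
  ultimately show ?case by blast
qed

lemma row_hwt: "hwt a N (\<lambda>i. \<mu> i - (if i \<le> h then 1 else 0)) (wact (row 1) v)"
  unfolding hwt_def using row_hw row_count(1)[of 1] by auto

end

text \<open>\<open>ks\<close> lists the column lengths of the weight. The first column stands at the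
  right end, so it is removed first, and column q, counted from zero, is emptied into the symbol
  \<open>b (r + q)\<close>.\<close>

fun reflection_word :: "(nat \<Rightarrow> symbol) \<Rightarrow> (nat \<Rightarrow> symbol) \<Rightarrow> nat \<Rightarrow> nat list \<Rightarrow> (symbol \<times> symbol) list" where
  "reflection_word b a r [] = []"
| "reflection_word b a r (k # ks) =
     reflection_word b a (Suc r) ks @ map (\<lambda>i. (b r, a i)) [1..<Suc k]"

text \<open>By \<open>row_hwt\<close> the removal of the longest column leaves a highest weight
  vector whose column lengths are the tail of \<open>ks\<close>, so the next symbol of
  \<open>b\<close> can take over.\<close>

lemma reflection_word_nonzero:
  assumes "inj a" "inj b" "\<And>i j. parity (a i) \<noteq> parity (b j)"
    and "sorted_wrt (\<ge>) ks" "\<And>k. k \<in> set ks \<Longrightarrow> k \<le> N"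
    and "hwt a N (\<lambda>i. length (filter (\<lambda>k. i \<le> k) ks)) v"
    and "v \<noteq> 0" "v \<in> Vec B k" "\<And>j. j \<ge> r \<Longrightarrow> lacks (b j) v"
    and "finite B" "\<And>i. 1 \<le> i \<Longrightarrow> i \<le> N \<Longrightarrow> a i \<in> B" "\<And>j. r \<le> j \<Longrightarrow> j < r + length ks \<Longrightarrow> b j \<in> B"
  shows "wact (reflection_word b a r ks) v \<noteq> 0"
  using assms(4-)
proof (induction ks arbitrary: r v)
  case (Cons h ks)
  have pos: "0 < length (filter (\<lambda>k. i \<le> k) (h # ks)) \<longleftrightarrow> i \<le> h" for i
    using Cons.prems(1) by (auto simp: filter_empty_conv)
  interpret odd_row a N h "b r" B k v "\<lambda>i. length (filter (\<lambda>k. i \<le> k) (h # ks))"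
    by unfold_locales (use Cons.prems assms(1,3) pos in auto)
  let ?v = "wact (row 1) v"
  have row: "row 1 = map (\<lambda>i. (b r, a i)) [1..<Suc h]" by (simp add: row_def)
  have "wact (reflection_word b a (Suc r) ks) ?v \<noteq> 0"
  proof (rule Cons.IH)
    show "sorted_wrt (\<ge>) ks" "\<And>k. k \<in> set ks \<Longrightarrow> k \<le> N" using Cons.prems by auto
    have "length (filter (\<lambda>k. i \<le> k) (h # ks)) - (if i \<le> h then 1 else 0) = length (filter (\<lambda>k. i \<le> k) ks)" for i
      by simp
    then show "hwt a N (\<lambda>i. length (filter (\<lambda>k. i \<le> k) ks)) ?v" using row_hwt by simp
    show "?v \<noteq> 0" using row_nonzero[of 1] by simp
    show "?v \<in> Vec B k" by (rule row_Vec)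
    show "lacks (b j) ?v" if "j \<ge> Suc r" for j
      using Cons.prems(6)[of j] that assms(2)
      by (intro lacks_wact) (auto simp: row_def inj_eq)
    show "finite B" "\<And>i. 1 \<le> i \<Longrightarrow> i \<le> N \<Longrightarrow> a i \<in> B" "\<And>j. Suc r \<le> j \<Longrightarrow> j < Suc r + length ks \<Longrightarrow> b j \<in> B"
      using Cons.prems by auto
  qed
  then show ?case unfolding row by (simp add: wact_append del: upt_Suc)
qed simp

lemma set_reflection_word:
  "set (reflection_word b a r ks) = {(b (r + q), a i) | q i. q < length ks \<and> 1 \<le> i \<and> i \<le> ks ! q}"
proof (induction ks arbitrary: r)
  case (Cons k ks)
  have "(x \<in> set (reflection_word b a r (k # ks))) =
     (x \<in> {(b (r + q), a i) | q i. q < length (k # ks) \<and> 1 \<le> i \<and> i \<le> (k # ks) ! q})" for x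
  proof -
    have "(\<exists>q i. x = (b (r + q), a i) \<and> q < Suc (length ks) \<and> 1 \<le> i \<and> i \<le> (k # ks) ! q) \<longleftrightarrow>
      (\<exists>i. x = (b r, a i) \<and> 1 \<le> i \<and> i \<le> k) \<or> (\<exists>q i. x = (b (Suc r + q), a i) \<and> q < length ks \<and> 1 \<le> i \<and> i \<le> ks ! q)"
      (is "?L \<longleftrightarrow> ?R")
    proof
      assume ?L
      then obtain q i where "x = (b (r + q), a i)" "q < Suc (length ks)" "1 \<le> i" "i \<le> (k # ks) ! q" by blast
      then show ?R by (cases q) auto
    next
      assume ?R
      then show ?L
      proof
        assume "\<exists>q i. x = (b (Suc r + q), a i) \<and> q < length ks \<and> 1 \<le> i \<and> i \<le> ks ! q"
        then obtain q i where "x = (b (Suc r + q), a i)" "q < length ks" "1 \<le> i" "i \<le> ks ! q" by blast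
        then show ?L by (intro exI[of _ "Suc q"] exI[of _ i]) auto
      next
        assume "\<exists>i. x = (b r, a i) \<and> 1 \<le> i \<and> i \<le> k"
        then obtain i where "x = (b r, a i)" "1 \<le> i" "i \<le> k" by blast
        then show ?L by (intro exI[of _ 0] exI[of _ i]) auto
      qed
    qed
    moreover have "x \<in> set (map (\<lambda>i. (b r, a i)) [1..<Suc k]) \<longleftrightarrow> (\<exists>i. x = (b r, a i) \<and> 1 \<le> i \<and> i \<le> k)"
      by (auto simp: less_Suc_eq_le simp del: upt_Suc)
    ultimately show ?thesis
      unfolding reflection_word.simps set_append Un_iff Cons[of "Suc r"] length_Cons by blast
  qed
  then show ?case by blast
qed simp

lemma distinct_reflection_word:
  assumes "inj a" "inj b"
  shows "distinct (reflection_word b a r ks)"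
proof (induction ks arbitrary: r)
  case (Cons k ks)
  have "distinct (map (\<lambda>i. (b r, a i)) [1..<Suc k])"
    using assms(1) by (auto simp: distinct_map inj_on_def dest: injD)
  moreover have "set (reflection_word b a (Suc r) ks) \<inter> set (map (\<lambda>i. (b r, a i)) [1..<Suc k]) = {}"
    using assms(2) by (auto simp: set_reflection_word inj_eq simp del: upt_Suc)
  ultimately show ?case using Cons by (simp del: upt_Suc)
qed simp

text \<open>The commutator with e_{b(q),b(r)}, q < r, replaces a letter \<open>(b r, a i)\<close> by
  \<open>(b q, a i)\<close>, which is already present because column q is at least as long as column
  r. The result has highest weight for the alphabet \<open>b\<close>, so a second round of
  reflections can start from it.\<close>

lemma reflection_word_hwt:
  assumes "inj a" "inj b" "\<And>i j. parity (a i) \<noteq> parity (b j)"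
    and "sorted_wrt (\<ge>) ks" "\<And>j. j \<ge> 1 \<Longrightarrow> lacks (b j) v"
  shows "hwt b (length ks) (\<lambda>r. ks ! (r - 1)) (wact (reflection_word b a 1 ks) v)"
proof -
  let ?W = "reflection_word b a 1 ks"
  have neq: "a i \<noteq> b j" for i j using assms(3)[of i j] by auto
  have neq': "b j \<noteq> a i" for i j using neq by metis
  have peq: "parity (b i) = parity (b j)" for i j
    using assms(3)[of 0 i] assms(3)[of 0 j] parity_cases[of "b i"] parity_cases[of "b j"] parity_cases[of "a 0"] by auto
  have pol0: "pol (b q) (b r) (wact ?W v) = 0" if qr: "1 \<le> q" "q < r" "r \<le> length ks" for q r
  proof -
    have "wact (?W[p := (b q, snd (?W ! p))]) v = 0" if p: "p < length ?W" "fst (?W ! p) = b r" for p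
    proof -
      let ?W' = "?W[p := (b q, snd (?W ! p))]"
      have "?W ! p \<in> set ?W" using p by simp
      then obtain r' i where i: "?W ! p = (b (1 + r'), a i)" "r' < length ks" "1 \<le> i" "i \<le> ks ! r'"
        unfolding set_reflection_word by blast
      with p(2) assms(2) have r': "r = Suc r'" by (auto dest: injD)
      have "ks ! r' \<le> ks ! (q - 1)" using assms(4) qr r' i(2) by (auto simp: sorted_wrt_iff_nth_less)
      then have "(b q, a i) \<in> set ?W" unfolding set_reflection_word
        using i qr r' by (intro CollectI exI[of _ "q - 1"] exI[of _ i]) auto
      then obtain p' where p': "p' < length ?W" "?W ! p' = (b q, a i)" by (auto simp: in_set_conv_nth)
      have "p' \<noteq> p" using p(2) p'(2) assms(2) qr by (auto dest: injD)
      then have "?W' ! p = ?W' ! p'" "p < length ?W'" "p' < length ?W'" using p(1) p' i(1) by auto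
      then have "\<not> distinct ?W'" using \<open>p' \<noteq> p\<close> nth_eq_iff_index_eq by blast
      moreover have "anti_word ?W'"
      proof (rule anti_wordI)
        have "set ?W \<subseteq> range b \<times> range a" by (auto simp: set_reflection_word)
        then show "set ?W' \<subseteq> range b \<times> range a"
          using set_update_subset_insert[of ?W p "(b q, snd (?W ! p))"] i(1) by auto
      qed (use neq assms(3) in \<open>auto, metis+\<close>)
      ultimately show ?thesis by (intro anti_word_repeat)
    qed
    moreover have "snd (?W ! p) \<noteq> b q" if "p < length ?W" for p
    proof -
      have "?W ! p \<in> set ?W" using that by simp
      then show ?thesis unfolding set_reflection_word using neq by auto
    qed
    ultimately have "(\<Sum>p<length ?W. (if fst (?W ! p) = b r then wact (?W[p := (b q, snd (?W ! p))]) v else 0)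
       - (if snd (?W ! p) = b q then wact (?W[p := (fst (?W ! p), b r)]) v else 0)) = 0"
      by (intro sum.neutral) auto
    moreover have "pol (b q) (b r) v = 0" using assms(5)[of r] qr by (intro lacks_pol) auto
    ultimately show ?thesis using pol_wact_even[OF peq[of q r], of ?W v] by simp
  qed
  have cnt: "count_list (map fst (reflection_word b a s ks)) (b (s + q)) = ks ! q" if "q < length ks" for q s ks
    using that
  proof (induction ks arbitrary: q s)
    case (Cons k ks)
    have r: "map fst (map (\<lambda>i. (b s, a i)) [1..<Suc k]) = replicate k (b s)"
      by (simp add: comp_def map_replicate_const del: upt_Suc)
    have c: "count_list (replicate k x) y = (if x = y then k else 0)" for k and x y :: symbol
      by (induction k) auto
    show ?case
    proof (cases q)
      case 0
      have "b s \<notin> set (map fst (reflection_word b a (Suc s) ks))"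
        using assms(2) by (auto simp: set_reflection_word inj_eq)
      then show ?thesis using 0 r c by (simp add: count_list_0_iff del: upt_Suc)
    next
      case (Suc q')
      then have "count_list (map fst (reflection_word b a (Suc s) ks)) (b (Suc s + q')) = ks ! q'"
        using Cons.IH[of q' "Suc s"] Cons.prems by simp
      then show ?thesis using Suc r c assms(2) by (simp add: inj_eq del: upt_Suc)
    qed
  qed simp
  have "count_list w (b i) = ks ! (i - 1)" if i: "1 \<le> i" "i \<le> length ks" "wact ?W v w \<noteq> 0" for i w
  proof -
    obtain u where u: "v u \<noteq> 0"
      "\<And>x. int (count_list w x) = int (count_list u x) + int (count_list (map fst ?W) x) - int (count_list (map snd ?W) x)"
      using wact_count[OF i(3)] by blast
    have "b i \<notin> set u" using u(1) assms(5)[of i] i by (auto simp: lacks_def)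
    then have "count_list u (b i) = 0" by (simp add: count_list_0_iff)
    moreover have "b i \<notin> set (map snd ?W)" using neq' by (auto simp: set_reflection_word)
    then have "count_list (map snd ?W) (b i) = 0" by (simp add: count_list_0_iff)
    ultimately show ?thesis using u(2)[of "b i"] cnt[of "i - 1" ks 1] i by simp
  qed
  with pol0 show ?thesis unfolding hwt_def by blast
qed

section \<open>Centrality of the Schur elements\<close>

definition sandwich :: "symbol \<Rightarrow> nat \<Rightarrow> (tensor \<Rightarrow> tensor) \<Rightarrow> tensor \<Rightarrow> tensor" where
  "sandwich \<alpha> s F = (\<lambda>t. pol (Letter s) \<alpha> (F (pol \<alpha> (Letter s) t)))"

definition sandwich_sum :: "nat \<Rightarrow> symbol \<Rightarrow> (tensor \<Rightarrow> tensor) \<Rightarrow> tensor \<Rightarrow> tensor" where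
  "sandwich_sum n \<alpha> F = (\<lambda>t. \<Sum>s=1..n. sandwich \<alpha> s F t)"

text \<open>The elementary symmetric functions of the commuting, square-zero superoperators
  \<open>sandwich \<alpha> s\<close>.\<close>

fun row_sum :: "nat \<Rightarrow> nat \<Rightarrow> symbol \<Rightarrow> (tensor \<Rightarrow> tensor) \<Rightarrow> tensor \<Rightarrow> tensor" where
  "row_sum n 0 \<alpha> F = F"
| "row_sum 0 (Suc k) \<alpha> F = (\<lambda>t. 0)"
| "row_sum (Suc n) (Suc k) \<alpha> F =
     (\<lambda>t. row_sum n (Suc k) \<alpha> F t + row_sum n k \<alpha> (sandwich \<alpha> (Suc n) F) t)"

lemma lin_sandwich: "lin F \<Longrightarrow> lin (sandwich \<alpha> s F)"
  unfolding sandwich_def lin_def[of "\<lambda>t. _ t"] by (simp add: lin_simps)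

lemma lin_row_sum: "lin F \<Longrightarrow> lin (row_sum n k \<alpha> F)"
proof (induction n k \<alpha> F rule: row_sum.induct)
  case (3 n k \<alpha> F)
  have "lin (row_sum n (Suc k) \<alpha> F)" "lin (row_sum n k \<alpha> (sandwich \<alpha> (Suc n) F))"
    using 3 lin_sandwich by auto
  then show ?case unfolding lin_def by (simp add: scl_distribs)
qed (auto simp: lin_def)

lemma sandwich_zero: "sandwich \<alpha> s (\<lambda>t. 0) = (\<lambda>t. 0)"
  by (simp add: sandwich_def)

lemma row_sum_zero: "row_sum n k \<alpha> (\<lambda>t. 0) = (\<lambda>t. 0)"
proof -
  have "F = (\<lambda>t. 0) \<Longrightarrow> row_sum n k \<alpha> F = (\<lambda>t. 0)" for F
    by (induction n k \<alpha> F rule: row_sum.induct) (simp_all add: sandwich_zero)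
  then show ?thesis by simp
qed

lemma anti_letters:
  assumes "parity \<alpha> = 0"
  shows "anti (Letter s, \<alpha>) (Letter r, \<alpha>)" "anti (\<alpha>, Letter s) (\<alpha>, Letter r)"
proof -
  have "\<alpha> \<noteq> Letter i" "Letter i \<noteq> \<alpha>" for i using assms by auto
  then show "anti (Letter s, \<alpha>) (Letter r, \<alpha>)" "anti (\<alpha>, Letter s) (\<alpha>, Letter r)"
    using assms by (auto intro!: antiI)
qed

text \<open>The exchange costs one sign on the left of \<open>F\<close> and one on the
  right.\<close>

lemma sandwich_commute:
  assumes "parity \<alpha> = 0" "lin F"
  shows "sandwich \<alpha> s (sandwich \<alpha> r F) = sandwich \<alpha> r (sandwich \<alpha> s F)"
proof
  fix t
  have "pol (Letter s) \<alpha> (pol (Letter r) \<alpha> y) = - pol (Letter r) \<alpha> (pol (Letter s) \<alpha> y)"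
    "pol \<alpha> (Letter r) (pol \<alpha> (Letter s) y) = - pol \<alpha> (Letter s) (pol \<alpha> (Letter r) y)" for y
    using anti_letters(1)[OF assms(1), of s r] anti_letters(2)[OF assms(1), of r s]
    unfolding anti_def fst_conv snd_conv by blast+
  note this(1)[of "F (pol \<alpha> (Letter r) (pol \<alpha> (Letter s) t))"] this(2)[of t]
  then show "sandwich \<alpha> s (sandwich \<alpha> r F) t = sandwich \<alpha> r (sandwich \<alpha> s F) t"
    by (simp add: sandwich_def lin_minus[OF assms(2)])
qed

lemma neg_self_zero: "t = - t \<Longrightarrow> t = (0 :: tensor)"
  by (auto simp: fun_eq_iff)

lemma sandwich_square:
  assumes "parity \<alpha> = 0"
  shows "sandwich \<alpha> s (sandwich \<alpha> s F) = (\<lambda>t. 0)"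
proof
  fix t
  show "sandwich \<alpha> s (sandwich \<alpha> s F) t = 0"
    using anti_letters(1)[OF assms, of s s] unfolding anti_def sandwich_def
    by (intro neg_self_zero) simp
qed

lemma sandwich_add: "sandwich \<alpha> s (\<lambda>t. F t + G t) = (\<lambda>t. sandwich \<alpha> s F t + sandwich \<alpha> s G t)"
  by (simp add: sandwich_def)

lemma sandwich_row_sum:
  assumes "parity \<alpha> = 0" "lin F"
  shows "sandwich \<alpha> s (row_sum n k \<alpha> F) = row_sum n k \<alpha> (sandwich \<alpha> s F)"
  using assms(2,1)
proof (induction n k \<alpha> F rule: row_sum.induct)
  case (3 n k \<alpha> F)
  have "sandwich \<alpha> s (row_sum n (Suc k) \<alpha> F) = row_sum n (Suc k) \<alpha> (sandwich \<alpha> s F)"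
    "sandwich \<alpha> s (row_sum n k \<alpha> (sandwich \<alpha> (Suc n) F)) = row_sum n k \<alpha> (sandwich \<alpha> s (sandwich \<alpha> (Suc n) F))"
    using 3 lin_sandwich by blast+
  then show "sandwich \<alpha> s (row_sum (Suc n) (Suc k) \<alpha> F) = row_sum (Suc n) (Suc k) \<alpha> (sandwich \<alpha> s F)"
    unfolding row_sum.simps sandwich_add sandwich_commute[OF 3(4,3), of "Suc n" s] by simp
qed (auto simp: sandwich_zero)

lemma sandwich_sum_add:
  "sandwich_sum n \<alpha> (\<lambda>t. F t + G t) t = sandwich_sum n \<alpha> F t + sandwich_sum n \<alpha> G t"
  by (simp add: sandwich_sum_def sandwich_add sum.distrib)

text \<open>The identity e_1 e_k = (k + 1) e_{k+1} for elementary symmetric functions of square-zero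
  variables: every set of k + 1 variables arises k + 1 times and repetitions vanish.\<close>

lemma sandwich_sum_row_sum:
  assumes "parity \<alpha> = 0" "lin F"
  shows "sandwich_sum n \<alpha> (row_sum n k \<alpha> F) t = scl (of_nat (Suc k)) (row_sum n (Suc k) \<alpha> F t)"
  using assms(2)
proof (induction n arbitrary: k F t)
  case 0
  show ?case by (simp add: sandwich_sum_def)
next
  case (Suc n)
  let ?q = "sandwich \<alpha> (Suc n)"
  have IH: "sandwich_sum n \<alpha> (row_sum n k \<alpha> F) t = scl (of_nat (Suc k)) (row_sum n (Suc k) \<alpha> F t)"
    if "lin F" for k F t by (rule Suc.IH[OF that])
  have step: "sandwich_sum (Suc n) \<alpha> G t = sandwich_sum n \<alpha> G t + ?q G t" for G t
    by (simp add: sandwich_sum_def)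
  have lq: "lin (?q F)" by (rule lin_sandwich[OF Suc.prems])
  show "sandwich_sum (Suc n) \<alpha> (row_sum (Suc n) k \<alpha> F) t = scl (of_nat (Suc k)) (row_sum (Suc n) (Suc k) \<alpha> F t)"
  proof (cases k)
    case 0
    then show ?thesis using IH[OF Suc.prems, of 0 t] by (simp add: step)
  next
    case (Suc k')
    \<comment> \<open>Multiplication by the last variable extends the products without it and
      annihilates those that contain it.\<close>
    have "?q (row_sum n (Suc k') \<alpha> F) t = row_sum n (Suc k') \<alpha> (?q F) t"
      by (simp add: sandwich_row_sum[OF assms(1) \<open>lin F\<close>])
    moreover have "?q (row_sum n k' \<alpha> (?q F)) t = 0"
      by (simp add: sandwich_row_sum[OF assms(1) lq] sandwich_square[OF assms(1)] row_sum_zero)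
    ultimately have "sandwich_sum (Suc n) \<alpha> (row_sum (Suc n) k \<alpha> F) t =
      scl (of_nat (Suc (Suc k'))) (row_sum n (Suc (Suc k')) \<alpha> F t)
      + scl (of_nat (Suc k')) (row_sum n (Suc k') \<alpha> (?q F) t) + row_sum n (Suc k') \<alpha> (?q F) t"
      unfolding Suc row_sum.simps sandwich_sum_add step sandwich_add
      by (simp only: IH[OF \<open>lin F\<close>] IH[OF lq]) simp
    moreover have "scl (of_nat (Suc m)) y + y = scl (of_nat (Suc (Suc m))) y" for m y
      by (simp add: fun_eq_iff algebra_simps)
    ultimately show ?thesis unfolding Suc row_sum.simps
      by (simp only: add.assoc scl_distribs(3))
  qed
qed

definition invariant :: "nat \<Rightarrow> (tensor \<Rightarrow> tensor) \<Rightarrow> bool" where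
  "invariant n F \<longleftrightarrow> (\<forall>i\<in>{1..n}. \<forall>j\<in>{1..n}. \<forall>t.
     pol (Letter i) (Letter j) (F t) = F (pol (Letter i) (Letter j) t))"

text \<open>The bracket with e_{i,j} produces e_{i,\<alpha>} F e_{\<alpha>,j} with a plus sign at
  \<open>s = j\<close> and with a minus sign at \<open>s = i\<close>; both values occur in the full
  sum.\<close>

lemma invariant_sandwich_sum:
  assumes "parity \<alpha> = 0" "lin F" "invariant n F"
  shows "invariant n (sandwich_sum n \<alpha> F)"
  unfolding invariant_def
proof (intro ballI allI)
  fix i j t assume ij: "i \<in> {1..n}" "j \<in> {1..n}"
  let ?e = "pol (Letter i) (Letter j)"
  have ne: "\<alpha> \<noteq> Letter x" "Letter x \<noteq> \<alpha>" for x using assms(1) by auto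
  have "super_sign (Letter i) (Letter j) x y = 1" for x y by (simp add: super_sign_def)
  then have 1: "?e (pol (Letter s) \<alpha> y) = pol (Letter s) \<alpha> (?e y) + (if s = j then pol (Letter i) \<alpha> y else 0)"
    and 2: "?e (pol \<alpha> (Letter s) y) = pol \<alpha> (Letter s) (?e y) - (if s = i then pol \<alpha> (Letter j) y else 0)" for s y
    using ne by (auto simp: pol_pol[of "Letter i" "Letter j" "Letter s" \<alpha>] pol_pol[of "Letter i" "Letter j" \<alpha> "Letter s"])
  have F: "?e (F y) = F (?e y)" for y using assms(3) ij unfolding invariant_def by blast
  have "?e (sandwich \<alpha> s F t) = sandwich \<alpha> s F (?e t) +
     (if s = j then pol (Letter i) \<alpha> (F (pol \<alpha> (Letter j) t)) else 0)
     - (if s = i then pol (Letter i) \<alpha> (F (pol \<alpha> (Letter j) t)) else 0)" for s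
    by (simp add: sandwich_def 1 F 2 lin_diff[OF assms(2)] lin_0[OF assms(2)])
  then have "?e (sandwich_sum n \<alpha> F t) = (\<Sum>s=1..n. sandwich \<alpha> s F (?e t) +
     (if s = j then pol (Letter i) \<alpha> (F (pol \<alpha> (Letter j) t)) else 0)
     - (if s = i then pol (Letter i) \<alpha> (F (pol \<alpha> (Letter j) t)) else 0))"
    by (simp add: sandwich_sum_def)
  also have "\<dots> = sandwich_sum n \<alpha> F (?e t)"
    unfolding sum_subtractf sum.distrib sandwich_sum_def using ij by simp
  finally show "?e (sandwich_sum n \<alpha> F t) = sandwich_sum n \<alpha> F (?e t)" .
qed

text \<open>By \<open>sandwich_sum_row_sum\<close> each elementary symmetric function is, after
  division by \<open>Suc k\<close>, the invariant first one applied to its predecessor.\<close>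

lemma invariant_row_sum:
  assumes "parity \<alpha> = 0" "lin F" "invariant n F"
  shows "invariant n (row_sum n k \<alpha> F)"
proof (induction k)
  case 0
  then show ?case using assms by simp
next
  case (Suc k)
  have "invariant n (sandwich_sum n \<alpha> (row_sum n k \<alpha> F))"
    using assms Suc by (intro invariant_sandwich_sum lin_row_sum)
  then have I: "pol (Letter i) (Letter j) (scl (of_nat (Suc k)) (row_sum n (Suc k) \<alpha> F t)) =
      scl (of_nat (Suc k)) (row_sum n (Suc k) \<alpha> F (pol (Letter i) (Letter j) t))"
    if "i \<in> {1..n}" "j \<in> {1..n}" for i j t
    using that unfolding invariant_def sandwich_sum_row_sum[OF assms(1,2)] by blast
  show ?case unfolding invariant_def
  proof (intro ballI allI)
    fix i j t assume ij: "i \<in> {1..n}" "j \<in> {1..n}"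
    have "scl (1 / of_nat (Suc k)) (scl (of_nat (Suc k)) y) = y" for y
      by (simp del: of_nat_Suc)
    then show "pol (Letter i) (Letter j) (row_sum n (Suc k) \<alpha> F t) = row_sum n (Suc k) \<alpha> F (pol (Letter i) (Letter j) t)"
      using arg_cong[OF I[OF ij, of t], of "scl (1 / of_nat (Suc k))"] by (simp only: lin_scl[OF lin_pol])
  qed
qed

section \<open>Row strict tableaux as iterated elementary symmetric functions\<close>

definition strict_rows :: "nat \<Rightarrow> nat \<Rightarrow> nat list set" where
  "strict_rows n k = {r. length r = k \<and> set r \<subseteq> {1..n} \<and> sorted_wrt (<) r}"

lemma finite_strict_rows: "finite (strict_rows n k)"
  by (rule finite_subset[OF _ finite_lists_length_eq[of "{1..n}" k]]) (auto simp: strict_rows_def)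

lemma strict_rows_0: "strict_rows n 0 = {[]}" "strict_rows 0 (Suc k) = {}"
  by (auto simp: strict_rows_def)

text \<open>The largest letter can only stand at the end of a strict row. The two cases match the
  recursion of \<open>row_sum\<close>.\<close>

lemma strict_rows_Suc:
  "strict_rows (Suc n) (Suc k) = strict_rows n (Suc k) \<union> (\<lambda>r. r @ [Suc n]) ` strict_rows n k"
proof (intro equalityI subsetI)
  fix r assume r: "r \<in> strict_rows (Suc n) (Suc k)"
  then have "r \<noteq> []" by (auto simp: strict_rows_def)
  then obtain q x where q: "r = q @ [x]" by (metis append_butlast_last_id)
  have le: "\<forall>y\<in>set q. y < x" "x \<le> Suc n" using r q by (auto simp: strict_rows_def sorted_wrt_append)
  show "r \<in> strict_rows n (Suc k) \<union> (\<lambda>r. r @ [Suc n]) ` strict_rows n k"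
  proof (cases "x = Suc n")
    case True
    then have "q \<in> strict_rows n k" using r q le by (force simp: strict_rows_def sorted_wrt_append)
    then show ?thesis using q True by blast
  next
    case False
    then have "r \<in> strict_rows n (Suc k)" using r q le by (force simp: strict_rows_def)
    then show ?thesis by blast
  qed
next
  fix r assume "r \<in> strict_rows n (Suc k) \<union> (\<lambda>r. r @ [Suc n]) ` strict_rows n k"
  then show "r \<in> strict_rows (Suc n) (Suc k)" by (fastforce simp: strict_rows_def sorted_wrt_append)
qed

definition left_row :: "symbol \<Rightarrow> nat list \<Rightarrow> (symbol \<times> symbol) list" where
  "left_row \<alpha> r = map (\<lambda>s. (Letter s, \<alpha>)) r"

text \<open>Reversed, because nested sandwiches place their right-hand factors in mirror
  order.\<close>

definition right_row :: "symbol \<Rightarrow> nat list \<Rightarrow> (symbol \<times> symbol) list" where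
  "right_row \<alpha> r = rev (map (\<lambda>s. (\<alpha>, Letter s)) r)"

lemma row_sum_eq:
  "row_sum n k \<alpha> F t = (\<Sum>r\<in>strict_rows n k. wact (left_row \<alpha> r) (F (wact (right_row \<alpha> r) t)))"
proof (induction n k \<alpha> F arbitrary: t rule: row_sum.induct)
  case (3 n k \<alpha> F)
  have IH: "row_sum n (Suc k) \<alpha> F t = (\<Sum>r\<in>strict_rows n (Suc k). wact (left_row \<alpha> r) (F (wact (right_row \<alpha> r) t)))"
    "row_sum n k \<alpha> (sandwich \<alpha> (Suc n) F) t =
      (\<Sum>r\<in>strict_rows n k. wact (left_row \<alpha> r) (sandwich \<alpha> (Suc n) F (wact (right_row \<alpha> r) t)))"
    by (rule 3)+
  have "(\<Sum>r\<in>strict_rows (Suc n) (Suc k). wact (left_row \<alpha> r) (F (wact (right_row \<alpha> r) t))) =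
     (\<Sum>r\<in>strict_rows n (Suc k). wact (left_row \<alpha> r) (F (wact (right_row \<alpha> r) t))) +
     (\<Sum>r\<in>(\<lambda>r. r @ [Suc n]) ` strict_rows n k. wact (left_row \<alpha> r) (F (wact (right_row \<alpha> r) t)))"
    unfolding strict_rows_Suc
    by (intro sum.union_disjoint finite_strict_rows finite_imageI) (force simp: strict_rows_def)
  moreover have "(\<Sum>r\<in>(\<lambda>r. r @ [Suc n]) ` strict_rows n k. wact (left_row \<alpha> r) (F (wact (right_row \<alpha> r) t))) =
     (\<Sum>r\<in>strict_rows n k. wact (left_row \<alpha> r) (sandwich \<alpha> (Suc n) F (wact (right_row \<alpha> r) t)))"
    by (subst sum.reindex) (auto simp: inj_on_def left_row_def right_row_def wact_append sandwich_def)
  ultimately show "row_sum (Suc n) (Suc k) \<alpha> F t =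
    (\<Sum>r\<in>strict_rows (Suc n) (Suc k). wact (left_row \<alpha> r) (F (wact (right_row \<alpha> r) t)))"
    by (simp add: IH)
qed (auto simp: strict_rows_0 left_row_def right_row_def)

fun tableau_sum :: "nat \<Rightarrow> nat \<Rightarrow> nat list \<Rightarrow> (tensor \<Rightarrow> tensor) \<Rightarrow> tensor \<Rightarrow> tensor" where
  "tableau_sum n r [] F = F"
| "tableau_sum n r (k # ks) F = row_sum n k (Pos r) (tableau_sum n (Suc r) ks F)"

lemma invariant_tableau_sum:
  assumes "lin F" "invariant n F"
  shows "invariant n (tableau_sum n r ks F) \<and> lin (tableau_sum n r ks F)"
  using assms by (induction ks arbitrary: r) (auto intro!: invariant_row_sum lin_row_sum)

fun row_symbols :: "nat \<Rightarrow> nat list \<Rightarrow> symbol list" where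
  "row_symbols r [] = []"
| "row_symbols r (k # ks) = replicate k (Pos r) @ row_symbols (Suc r) ks"

lemma row_symbols_virtual_C: "concat (virtual_C ks) = row_symbols 1 ks"
proof -
  have "concat (map (\<lambda>i. replicate (ks ! i) (Pos (s + i))) [0..<length ks]) = row_symbols s ks" for s
  proof (induction ks arbitrary: s)
    case (Cons k ks)
    have "map (\<lambda>i. replicate ((k # ks) ! i) (Pos (s + i))) [0..<length (k # ks)] =
      replicate k (Pos s) # map (\<lambda>i. replicate (ks ! i) (Pos (Suc s + i))) [0..<length ks]"
      by (simp add: upt_conv_Cons map_Suc_upt[symmetric] del: upt_Suc)
    then show ?case using Cons[of "Suc s"] by simp
  qed simp
  from this[of 1] show ?thesis by (simp add: virtual_C_def)
qed

lemma row_strict_Cons: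
  "row_strict_tableaux n (k # ks) = (\<lambda>(r, S). r # S) ` (strict_rows n k \<times> row_strict_tableaux n ks)"
proof (intro equalityI subsetI)
  fix S assume S: "S \<in> row_strict_tableaux n (k # ks)"
  then obtain r S' where "S = r # S'" by (cases S) (auto simp: row_strict_tableaux_def)
  with S show "S \<in> (\<lambda>(r, S). r # S) ` (strict_rows n k \<times> row_strict_tableaux n ks)"
    by (intro image_eqI[of _ _ "(r, S')"]) (simp_all add: row_strict_tableaux_def strict_rows_def)
qed (clarsimp simp: row_strict_tableaux_def strict_rows_def)

lemma tableau_sum_eq:
  assumes "lin F"
  shows "tableau_sum n r ks F t = (\<Sum>S\<in>row_strict_tableaux n ks.
     wact (zip (map Letter (concat S)) (row_symbols r ks))
       (F (wact (rev (zip (row_symbols r ks) (map Letter (concat S)))) t)))"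
proof (induction ks arbitrary: r t)
  case Nil
  have "row_strict_tableaux n [] = {[]}" by (auto simp: row_strict_tableaux_def)
  then show ?case by simp
next
  case (Cons k ks)
  let ?T = "\<lambda>r ks S t. wact (zip (map Letter (concat S)) (row_symbols r ks))
       (F (wact (rev (zip (row_symbols r ks) (map Letter (concat S)))) t))"
  have IH: "tableau_sum n r ks F t = (\<Sum>S\<in>row_strict_tableaux n ks. ?T r ks S t)" for r t by (rule Cons)
  have z: "zip (map Letter q) (replicate (length q) x) = left_row x q"
    "rev (zip (replicate (length q) x) (map Letter q)) = right_row x q" for q x
    unfolding left_row_def right_row_def
    by (simp_all add: zip_replicate2 zip_replicate1)
  have e: "?T r (k # ks) (q # S) t = wact (left_row (Pos r) q) (?T (Suc r) ks S (wact (right_row (Pos r) q) t))"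
    if "q \<in> strict_rows n k" for q S t
  proof -
    have "length q = k" using that by (simp add: strict_rows_def)
    then show ?thesis using z[of q "Pos r"] by (simp add: wact_append)
  qed
  have inj: "inj_on (\<lambda>(r, S). r # S) X" for X by (auto simp: inj_on_def)
  have "(\<Sum>S\<in>row_strict_tableaux n (k # ks). ?T r (k # ks) S t) =
     (\<Sum>p\<in>strict_rows n k \<times> row_strict_tableaux n ks. ?T r (k # ks) (fst p # snd p) t)"
    unfolding row_strict_Cons by (subst sum.reindex[OF inj]) (simp add: comp_def case_prod_unfold)
  also have "\<dots> = (\<Sum>q\<in>strict_rows n k. \<Sum>S\<in>row_strict_tableaux n ks. ?T r (k # ks) (q # S) t)"
    by (simp add: sum.cartesian_product case_prod_unfold)
  also have "\<dots> = (\<Sum>q\<in>strict_rows n k. \<Sum>S\<in>row_strict_tableaux n ks.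
      wact (left_row (Pos r) q) (?T (Suc r) ks S (wact (right_row (Pos r) q) t)))"
    using e by (intro sum.cong refl) auto
  also have "\<dots> = (\<Sum>q\<in>strict_rows n k. wact (left_row (Pos r) q) (tableau_sum n (Suc r) ks F (wact (right_row (Pos r) q) t)))"
    unfolding IH lin_sum[OF lin_wact] ..
  also have "\<dots> = tableau_sum n r (k # ks) F t" by (simp add: row_sum_eq)
  finally show "tableau_sum n r (k # ks) F t = (\<Sum>S\<in>row_strict_tableaux n (k # ks). ?T r (k # ks) S t)" ..
qed

definition middle_word :: "nat list \<Rightarrow> (symbol \<times> symbol) list" where
  "middle_word l = (let c = concat (virtual_C l); d = concat (virtual_D l) in zip c d @ zip d c)"

lemma set_middle_word: "set (middle_word l) \<subseteq> {p. (\<forall>i. fst p \<noteq> Letter i) \<and> (\<forall>i. snd p \<noteq> Letter i)}"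
proof -
  have "x \<in> set (concat (virtual_C l)) \<Longrightarrow> x \<noteq> Letter i" "x \<in> set (concat (virtual_D l)) \<Longrightarrow> x \<noteq> Letter i" for x i
    by (auto simp: virtual_C_def virtual_D_def)
  then show ?thesis unfolding middle_word_def Let_def
    using set_zip_le[OF subset_refl subset_refl, of "concat (virtual_C l)" "concat (virtual_D l)"]
      set_zip_le[OF subset_refl subset_refl, of "concat (virtual_D l)" "concat (virtual_C l)"] by fastforce
qed

text \<open>The letters of the middle part involve virtual symbols only and so have no index in
  common with e_{i,j}.\<close>

lemma invariant_middle: "invariant n (wact (middle_word l))"
  unfolding invariant_def
proof (intro ballI allI)
  fix i j t
  have "fst (middle_word l ! p) \<noteq> Letter j \<and> snd (middle_word l ! p) \<noteq> Letter i" if "p < length (middle_word l)" for p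
    using set_middle_word[of l] nth_mem[OF that] by blast
  then show "pol (Letter i) (Letter j) (wact (middle_word l) t) = wact (middle_word l) (pol (Letter i) (Letter j) t)"
    by (subst pol_wact_even) (auto intro!: sum.neutral)
qed

lemma anti_capelli:
  assumes "set s \<subseteq> range Letter" "set c \<subseteq> range Pos" "set d \<subseteq> range Neg"
  shows "anti_word (zip c s)" "anti_word (zip d c)"
proof -
  show "anti_word (zip c s)"
    by (rule anti_wordI[OF set_zip_le[OF assms(2,1)]]) auto
  show "anti_word (zip d c)"
    by (rule anti_wordI[OF set_zip_le[OF assms(3,2)]]) auto
qed

lemma virtual_ranges: "set (concat (virtual_C l)) \<subseteq> range Pos" "set (concat (virtual_D l)) \<subseteq> range Neg"
  by (auto simp: virtual_C_def virtual_D_def)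

lemma length_tableau: "S \<in> row_strict_tableaux n l \<Longrightarrow> length (concat S) = sum_list l"
  by (auto simp: row_strict_tableaux_def length_concat)

text \<open>The Capelli word lists its last factor in row order, whereas nested sandwiches produce
  the opposite order. The sign of the reversal depends on the size only, so it is common to all
  tableaux.\<close>

lemma invariant_schur_op: "invariant n (schur_op n l)"
proof -
  let ?l = "conj_partition l"
  let ?F = "wact (middle_word ?l)"
  let ?c = "concat (virtual_C ?l)"
  let ?k = "sum_list ?l"
  have "schur_op n l t = scl (rev_sign ?k) (tableau_sum n 1 ?l ?F t)" for t
  proof -
    have "wact (capelli_word ?l S) t = scl (rev_sign ?k)
      (wact (zip (map Letter (concat S)) ?c) (?F (wact (rev (zip ?c (map Letter (concat S)))) t)))"
      if S: "S \<in> row_strict_tableaux n ?l" for S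
    proof -
      let ?z = "zip ?c (map Letter (concat S))"
      have "anti_word ?z" by (rule anti_capelli(1)[OF _ virtual_ranges]) auto
      moreover have "length ?z = ?k" using length_tableau[OF S] length_virtual_C[of ?l] by simp
      ultimately have "wact ?z t = scl (rev_sign ?k) (wact (rev ?z) t)"
        using wact_rev[of ?z t] rev_sign_square[of ?k] by simp
      then show ?thesis
        by (simp add: capelli_word_def Let_def middle_word_def wact_append)
    qed
    then show ?thesis
      unfolding tableau_sum_eq[OF lin_wact] row_symbols_virtual_C[symmetric] schur_op_def scl_sum
      by (intro sum.cong) auto
  qed
  then show ?thesis
    using invariant_tableau_sum[OF lin_wact invariant_middle[of n ?l], of 1 ?l]
    by (simp add: invariant_def)
qed

section \<open>Central elements act by scalars on highest weight vectors\<close>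

lemmas act_simps [simp] = lin_simps[OF lin_act]

definition HW :: "nat \<Rightarrow> (nat \<Rightarrow> nat) \<Rightarrow> nat \<Rightarrow> tensor set" where
  "HW n \<mu> k = {v \<in> Vec (proper_symbols n) k. hwt Letter n \<mu> v}"

definition lowering :: "nat \<Rightarrow> (symbol \<times> symbol) set" where
  "lowering n = {(Letter i, Letter j) | i j. 1 \<le> j \<and> j < i \<and> i \<le> n}"

text \<open>A single combination \<open>L\<close> of products of lowering operators has to serve all
  highest weight vectors of the given weight. This uniformity makes the scalar in
  \<open>central_scalar\<close> independent of the vector.\<close>

definition low_rep :: "nat \<Rightarrow> (nat \<Rightarrow> nat) \<Rightarrow> nat \<Rightarrow> (tensor \<Rightarrow> tensor) \<Rightarrow> bool" where
  "low_rep n \<mu> k F \<longleftrightarrow> (\<exists>L. Poly_Mapping.keys L \<subseteq> lists (lowering n) \<and> (\<forall>v\<in>HW n \<mu> k. F v = act L v))"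

lemma low_rep_add: "low_rep n \<mu> k F \<Longrightarrow> low_rep n \<mu> k G \<Longrightarrow> low_rep n \<mu> k (\<lambda>v. F v + G v)"
  unfolding low_rep_def
proof (elim exE conjE)
  fix L M assume "Poly_Mapping.keys L \<subseteq> lists (lowering n)" "\<forall>v\<in>HW n \<mu> k. F v = act L v"
    "Poly_Mapping.keys M \<subseteq> lists (lowering n)" "\<forall>v\<in>HW n \<mu> k. G v = act M v"
  then show "\<exists>K. Poly_Mapping.keys K \<subseteq> lists (lowering n) \<and> (\<forall>v\<in>HW n \<mu> k. F v + G v = act K v)"
    using Poly_Mapping.keys_add[of L M] by (intro exI[of _ "L + M"] conjI) (blast, simp add: act_add)
qed

lemma low_rep_scl: "low_rep n \<mu> k F \<Longrightarrow> low_rep n \<mu> k (\<lambda>v. scl c (F v))"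
  unfolding low_rep_def
proof (elim exE conjE)
  fix L assume "Poly_Mapping.keys L \<subseteq> lists (lowering n)" "\<forall>v\<in>HW n \<mu> k. F v = act L v"
  moreover have "Poly_Mapping.keys (free_scale c L) \<subseteq> Poly_Mapping.keys L"
    using keys_mult[of "Poly_Mapping.single [] c" L] by (auto simp: free_scale_eq plus_list_def split: if_splits)
  ultimately show "\<exists>K. Poly_Mapping.keys K \<subseteq> lists (lowering n) \<and> (\<forall>v\<in>HW n \<mu> k. scl c (F v) = act K v)"
    by (intro exI[of _ "free_scale c L"]) (auto simp: act_free_scale)
qed

lemma low_rep_word: "set w \<subseteq> lowering n \<Longrightarrow> low_rep n \<mu> k (wact w)"
  unfolding low_rep_def by (intro exI[of _ "mono w"]) auto

lemma low_rep_zero: "low_rep n \<mu> k (\<lambda>v. 0)"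
  unfolding low_rep_def by (intro exI[of _ 0]) auto

lemma low_rep_cong: "low_rep n \<mu> k F \<Longrightarrow> (\<And>v. v \<in> HW n \<mu> k \<Longrightarrow> G v = F v) \<Longrightarrow> low_rep n \<mu> k G"
  unfolding low_rep_def by auto

lemma low_rep_pol:
  assumes "(a, b) \<in> lowering n" "low_rep n \<mu> k F"
  shows "low_rep n \<mu> k (\<lambda>v. pol a b (F v))"
proof -
  obtain L where L: "Poly_Mapping.keys L \<subseteq> lists (lowering n)" "\<forall>v\<in>HW n \<mu> k. F v = act L v"
    using assms(2) unfolding low_rep_def by blast
  have "Poly_Mapping.keys (free_gen a b * L) \<subseteq> lists (lowering n)"
    using keys_mult[of "free_gen a b" L] L(1) assms(1) by (fastforce simp: free_gen_def plus_list_def)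
  then show ?thesis using L unfolding low_rep_def by (intro exI[of _ "free_gen a b * L"]) (simp add: act_mult)
qed

text \<open>Move e_{i,j} to the right through the lowering operators. Every bracket is again one
  generator in front of a shorter word; at the vector itself the generator kills, scales or
  lowers.\<close>

lemma low_rep_gen_word:
  assumes "set u \<subseteq> lowering n" "i \<in> {1..n}" "j \<in> {1..n}"
  shows "low_rep n \<mu> k (\<lambda>v. pol (Letter i) (Letter j) (wact u v))"
  using assms
proof (induction u arbitrary: i j)
  case Nil
  consider "i < j" | "i = j" | "i > j" by linarith
  then show ?case
  proof cases
    case 1
    have "pol (Letter i) (Letter j) v = 0" if "v \<in> HW n \<mu> k" for v
      using that 1 Nil unfolding HW_def hwt_def by simp
    then show ?thesis by (intro low_rep_cong[OF low_rep_zero]) simp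
  next
    case 2
    have "pol (Letter i) (Letter j) v = scl (of_nat (\<mu> i)) v" if "v \<in> HW n \<mu> k" for v
      unfolding 2[symmetric] using that Nil unfolding HW_def hwt_def by (intro diag_scl) simp
    then show ?thesis by (intro low_rep_cong[OF low_rep_scl[OF low_rep_word[of "[]"]], of _ _ _ "\<lambda>v. pol _ _ (wact [] v)" "of_nat (\<mu> i)"]) auto
  next
    case 3
    then have "low_rep n \<mu> k (wact [(Letter i, Letter j)])"
      by (intro low_rep_word) (use Nil in \<open>auto simp: lowering_def\<close>)
    then show ?thesis by (rule low_rep_cong) simp
  qed
next
  case (Cons p u)
  obtain c d where p: "p = (Letter c, Letter d)" "1 \<le> d" "d < c" "c \<le> n"
    using Cons.prems(1) by (auto simp: lowering_def)
  have IH: "low_rep n \<mu> k (\<lambda>v. pol (Letter i) (Letter j) (wact u v))" if "i \<in> {1..n}" "j \<in> {1..n}" for i j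
    using Cons.IH[OF _ that] Cons.prems(1) by simp
  have sgn: "super_sign (Letter i) (Letter j) (Letter c) (Letter d) = 1" by (simp add: super_sign_def)
  have "low_rep n \<mu> k (\<lambda>v. pol (Letter c) (Letter d) (pol (Letter i) (Letter j) (wact u v)) +
     (scl (if j = c then 1 else 0) (pol (Letter i) (Letter d) (wact u v)) +
      scl (if i = d then - 1 else 0) (pol (Letter c) (Letter j) (wact u v))))"
    using p Cons.prems by (intro low_rep_add low_rep_scl low_rep_pol IH) (auto simp: lowering_def)
  moreover have "pol (Letter i) (Letter j) (wact (p # u) v) =
     pol (Letter c) (Letter d) (pol (Letter i) (Letter j) (wact u v)) +
     (scl (if j = c then 1 else 0) (pol (Letter i) (Letter d) (wact u v)) +
      scl (if i = d then - 1 else 0) (pol (Letter c) (Letter j) (wact u v)))" for v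
    by (simp add: p pol_pol[of "Letter i" "Letter j" "Letter c" "Letter d"] sgn)
  ultimately show ?case by (rule low_rep_cong)
qed

lemma low_rep_gen:
  assumes "low_rep n \<mu> k F" "i \<in> {1..n}" "j \<in> {1..n}"
  shows "low_rep n \<mu> k (\<lambda>v. pol (Letter i) (Letter j) (F v))"
proof -
  obtain L where L: "Poly_Mapping.keys L \<subseteq> lists (lowering n)" "\<forall>v\<in>HW n \<mu> k. F v = act L v"
    using assms(1) unfolding low_rep_def by blast
  have "low_rep n \<mu> k (\<lambda>v. \<Sum>w\<in>W. scl (Poly_Mapping.lookup L w) (pol (Letter i) (Letter j) (wact w v)))"
    if "finite W" "W \<subseteq> Poly_Mapping.keys L" for W
    using that
  proof (induction W rule: finite_induct)
    case empty
    then show ?case using low_rep_zero by simp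
  next
    case (insert w W)
    then have "low_rep n \<mu> k (\<lambda>v. scl (Poly_Mapping.lookup L w) (pol (Letter i) (Letter j) (wact w v)))"
      using L(1) by (intro low_rep_scl low_rep_gen_word assms) auto
    moreover have "low_rep n \<mu> k (\<lambda>v. \<Sum>w\<in>W. scl (Poly_Mapping.lookup L w) (pol (Letter i) (Letter j) (wact w v)))"
      by (rule insert.IH) (use insert in auto)
    ultimately show ?case
      by (rule low_rep_cong[OF low_rep_add]) (rule sum.insert[OF insert.hyps])
  qed
  from this[OF finite_keys subset_refl] show ?thesis
    by (rule low_rep_cong) (simp add: L(2) act_def)
qed

lemma low_rep_act:
  assumes "f \<in> free_carrier (proper_symbols n)"
  shows "low_rep n \<mu> k (act f)"
proof -
  have w: "set w \<subseteq> proper_symbols n \<times> proper_symbols n \<Longrightarrow> low_rep n \<mu> k (wact w)" for w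
  proof (induction w)
    case Nil
    show ?case by (rule low_rep_word) simp
  next
    case (Cons p w)
    obtain i j where p: "p = (Letter i, Letter j)" "i \<in> {1..n}" "j \<in> {1..n}"
      using Cons.prems by (auto simp: proper_symbols_def)
    have "low_rep n \<mu> k (\<lambda>v. pol (Letter i) (Letter j) (wact w v))"
      using Cons by (intro low_rep_gen p) auto
    then show ?case by (rule low_rep_cong) (simp add: p)
  qed
  show ?thesis
  proof (rule free_alg_induct[of f "lists (proper_symbols n \<times> proper_symbols n)" "\<lambda>f. low_rep n \<mu> k (act f)"])
    show "Poly_Mapping.keys f \<subseteq> lists (proper_symbols n \<times> proper_symbols n)"
      using assms by (simp add: free_carrier_iff)
    show "low_rep n \<mu> k (act 0)" by (rule low_rep_cong[OF low_rep_zero]) simp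
    show "low_rep n \<mu> k (act (Poly_Mapping.single w c))" if "w \<in> lists (proper_symbols n \<times> proper_symbols n)" for w c
      using that by (intro low_rep_cong[OF low_rep_scl[OF w]]) auto
    show "low_rep n \<mu> k (act (f + g))" if "low_rep n \<mu> k (act f)" "low_rep n \<mu> k (act g)" for f g
      by (rule low_rep_cong[OF low_rep_add[OF that]]) (simp add: act_add)
  qed
qed

definition central_on :: "nat \<Rightarrow> nat \<Rightarrow> free_alg \<Rightarrow> bool" where
  "central_on n k f \<longleftrightarrow> (\<forall>i\<in>{1..n}. \<forall>j\<in>{1..n}. \<forall>t\<in>Vec (proper_symbols n) k.
     pol (Letter i) (Letter j) (act f t) = act f (pol (Letter i) (Letter j) t))"

lemma finite_proper: "finite (proper_symbols n)"
  by (simp add: proper_symbols_def)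

lemma proper_iff: "Letter i \<in> proper_symbols n \<longleftrightarrow> i \<in> {1..n}"
  by (auto simp: proper_symbols_def)

lemma act_proper_Vec: "f \<in> free_carrier (proper_symbols n) \<Longrightarrow> t \<in> Vec (proper_symbols n) k \<Longrightarrow>
   act f t \<in> Vec (proper_symbols n) k"
  by (auto simp: free_carrier_iff intro: act_Vec)

text \<open>Take for c the constant coefficient of \<open>L\<close>. The vector f v - c v is killed
  by raising operators, as f commutes with them, and is a combination of nonempty lowering words
  applied to v; by adjointness it is orthogonal to itself.\<close>

lemma central_scalar:
  assumes "f \<in> free_carrier (proper_symbols n)" "central_on n k f"
  shows "\<exists>c. \<forall>v\<in>HW n \<mu> k. act f v = scl c v"
proof -
  let ?P = "proper_symbols n"
  obtain L where L: "Poly_Mapping.keys L \<subseteq> lists (lowering n)" "\<And>v. v \<in> HW n \<mu> k \<Longrightarrow> act f v = act L v"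
    using low_rep_act[OF assms(1)] unfolding low_rep_def by blast
  let ?c = "Poly_Mapping.lookup L []"
  have "act f v = scl ?c v" if v: "v \<in> HW n \<mu> k" for v
  proof -
    let ?x = "act f v - scl ?c v"
    have vV: "v \<in> Vec ?P k" using v by (simp add: HW_def)
    have xV: "?x \<in> Vec ?P k" using act_proper_Vec[OF assms(1) vV] vV by auto
    have raise: "pol (Letter i) (Letter j) ?x = 0" if "1 \<le> i" "i < j" "j \<le> n" for i j
    proof -
      have "pol (Letter i) (Letter j) v = 0" using v that unfolding HW_def hwt_def by simp
      moreover have "pol (Letter i) (Letter j) (act f v) = act f (pol (Letter i) (Letter j) v)"
        using assms(2) that vV unfolding central_on_def by simp
      ultimately show ?thesis by (simp add: lin_0)
    qed
    have z: "ip ?P k (wact w v) ?x = 0" if wL: "w \<in> Poly_Mapping.keys L - {[]}" for w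
    proof -
      obtain p u where w: "w = p # u" using wL by (cases w) auto
      then have "p \<in> lowering n" using wL L(1) by auto
      then obtain i j where p: "p = (Letter i, Letter j)" "1 \<le> j" "j < i" "i \<le> n"
        by (auto simp: lowering_def)
      have "ip ?P k (wact w v) ?x = ip ?P k (wact u v) (pol (Letter j) (Letter i) ?x)"
        using p by (simp add: w ip_pol[OF finite_proper] proper_iff del: pol_simps ip_diff)
      then show ?thesis using raise[OF p(2-4)] by (simp del: pol_simps ip_diff)
    qed
    have "act L v = (\<Sum>w\<in>insert [] (Poly_Mapping.keys L - {[]}). scl (Poly_Mapping.lookup L w) (wact w v))"
      by (rule act_superset) auto
    also have "\<dots> = scl ?c (wact [] v) + (\<Sum>w\<in>Poly_Mapping.keys L - {[]}. scl (Poly_Mapping.lookup L w) (wact w v))"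
      by (rule sum.insert) auto
    finally have "act L v = scl ?c v + (\<Sum>w\<in>Poly_Mapping.keys L - {[]}. scl (Poly_Mapping.lookup L w) (wact w v))"
      by (simp only: wact.simps)
    then have x: "?x = (\<Sum>w\<in>Poly_Mapping.keys L - {[]}. scl (Poly_Mapping.lookup L w) (wact w v))"
      using L(2)[OF v] by simp
    have "ip ?P k (\<Sum>w\<in>Poly_Mapping.keys L - {[]}. scl (Poly_Mapping.lookup L w) (wact w v)) ?x = 0"
      unfolding ip_sum ip_scl using z by (intro sum.neutral) auto
    then have "ip ?P k ?x ?x = 0" by (simp only: x[symmetric])
    then have "?x = 0" by (rule ip_definite[OF finite_proper _ xV])
    then show ?thesis by simp
  qed
  then show ?thesis by blast
qed

text \<open>For the content \<nu> of a tableau this is the sum of its entries. Raising operators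
  decrease it strictly, and it also orders the weights of equal size.\<close>

definition letter_sum :: "nat \<Rightarrow> (nat \<Rightarrow> nat) \<Rightarrow> nat" where
  "letter_sum n \<nu> = (\<Sum>i=1..n. i * \<nu> i)"

definition weight_vector :: "nat \<Rightarrow> (nat \<Rightarrow> nat) \<Rightarrow> tensor \<Rightarrow> bool" where
  "weight_vector n \<nu> u \<longleftrightarrow> (\<forall>w. u w \<noteq> 0 \<longrightarrow> (\<forall>i\<in>{1..n}. count_list w (Letter i) = \<nu> i))"

lemma weight_vector_raise:
  assumes "weight_vector n \<nu> u" "1 \<le> i" "i < j" "j \<le> n" "pol (Letter i) (Letter j) u \<noteq> 0"
  shows "\<exists>\<nu>'. weight_vector n \<nu>' (pol (Letter i) (Letter j) u) \<and> letter_sum n \<nu>' < letter_sum n \<nu>"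
proof -
  define \<nu>' where "\<nu>' x = \<nu> x + (if x = i then 1 else 0) - (if x = j then 1 else 0)" for x
  have cnt: "int (count_list w (Letter x)) = int (\<nu> x) + (if x = i then 1 else 0) - (if x = j then 1 else 0)"
    if w: "pol (Letter i) (Letter j) u w \<noteq> 0" and x: "x \<in> {1..n}" for w x
  proof -
    obtain z where z: "u z \<noteq> 0" "\<And>x. int (count_list z x) =
      int (count_list w x) + (if Letter j = x then 1 else 0) - (if Letter i = x then 1 else 0)"
      using pol_count[OF w] by metis
    have "count_list z (Letter x) = \<nu> x" using assms(1) x z(1) unfolding weight_vector_def by blast
    then show ?thesis using z(2)[of "Letter x"] by (auto split: if_splits)
  qed
  obtain w where w: "pol (Letter i) (Letter j) u w \<noteq> 0" using assms(5) by (auto simp: fun_eq_iff)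
  have "j \<in> {1..n}" "i \<in> {1..n}" using assms by auto
  then have \<nu>j: "\<nu> j \<ge> 1" using cnt[OF w, of j] assms(3) by (auto split: if_splits)
  have 1: "weight_vector n \<nu>' (pol (Letter i) (Letter j) u)"
    unfolding weight_vector_def
  proof (intro allI impI ballI)
    fix w x assume "pol (Letter i) (Letter j) u w \<noteq> 0" "x \<in> {1..n}"
    from cnt[OF this] show "count_list w (Letter x) = \<nu>' x" using \<nu>j unfolding \<nu>'_def by (auto split: if_splits)
  qed
  have "letter_sum n \<nu>' + j = letter_sum n \<nu> + i"
  proof -
    have "letter_sum n \<nu>' + j = (\<Sum>x=1..n. x * \<nu>' x + (if x = j then x else 0))"
      using \<open>j \<in> {1..n}\<close> by (simp add: letter_sum_def sum.distrib)
    also have "\<dots> = (\<Sum>x=1..n. x * \<nu> x + (if x = i then x else 0))"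
      using \<nu>j assms(3) by (intro sum.cong refl) (auto simp: \<nu>'_def diff_mult_distrib2)
    also have "\<dots> = letter_sum n \<nu> + i" using \<open>i \<in> {1..n}\<close> by (simp add: letter_sum_def sum.distrib)
    finally show ?thesis .
  qed
  then show ?thesis using 1 assms(3) by (intro exI[of _ \<nu>']) auto
qed

text \<open>The range of a central element is a submodule, so if it is nonzero it contains a highest
  weight vector; the adjoint turns this into a contradiction.\<close>

lemma central_vanishes:
  assumes f: "f \<in> free_carrier (proper_symbols n)" "central_on n k f"
    and hw: "\<And>\<mu> v. v \<in> HW n \<mu> k \<Longrightarrow> act f v = 0"
    and t: "t \<in> Vec (proper_symbols n) k"
  shows "act f t = 0"
proof (rule ccontr)
  let ?P = "proper_symbols n"
  assume nz: "act f t \<noteq> 0"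
  let ?W = "{w. set w \<subseteq> ?P \<and> length w = k}"
  have finW: "finite ?W" by (rule finite_lists_length_eq[OF finite_proper])
  \<comment> \<open>Words are weight vectors, so some weight vector is not killed by
    \<open>f\<close>.\<close>
  have "t = (\<Sum>w\<in>?W. scl (t w) (basis_tensor w))"
  proof
    fix x
    have "(\<Sum>w\<in>?W. t w * basis_tensor w x) = (\<Sum>w\<in>?W. if w = x then t x else 0)"
      by (intro sum.cong) (auto simp: basis_tensor_def)
    also have "\<dots> = t x" using t finW by (auto simp: Vec_def)
    finally show "t x = (\<Sum>w\<in>?W. scl (t w) (basis_tensor w)) x" by (simp add: sum_tensor_apply)
  qed
  then have "act f t = (\<Sum>w\<in>?W. scl (t w) (act f (basis_tensor w)))"
    by (metis (no_types, lifting) lin_act lin_scl lin_sum sum.cong)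
  then obtain w where w: "w \<in> ?W" "act f (basis_tensor w) \<noteq> 0" using nz by (metis (no_types, lifting) scl_simps(3) sum.neutral)
  \<comment> \<open>Among these take \<open>u\<close> with least letter sum. Raising operators send
    it to weight vectors of smaller letter sum, on which \<open>f\<close> must vanish; hence
    \<open>act f u\<close> is a highest weight vector.\<close>
  let ?Q = "\<lambda>x. snd x \<in> Vec ?P k \<and> weight_vector n (fst x) (snd x) \<and> act f (snd x) \<noteq> 0"
  have "?Q ((\<lambda>i. count_list w (Letter i)), basis_tensor w)"
    using w basis_tensor_Vec[of w ?P] by (auto simp: weight_vector_def basis_tensor_def split: if_splits)
  then obtain x where x: "?Q x" "\<And>y. ?Q y \<Longrightarrow> letter_sum n (fst x) \<le> letter_sum n (fst y)"
    using ex_has_least_nat[of ?Q _ "\<lambda>x. letter_sum n (fst x)"] by blast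
  define \<nu> u where "\<nu> = fst x" and "u = snd x"
  have u: "u \<in> Vec ?P k" "weight_vector n \<nu> u" "act f u \<noteq> 0" using x(1) by (auto simp: \<nu>_def u_def)
  let ?v = "act f u"
  have com: "pol (Letter i) (Letter j) (act f s) = act f (pol (Letter i) (Letter j) s)"
    if "i \<in> {1..n}" "j \<in> {1..n}" "s \<in> Vec ?P k" for i j s
    using f(2) that unfolding central_on_def by blast
  have vV: "?v \<in> Vec ?P k" by (rule act_proper_Vec[OF f(1) u(1)])
  have v: "?v \<in> HW n \<nu> k"
    unfolding HW_def hwt_def
  proof (intro CollectI conjI allI impI vV)
    fix i j assume ij: "1 \<le> i \<and> i < j \<and> j \<le> n"
    let ?u = "pol (Letter i) (Letter j) u"
    have uV: "?u \<in> Vec ?P k" using u(1) ij by (intro pol_Vec) (auto simp: proper_iff)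
    have "act f ?u = 0"
    proof (rule ccontr)
      assume n0: "act f ?u \<noteq> 0"
      then have "?u \<noteq> 0" by (auto simp: lin_0)
      then obtain \<nu>' where \<nu>': "weight_vector n \<nu>' ?u" "letter_sum n \<nu>' < letter_sum n \<nu>"
        using weight_vector_raise[OF u(2)] ij by blast
      have "?Q (\<nu>', ?u)" using \<nu>' uV n0 by simp
      from x(2)[OF this] \<nu>'(2) show False by (simp add: \<nu>_def)
    qed
    then show "pol (Letter i) (Letter j) ?v = 0" using com[OF _ _ u(1), of i j] ij by simp
  next
    fix i w assume iw: "1 \<le> i \<and> i \<le> n \<and> ?v w \<noteq> 0"
    have "pol (Letter i) (Letter i) u = scl (of_nat (\<nu> i)) u"
      using u(2) iw unfolding weight_vector_def by (intro diag_scl) auto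
    then have "pol (Letter i) (Letter i) ?v = scl (of_nat (\<nu> i)) ?v"
      using com[OF _ _ u(1), of i i] iw by (simp add: lin_scl)
    from fun_cong[OF this, of w] show "count_list w (Letter i) = \<nu> i" using iw by (simp add: pol_diag)
  qed
  obtain g where g: "Poly_Mapping.keys g \<subseteq> lists (?P \<times> ?P)" "\<And>s t. ip ?P k (act f s) t = ip ?P k s (act g t)"
    using act_adjoint_exists[OF finite_proper, of f n] f(1) by (auto simp: free_carrier_iff)
  have gc: "g \<in> free_carrier ?P" using g(1) by (simp add: free_carrier_iff)
  \<comment> \<open>The adjoint is central as well: if \<open>?y\<close> is the failure of
    \<open>g\<close> to commute with e_{i,j}, moving everything to the other side and commuting
    \<open>f\<close> with e_{j,i} shows that \<open>?y\<close> is orthogonal to itself.\<close>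
  have "central_on n k g"
    unfolding central_on_def
  proof (intro ballI)
    fix i j s assume ij: "i \<in> {1..n}" "j \<in> {1..n}" and s: "s \<in> Vec ?P k"
    let ?e = "pol (Letter i) (Letter j)" and ?e' = "pol (Letter j) (Letter i)"
    let ?y = "?e (act g s) - act g (?e s)"
    have adj: "ip ?P k (?e' a) b = ip ?P k a (?e b)" for a b
      using ij by (intro ip_pol finite_proper) (auto simp: proper_iff)
    have "?e s \<in> Vec ?P k" "?e (act g s) \<in> Vec ?P k"
      using ij s act_proper_Vec[OF gc s] by (auto simp: proper_iff intro!: pol_Vec)
    then have yV: "?y \<in> Vec ?P k" using act_proper_Vec[OF gc] by blast
    have "ip ?P k ?y (?e (act g s)) = ip ?P k ?y (act g (?e s))"
      using com[OF ij(2,1) yV] by (simp only: adj[symmetric] g(2)[symmetric])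
    then have "ip ?P k ?y ?y = 0" by (simp only: ip_diff(2) diff_self)
    then have "?y = 0" by (rule ip_definite[OF finite_proper _ yV])
    then show "?e (act g s) = act g (?e s)" by simp
  qed
  then obtain c where c: "\<And>v. v \<in> HW n \<nu> k \<Longrightarrow> act g v = scl c v"
    using central_scalar[OF gc] by blast
  \<comment> \<open>As \<open>f\<close> kills \<open>?v\<close>, either c or the norm of
    \<open>?v\<close> vanishes. Since \<open>?v\<close> lies in the range of \<open>f\<close>, its
    squared norm also carries the factor \<open>cnj c\<close>, so it is zero in both cases.\<close>
  have "cnj c * ip ?P k ?v ?v = ip ?P k (act f ?v) ?v" using c[OF v] by (simp add: g(2))
  also have "\<dots> = 0" using hw[OF v] by simp
  finally have "c = 0 \<or> ip ?P k ?v ?v = 0" by simp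
  moreover have "ip ?P k ?v ?v = cnj c * ip ?P k u ?v" using c[OF v] by (simp add: g(2)[of u ?v])
  ultimately have "ip ?P k ?v ?v = 0" by auto
  then have "?v = 0" by (rule ip_definite[OF finite_proper _ vV])
  with u(3) show False by simp
qed

section \<open>Existence of highest weight vectors\<close>

definition prepend :: "symbol \<Rightarrow> tensor \<Rightarrow> tensor" where
  "prepend x t = (\<lambda>w. case w of [] \<Rightarrow> 0 | y # u \<Rightarrow> if y = x then t u else 0)"

lemma prepend_simps [simp]: "prepend x t [] = 0" "prepend x t (y # u) = (if y = x then t u else 0)"
  by (simp_all add: prepend_def)

lemma prepend_zero [simp]: "prepend x 0 = 0"
  by (auto simp: fun_eq_iff prepend_def split: list.splits)

lemma pol_prepend:
  assumes "parity a = parity b" "x \<noteq> b"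
  shows "pol a b (prepend x t) = prepend x (pol a b t)"
proof
  fix w
  have sgn: "(- 1 :: complex) ^ ((parity a + parity b) * parity y) = 1" for y
    using assms(1) by (simp flip: mult_2 add: power_mult)
  have "(\<lambda>u. if y = x then t u else 0) = (if y = x then t else 0)" for y by auto
  then show "pol a b (prepend x t) w = prepend x (pol a b t) w"
    using assms(2) by (cases w) (simp_all add: sgn)
qed

lemma pol_prepend_pow:
  assumes "parity a = parity b" "x \<noteq> b" "pol a b t = 0"
  shows "pol a b ((prepend x ^^ m) t) = 0"
  by (induction m) (simp_all add: assms(3) pol_prepend[OF assms(1,2)])

text \<open>No letter of \<open>W\<close> writes y, so a first letter y was there from the start. It
  contributes only Koszul signs, and none if it is even.\<close>

lemma wact_slice:
  assumes "y \<notin> fst ` set W"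
  shows "\<exists>e. (\<lambda>u. wact W F (y # u)) = scl e (wact W (\<lambda>u. F (y # u))) \<and> (parity y = 0 \<longrightarrow> e = 1)"
  using assms
proof (induction W)
  case Nil
  show ?case by (intro exI[of _ 1]) simp
next
  case (Cons p W)
  have "y \<notin> fst ` set W" using Cons.prems by auto
  then have "\<exists>e. (\<lambda>u. wact W F (y # u)) = scl e (wact W (\<lambda>u. F (y # u))) \<and> (parity y = 0 \<longrightarrow> e = 1)"
    by (rule Cons.IH)
  then obtain e where
    "(\<lambda>u. wact W F (y # u)) = scl e (wact W (\<lambda>u. F (y # u))) \<and> (parity y = 0 \<longrightarrow> e = 1)" by (rule exE)
  note e = conjunct1[OF this] conjunct2[OF this]
  let ?s = "(-1 :: complex) ^ ((parity (fst p) + parity (snd p)) * parity y)"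
  have "(\<lambda>u. wact (p # W) F (y # u)) = scl ?s (pol (fst p) (snd p) (\<lambda>u. wact W F (y # u)))"
    using Cons.prems by (auto simp: fun_eq_iff)
  also have "\<dots> = scl (?s * e) (wact (p # W) (\<lambda>u. F (y # u)))" unfolding e(1) by simp
  finally have "(\<lambda>u. wact (p # W) F (y # u)) = scl (?s * e) (wact (p # W) (\<lambda>u. F (y # u)))" .
  then show ?case using e(2) by (intro exI[of _ "?s * e"]) auto
qed

text \<open>At the word that starts with the letters of \<open>ss\<close>, each position can be
  filled by one operator only, so a single term remains. Its sign is + because the letters passed
  are copies of the even \<alpha>.\<close>

lemma wact_prepend:
  assumes "parity \<alpha> = 0" "distinct ss"
  shows "wact (map (\<lambda>i. (Letter i, \<alpha>)) ss) ((prepend \<alpha> ^^ length ss) v) (map Letter ss @ w) = v w"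
  using assms(2)
proof (induction ss)
  case (Cons s ss)
  let ?W = "map (\<lambda>i. (Letter i, \<alpha>)) ss" and ?t = "(prepend \<alpha> ^^ length ss) v"
  have ne: "\<alpha> \<noteq> Letter i" "Letter i \<noteq> \<alpha>" for i using assms(1) by auto
  have p1: "(\<lambda>u. prepend \<alpha> ?t (\<alpha> # u)) = ?t" by simp
  have p2: "(\<lambda>u. prepend \<alpha> ?t (Letter s # u)) = 0" using ne by (auto simp: fun_eq_iff)
  have "\<alpha> \<notin> fst ` set ?W" using ne by auto
  from wact_slice[OF this, of "prepend \<alpha> ?t", unfolded p1] assms(1)
  obtain e where "(\<lambda>u. wact ?W (prepend \<alpha> ?t) (\<alpha> # u)) = scl e (wact ?W ?t)" "e = 1" by blast
  then have 1: "wact ?W (prepend \<alpha> ?t) (\<alpha> # u) = wact ?W ?t u" for u by (metis scl_simps(2))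
  have "Letter s \<notin> fst ` set ?W" using Cons.prems by auto
  from wact_slice[OF this, of "prepend \<alpha> ?t"] have 2: "(\<lambda>u. wact ?W (prepend \<alpha> ?t) (Letter s # u)) = 0"
    unfolding p2 by auto
  have "wact (map (\<lambda>i. (Letter i, \<alpha>)) (s # ss)) ((prepend \<alpha> ^^ length (s # ss)) v) (map Letter (s # ss) @ w) =
     wact ?W (prepend \<alpha> ?t) (\<alpha> # map Letter ss @ w)"
    by (simp add: 2)
  also have "\<dots> = v w" unfolding 1 using Cons by simp
  finally show ?case .
qed simp

lemma prepend_pow_supp:
  "(prepend x ^^ m) t w \<noteq> 0 \<Longrightarrow> \<exists>u. w = replicate m x @ u \<and> t u \<noteq> 0"
proof (induction m arbitrary: w)
  case (Suc m)
  then show ?case by (cases w) (auto split: if_splits)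
qed simp

text \<open>Each column is added in front. The anticommuting operators e_{i,\<alpha>}, i = 1, ...,
  k, turn k copies of the even \<alpha> into an alternating tensor of 1, ..., k. A raising operator
  from j to i < j repeats one of them and yields zero.\<close>

lemma HW_exists:
  assumes "sorted_wrt (\<ge>) ks" "\<And>k. k \<in> set ks \<Longrightarrow> k \<le> n"
  shows "\<exists>v. v \<noteq> 0 \<and> v \<in> HW n (\<lambda>i. length (filter (\<lambda>k. i \<le> k) ks)) (sum_list ks)"
  using assms
proof (induction ks)
  case Nil
  have "basis_tensor [] \<noteq> 0" by (auto simp: basis_tensor_def fun_eq_iff)
  moreover have "pol a b (basis_tensor []) = 0" for a b
    by (rule pol_absent) (auto simp: basis_tensor_def split: if_splits)
  moreover have "basis_tensor [] \<in> Vec (proper_symbols n) 0" using basis_tensor_Vec[of "[]" "proper_symbols n"] by simp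
  ultimately show ?case
    by (intro exI[of _ "basis_tensor []"]) (auto simp: HW_def hwt_def basis_tensor_def split: if_splits)
next
  case (Cons k ks)
  let ?\<mu> = "\<lambda>ks i. length (filter (\<lambda>k. i \<le> k) ks)"
  let ?P = "proper_symbols n" and ?\<alpha> = "Pos 1"
  obtain v where v: "v \<noteq> 0" "v \<in> HW n (?\<mu> ks) (sum_list ks)" using Cons by auto
  let ?W = "map (\<lambda>i. (Letter i, ?\<alpha>)) [1..<Suc k]"
  let ?t = "(prepend ?\<alpha> ^^ k) v"
  let ?v = "wact ?W ?t"
  have kn: "k \<le> n" using Cons.prems by simp
  obtain w0 where w0: "v w0 \<noteq> 0" using v(1) by (auto simp: fun_eq_iff)
  have "?v (map Letter [1..<Suc k] @ w0) = v w0"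
    using wact_prepend[of ?\<alpha> "[1..<Suc k]" v w0] by (simp del: upt_Suc)
  then have nz: "?v \<noteq> 0" using w0 by (metis zero_fun_apply)
  have W: "map fst ?W = map Letter [1..<Suc k]" "map snd ?W = replicate k ?\<alpha>"
    by (simp_all add: comp_def map_replicate_const del: upt_Suc)
  have cl: "count_list (map Letter [Suc 0..<m]) (Letter i) = (if 1 \<le> i \<and> i < m then 1 else 0)" for m i
    by (induction m) auto
  have cr: "count_list (replicate m x) y = (if x = y then m else 0)" for m and x y :: symbol
    by (induction m) auto
  have cp: "count_list (map Letter ss) (Pos x) = 0" for ss x by (induction ss) auto
  have supp: "set w \<subseteq> ?P \<and> length w = k + sum_list ks \<and>
     (\<forall>i\<in>{1..n}. count_list w (Letter i) = ?\<mu> (k # ks) i)" if w: "?v w \<noteq> 0" for w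
  proof -
    obtain z where z: "?t z \<noteq> 0" "\<And>x. int (count_list w x) = int (count_list z x) +
       int (count_list (map fst ?W) x) - int (count_list (map snd ?W) x)"
      using wact_count[OF w] by metis
    obtain u where u: "z = replicate k ?\<alpha> @ u" "v u \<noteq> 0" using prepend_pow_supp[OF z(1)] by blast
    have uV: "set u \<subseteq> ?P" "length u = sum_list ks" using v(2) u(2) by (auto simp: HW_def Vec_def)
    have "?\<alpha> \<notin> set u" using uV(1) by (auto simp: proper_symbols_def)
    then have u0: "count_list u ?\<alpha> = 0" by (simp add: count_list_0_iff)
    have tV: "?t \<in> Vec (insert ?\<alpha> ?P) (k + sum_list ks)"
      unfolding Vec_def using prepend_pow_supp[of k ?\<alpha> v] v(2) by (fastforce simp: HW_def Vec_def)
    have "?v \<in> Vec (insert ?\<alpha> ?P) (k + sum_list ks)"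
      using kn by (intro wact_Vec tV) (auto simp: proper_symbols_def simp del: upt_Suc)
    then have wV: "set w \<subseteq> insert ?\<alpha> ?P" "length w = k + sum_list ks" using w by (auto simp: Vec_def)
    \<comment> \<open>The \<open>k\<close> operators consume all \<open>k\<close> copies of
      \<alpha>, so the result is a tensor over proper symbols.\<close>
    have "count_list w ?\<alpha> = 0" using z(2)[of ?\<alpha>] u u0 unfolding W by (simp add: cr cp del: upt_Suc)
    then have "?\<alpha> \<notin> set w" by (simp add: count_list_0_iff)
    moreover have "count_list w (Letter i) = ?\<mu> (k # ks) i" if i: "i \<in> {1..n}" for i
    proof -
      have "count_list u (Letter i) = ?\<mu> ks i" using v(2) u(2) i unfolding HW_def hwt_def by auto
      then show ?thesis using z(2)[of "Letter i"] i u unfolding W by (auto simp: cr cl simp del: upt_Suc)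
    qed
    ultimately show ?thesis using wV by auto
  qed
  have raise: "pol (Letter i) (Letter j) ?v = 0" if ij: "1 \<le> i" "i < j" "j \<le> n" for i j
  proof -
    have "pol (Letter i) (Letter j) v = 0" using v(2) ij by (auto simp: HW_def hwt_def)
    then have "pol (Letter i) (Letter j) ?t = 0" by (intro pol_prepend_pow) auto
    moreover have "wact (?W[p := (Letter i, snd (?W ! p))]) ?t = 0" if p: "p < length ?W" "fst (?W ! p) = Letter j" for p
    proof -
      let ?W' = "?W[p := (Letter i, snd (?W ! p))]"
      have jp: "j = Suc p" "p < k" using p by (auto simp del: upt_Suc)
      define q where "q = i - 1"
      have q: "q < length ?W" "?W ! q = (Letter i, ?\<alpha>)" "q \<noteq> p" using ij jp by (auto simp: q_def simp del: upt_Suc)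
      have "?W' ! p = ?W' ! q" "p < length ?W'" "q < length ?W'" using p q by (auto simp del: upt_Suc)
      then have "\<not> distinct ?W'" using q(3) nth_eq_iff_index_eq by blast
      moreover have "anti_word ?W'"
      proof (rule anti_wordI[of _ "range Letter" "{?\<alpha>}"])
        show "set ?W' \<subseteq> range Letter \<times> {?\<alpha>}"
          using set_update_subset_insert[of ?W p "(Letter i, snd (?W ! p))"] p by (auto simp del: upt_Suc)
      qed auto
      ultimately show ?thesis by (intro anti_word_repeat)
    qed
    moreover have "snd (?W ! p) \<noteq> Letter i" if "p < length ?W" for p
      using that by (simp del: upt_Suc)
    ultimately have s0: "(\<Sum>p<length ?W. (if fst (?W ! p) = Letter j then wact (?W[p := (Letter i, snd (?W ! p))]) ?t else 0)
       - (if snd (?W ! p) = Letter i then wact (?W[p := (fst (?W ! p), Letter j)]) ?t else 0)) = 0"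
      by (intro sum.neutral) (auto simp del: upt_Suc)
    show ?thesis
      using pol_wact_even[of "Letter i" "Letter j" ?W ?t] s0 \<open>pol (Letter i) (Letter j) ?t = 0\<close> by simp
  qed
  have "?v \<in> HW n (?\<mu> (k # ks)) (sum_list (k # ks))"
    unfolding HW_def hwt_def using supp raise by (auto simp: Vec_def simp del: upt_Suc filter.simps)
  with nz show ?case by blast
qed

section \<open>Partitions and highest weights\<close>

lemma down_closed_eq: "finite D \<Longrightarrow> (\<And>x y. x \<in> D \<Longrightarrow> y \<le> x \<Longrightarrow> y \<in> D) \<Longrightarrow> D = {..<card D}" for D :: "nat set"
proof -
  assume D: "finite D" "\<And>x y. x \<in> D \<Longrightarrow> y \<le> x \<Longrightarrow> y \<in> D"
  show ?thesis
  proof (cases "D = {}")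
    case False
    have "x \<in> D \<longleftrightarrow> x \<le> Max D" for x
      using D(2)[OF Max_in[OF D(1) False], of x] Max_ge[OF D(1), of x] by blast
    then have "D = {..Max D}" by auto
    then show ?thesis by (metis card_atMost lessThan_Suc_atMost)
  qed simp
qed

lemma partition_nth_mono:
  "is_partition l \<Longrightarrow> i \<le> j \<Longrightarrow> j < length l \<Longrightarrow> l ! j \<le> l ! i"
  unfolding is_partition_def using sorted_wrt_nth_less[of "(\<ge>)" l i j] by (cases "i = j") auto

lemma partition_pos: "is_partition l \<Longrightarrow> i < length l \<Longrightarrow> 0 < l ! i"
  unfolding is_partition_def by (metis gr0I nth_mem)

lemma first_part_ge: "is_partition l \<Longrightarrow> i < length l \<Longrightarrow> l ! i \<le> first_part l"
  using partition_nth_mono[of l 0 i] by (cases l) (auto simp: first_part_def)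

lemma length_conj [simp]: "length (conj_partition l) = first_part l"
  by (simp add: conj_partition_def)

lemma conj_nth: "j < first_part l \<Longrightarrow> conj_partition l ! j = length (filter (\<lambda>x. j < x) l)"
  by (simp add: conj_partition_def length_filter_conv_card)

text \<open>The rows longer than \<open>j\<close> form an initial segment, so their number
  determines them: this is the transposition of cells, counted from zero.\<close>

lemma conj_nth_ge:
  assumes "is_partition l" "j < first_part l"
  shows "i < conj_partition l ! j \<longleftrightarrow> i < length l \<and> j < l ! i"
proof -
  let ?D = "{i. i < length l \<and> j < l ! i}"
  have "?D = {..<card ?D}"
    using assms(1) by (intro down_closed_eq) (auto intro: less_le_trans partition_nth_mono)
  moreover have "conj_partition l ! j = card ?D" using assms(2) by (simp add: conj_partition_def)
  ultimately show ?thesis by auto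
qed

lemma sorted_conj: "sorted_wrt (\<ge>) (conj_partition l)"
  unfolding sorted_wrt_iff_nth_less
proof (intro allI impI)
  fix i j assume ij: "i < j" "j < length (conj_partition l)"
  have "length (filter (\<lambda>x. j < x) l) \<le> length (filter (\<lambda>x. i < x) l)"
    unfolding length_filter_conv_card using ij(1) by (intro card_mono) auto
  then show "conj_partition l ! j \<le> conj_partition l ! i" using ij by (simp add: conj_nth)
qed

lemma first_part_conj: "is_partition l \<Longrightarrow> first_part (conj_partition l) = length l"
proof (cases l)
  case (Cons x xs)
  assume p: "is_partition l"
  have "0 < first_part l" using partition_pos[OF p, of 0] Cons by (simp add: first_part_def)
  then have "conj_partition l \<noteq> []" "conj_partition l ! 0 = length (filter (\<lambda>x. 0 < x) l)"
    using conj_nth[of 0 l] by (auto simp flip: length_0_conv)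
  moreover have "filter (\<lambda>x. 0 < x) l = l" using p by (auto simp: is_partition_def intro!: filter_True gr0I)
  ultimately show ?thesis by (cases "conj_partition l") (auto simp: first_part_def)
qed (simp add: conj_partition_def first_part_def)

lemma conj_le: "k \<in> set (conj_partition l) \<Longrightarrow> k \<le> first_part (conj_partition l)"
  using sorted_conj[of l] by (cases "conj_partition l") (auto simp: first_part_def)

text \<open>Both sides count the cells, once by columns and once by rows.\<close>

lemma sum_list_conj: "is_partition l \<Longrightarrow> sum_list (conj_partition l) = sum_list l"
proof -
  assume p: "is_partition l"
  have "(\<forall>x\<in>set xs. x \<le> N) \<Longrightarrow> (\<Sum>j<N. length (filter (\<lambda>x. j < x) xs)) = sum_list xs" for xs and N :: nat
  proof (induction xs)
    case (Cons x xs)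
    have "(\<Sum>j<N. length (filter (\<lambda>y. j < y) (x # xs))) =
      (\<Sum>j<N. (if j < x then 1 else 0) + length (filter (\<lambda>y. j < y) xs))" by (intro sum.cong) auto
    also have "\<dots> = (\<Sum>j<N. if j < x then 1 else 0) + sum_list xs" using Cons by (simp add: sum.distrib)
    also have "(\<Sum>j<N. if j < x then 1 else 0 :: nat) = card {j. j < N \<and> j < x}"
      by (simp flip: sum.inter_filter add: lessThan_def)
    also have "{j. j < N \<and> j < x} = {..<x}" using Cons.prems by auto
    finally show ?case by simp
  qed simp
  moreover have "\<forall>x\<in>set l. x \<le> first_part l" using first_part_ge[OF p] by (auto simp: in_set_conv_nth)
  ultimately have "(\<Sum>j<first_part l. length (filter (\<lambda>x. j < x) l)) = sum_list l" by blast
  then show ?thesis by (simp add: sum_list_sum_nth atLeast0LessThan conj_nth)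
qed

text \<open>For a partition and \<open>i \<ge> 1\<close> this is the i-th part, read as zero past
  the end. It is expressed through the columns because highest weight vectors are both built and
  reflected column by column.\<close>

definition part_weight :: "nat list \<Rightarrow> nat \<Rightarrow> nat" where
  "part_weight l i = length (filter (\<lambda>k. i \<le> k) (conj_partition l))"

lemma part_weight_eq:
  assumes "is_partition l" "1 \<le> i"
  shows "part_weight l i = (if i \<le> length l then l ! (i - 1) else 0)"
proof -
  have "part_weight l i = card {j. j < first_part l \<and> i - 1 < conj_partition l ! j}"
    unfolding part_weight_def length_filter_conv_card using assms(2)
    by (intro arg_cong[of _ _ card]) auto
  also have "\<dots> = card {j. j < first_part l \<and> i - 1 < length l \<and> j < l ! (i - 1)}"
    using conj_nth_ge[OF assms(1)] by (intro arg_cong[of _ _ card]) auto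
  also have "\<dots> = (if i \<le> length l then l ! (i - 1) else 0)"
  proof (cases "i \<le> length l")
    case True
    then have i: "i - 1 < length l" using assms(2) by simp
    then have "{j. j < first_part l \<and> i - 1 < length l \<and> j < l ! (i - 1)} = {..<l ! (i - 1)}"
      using first_part_ge[OF assms(1) i] by auto
    then show ?thesis using True by simp
  next
    case False
    then have "{j. j < first_part l \<and> i - 1 < length l \<and> j < l ! (i - 1)} = {}" by auto
    then show ?thesis using False by simp
  qed
  finally show ?thesis .
qed

lemma schur_index_iff: "l \<in> schur_index n \<longleftrightarrow> is_partition l \<and> length l \<le> n"
  unfolding schur_index_def using first_part_conj by auto

lemma part_weight_inj:
  assumes "l \<in> schur_index n" "l' \<in> schur_index n" "\<And>i. 1 \<le> i \<Longrightarrow> i \<le> n \<Longrightarrow> part_weight l i = part_weight l' i"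
  shows "l = l'"
proof -
  have p: "is_partition l" "is_partition l'" "length l \<le> n" "length l' \<le> n" using assms by (auto simp: schur_index_iff)
  have e: "(if i < length l then l ! i else 0) = (if i < length l' then l' ! i else 0)" if "i < n" for i
    using assms(3)[of "Suc i"] that part_weight_eq[OF p(1), of "Suc i"] part_weight_eq[OF p(2), of "Suc i"]
    by (simp add: Suc_le_eq cong: if_cong)
  have "i < length l \<longleftrightarrow> i < length l'" for i
  proof (cases "i < n")
    case True
    then show ?thesis using e[OF True] partition_pos[OF p(1), of i] partition_pos[OF p(2), of i] by (auto split: if_splits)
  qed (use p in auto)
  then have "length l = length l'" by (metis linorder_neqE_nat nat_neq_iff)
  then show ?thesis
  proof (rule nth_equalityI)
    fix i assume "i < length l"
    then show "l ! i = l' ! i" using e[of i] p \<open>length l = length l'\<close> by simp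
  qed
qed

lemma sum_part_weight: "l \<in> schur_index n \<Longrightarrow> (\<Sum>i=1..n. part_weight l i) = sum_list l"
proof -
  assume l: "l \<in> schur_index n"
  then have p: "is_partition l" "length l \<le> n" by (auto simp: schur_index_iff)
  have "(\<Sum>i=1..n. part_weight l i) = (\<Sum>i<n. part_weight l (Suc i))"
    by (rule sum.reindex_bij_witness[of _ Suc "\<lambda>i. i - 1"]) auto
  also have "\<dots> = (\<Sum>i<n. if i < length l then l ! i else 0)"
    using p by (intro sum.cong) (auto simp: part_weight_eq Suc_le_eq)
  also have "\<dots> = (\<Sum>i<length l. l ! i)"
    using p(2) by (intro sum.mono_neutral_cong_right) auto
  finally show ?thesis by (simp add: sum_list_sum_nth atLeast0LessThan)
qed

section \<open>Triangularity\<close>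

lemma count_list_sums:
  "set xs \<subseteq> {1..n} \<Longrightarrow> (\<Sum>i=1..n. count_list xs i) = length xs"
  "set xs \<subseteq> {1..n} \<Longrightarrow> (\<Sum>i=1..n. i * count_list xs i) = sum_list xs"
proof (induction xs)
  case (Cons x xs)
  { case 1
    have "(\<Sum>i=1..n. count_list (x # xs) i) = (\<Sum>i=1..n. count_list xs i + (if i = x then 1 else 0))"
      by (intro sum.cong) auto
    then show ?case unfolding sum.distrib using Cons 1 by simp }
  { case 2
    have "(\<Sum>i=1..n. i * count_list (x # xs) i) = (\<Sum>i=1..n. i * count_list xs i + (if i = x then x else 0))"
      by (intro sum.cong) auto
    then show ?case unfolding sum.distrib using Cons 2 by simp }
qed auto

text \<open>An entry of a strict row of positive numbers is at least its position, counted from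
  one.\<close>

lemma strict_row_bound:
  assumes "sorted_wrt (<) r" "\<And>x. x \<in> set r \<Longrightarrow> 1 \<le> x"
  shows "sum_list [1..<Suc (length r)] \<le> sum_list r \<and> (sum_list r = sum_list [1..<Suc (length r)] \<longrightarrow> r = [1..<Suc (length r)])"
  using assms
proof (induction r rule: rev_induct)
  case (snoc x r)
  have IH: "sum_list [1..<Suc (length r)] \<le> sum_list r \<and> (sum_list r = sum_list [1..<Suc (length r)] \<longrightarrow> r = [1..<Suc (length r)])"
    using snoc by (simp add: sorted_wrt_append)
  have "set r \<subseteq> {1..<x}" using snoc.prems by (auto simp: sorted_wrt_append)
  then have "card (set r) \<le> x - 1" by (metis card_atLeastLessThan card_mono finite_atLeastLessThan)
  moreover have "distinct r" using snoc.prems by (auto simp: sorted_wrt_append strict_sorted_iff)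
  moreover have "1 \<le> x" using snoc.prems by simp
  ultimately have x: "Suc (length r) \<le> x" by (simp add: distinct_card)
  have e: "[1..<Suc (length (r @ [x]))] = [1..<Suc (length r)] @ [Suc (length r)]" by simp
  show ?case unfolding e using IH x by (auto simp del: upt_Suc)
qed simp

text \<open>Every cell carries the number of its column. This filling has the least letter sum among
  the row strict ones, and its content is the partition conjugate to \<open>ks\<close>.\<close>

definition standard_tableau :: "nat list \<Rightarrow> nat list list" where
  "standard_tableau ks = map (\<lambda>k. [1..<Suc k]) ks"

lemma standard_tableau_bound:
  assumes "S \<in> row_strict_tableaux n ks"
  shows "sum_list (concat (standard_tableau ks)) \<le> sum_list (concat S) \<and>
    (sum_list (concat S) = sum_list (concat (standard_tableau ks)) \<longrightarrow> S = standard_tableau ks)"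
  using assms
proof (induction ks arbitrary: S)
  case Nil
  then show ?case by (auto simp: row_strict_tableaux_def standard_tableau_def)
next
  case (Cons k ks)
  obtain r S' where S: "S = r # S'" "r \<in> strict_rows n k" "S' \<in> row_strict_tableaux n ks"
    using Cons.prems unfolding row_strict_Cons by auto
  have "sorted_wrt (<) r" "\<And>x. x \<in> set r \<Longrightarrow> 1 \<le> x" "length r = k" using S(2) by (auto simp: strict_rows_def)
  from strict_row_bound[OF this(1,2)] this(3) Cons.IH[OF S(3)] show ?case
    unfolding S(1) standard_tableau_def list.map concat.simps sum_list_append by auto
qed

lemma standard_tableau_row_strict: "(\<And>k. k \<in> set ks \<Longrightarrow> k \<le> n) \<Longrightarrow> standard_tableau ks \<in> row_strict_tableaux n ks"
  unfolding row_strict_tableaux_def standard_tableau_def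
  by (auto simp: comp_def less_Suc_eq_le simp del: upt_Suc) (meson le_trans)

lemma count_standard_tableau:
  "1 \<le> i \<Longrightarrow> count_list (concat (standard_tableau ks)) i = length (filter (\<lambda>k. i \<le> k) ks)"
proof (induction ks)
  case (Cons k ks)
  have "count_list [1..<m] i = (if 1 \<le> i \<and> i < m then 1 else 0)" for m by (induction m) auto
  then show ?case using Cons by (simp add: standard_tableau_def less_Suc_eq_le del: upt_Suc)
qed (simp add: standard_tableau_def)

lemma HW_sum:
  assumes "v \<in> HW n \<mu> k" "v \<noteq> 0"
  shows "(\<Sum>i=1..n. \<mu> i) = k"
proof -
  obtain w where w: "v w \<noteq> 0" using assms(2) by (auto simp: fun_eq_iff)
  then have s: "set w \<subseteq> proper_symbols n" "length w = k" using assms(1) by (auto simp: HW_def Vec_def)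
  then obtain xs where xs: "w = map Letter xs" "set xs \<subseteq> {1..n}"
  proof -
    assume h: "\<And>xs. w = map Letter xs \<Longrightarrow> set xs \<subseteq> {1..n} \<Longrightarrow> thesis"
    have "set w \<subseteq> Letter ` {1..n} \<Longrightarrow> \<exists>xs. w = map Letter xs \<and> set xs \<subseteq> {1..n}" for w
    proof (induction w)
      case (Cons a w)
      then obtain xs i where "w = map Letter xs" "set xs \<subseteq> {1..n}" "a = Letter i" "i \<in> {1..n}" by auto
      then show ?case by (intro exI[of _ "i # xs"]) auto
    qed simp
    then show thesis using h s(1) unfolding proper_symbols_def by blast
  qed
  have "count_list (map Letter xs) (Letter i) = count_list xs i" for i by (induction xs) auto
  moreover have "count_list w (Letter i) = \<mu> i" if "i \<in> {1..n}" for i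
    using assms(1) w that unfolding HW_def hwt_def by simp
  ultimately have "\<mu> i = count_list xs i" if "i \<in> {1..n}" for i
    using that xs(1) by simp
  then show ?thesis using count_list_sums(1)[OF xs(2)] s(2) xs(1) by simp
qed

text \<open>In a nonzero term the factor e_{C,S} consumes the letters of S, so the content of S is
  bounded by \<mu>. If the sizes agree, S has content \<mu>, and its letter sum is compared with
  that of the minimal filling.\<close>

lemma schur_op_triangular:
  assumes "l \<in> schur_index n" "v \<in> HW n \<mu> k" "schur_op n l v \<noteq> 0"
  shows "sum_list l < k \<or> (sum_list l = k \<and>
     (letter_sum n (part_weight l) < letter_sum n \<mu> \<or> (\<forall>i. 1 \<le> i \<and> i \<le> n \<longrightarrow> part_weight l i = \<mu> i)))"
proof -
  let ?ks = "conj_partition l"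
  let ?c = "concat (virtual_C ?ks)"
  have p: "is_partition l" using assms(1) by (simp add: schur_index_iff)
  obtain S where S: "S \<in> row_strict_tableaux n ?ks" "wact (capelli_word ?ks S) v \<noteq> 0"
    using assms(3) unfolding schur_op_def by (meson sum.not_neutral_contains_not_neutral)
  let ?s = "map Letter (concat S)"
  have len: "length ?s = sum_list ?ks" "length ?c = sum_list ?ks"
    using length_tableau[OF S(1)] by (simp_all add: length_virtual_C)
  have "wact (zip ?c ?s) v \<noteq> 0"
    using S(2) by (auto simp: capelli_word_def Let_def wact_append)
  then obtain w where w: "wact (zip ?c ?s) v w \<noteq> 0" by (auto simp: fun_eq_iff)
  obtain u where u: "v u \<noteq> 0" "\<And>x. int (count_list w x) = int (count_list u x) +
      int (count_list (map fst (zip ?c ?s)) x) - int (count_list (map snd (zip ?c ?s)) x)"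
    using wact_count[OF w] by blast
  have "v \<noteq> 0" using u(1) by auto
  then have k: "(\<Sum>i=1..n. \<mu> i) = k" using HW_sum[OF assms(2)] by simp
  have cm: "count_list (map Letter xs) (Letter i) = count_list xs i" for xs i by (induction xs) auto
  have c: "count_list (concat S) i \<le> \<mu> i" if i: "i \<in> {1..n}" for i
  proof -
    have "Letter i \<notin> set ?c" using virtual_ranges(1)[of ?ks] by auto
    then have "count_list ?c (Letter i) = 0" by (simp add: count_list_0_iff)
    moreover have "count_list u (Letter i) = \<mu> i" using assms(2) u(1) i unfolding HW_def hwt_def by auto
    ultimately show ?thesis using u(2)[of "Letter i"] len cm[of "concat S" i] by simp
  qed
  have sS: "set (concat S) \<subseteq> {1..n}" using S(1) by (auto simp: row_strict_tableaux_def)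
  have tot: "(\<Sum>i=1..n. count_list (concat S) i) = sum_list l"
    using count_list_sums(1)[OF sS] length_tableau[OF S(1)] sum_list_conj[OF p] by simp
  then have le: "sum_list l \<le> k" unfolding k[symmetric] using c by (metis (no_types, lifting) sum_mono)
  show ?thesis
  proof (cases "sum_list l = k")
    case False
    then show ?thesis using le by simp
  next
    case True
    \<comment> \<open>The content of \<open>S\<close> is bounded by \<mu> in every letter and has
      the same total.\<close>
    have ceq: "count_list (concat S) i = \<mu> i" if "i \<in> {1..n}" for i
    proof (rule ccontr)
      assume "count_list (concat S) i \<noteq> \<mu> i"
      then have "count_list (concat S) i < \<mu> i" using c[OF that] by simp
      then have "(\<Sum>i=1..n. count_list (concat S) i) < (\<Sum>i=1..n. \<mu> i)"
        using c that by (intro sum_strict_mono_ex1) auto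
      then show False using tot k True by simp
    qed
    then have L: "letter_sum n \<mu> = sum_list (concat S)"
      unfolding letter_sum_def using count_list_sums(2)[OF sS] by simp
    let ?T = "standard_tableau ?ks"
    have kn: "k \<le> n" if "k \<in> set ?ks" for k
      using conj_le[OF that] first_part_conj[OF p] assms(1) by (simp add: schur_index_iff)
    have T: "?T \<in> row_strict_tableaux n ?ks" by (rule standard_tableau_row_strict[OF kn])
    have sT: "set (concat ?T) \<subseteq> {1..n}" using T by (auto simp: row_strict_tableaux_def)
    have cT: "count_list (concat ?T) i = part_weight l i" if "i \<in> {1..n}" for i
      using count_standard_tableau[of i ?ks] that by (simp add: part_weight_def)
    then have "letter_sum n (part_weight l) = sum_list (concat ?T)"
      unfolding letter_sum_def using count_list_sums(2)[OF sT] by simp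
    with standard_tableau_bound[OF S(1)] L have "letter_sum n (part_weight l) < letter_sum n \<mu> \<or> S = ?T" by auto
    then show ?thesis using True ceq cT by auto
  qed
qed

text \<open>Rows are counted from zero and columns from one, to match \<open>Pos (Suc r)\<close> and
  \<open>Neg j\<close>. Listing the cells reduces the comparison of words to that of sets.\<close>

definition cell_list :: "nat list \<Rightarrow> (nat \<times> nat) list" where
  "cell_list ks = concat (map (\<lambda>r. map (Pair r) [1..<Suc (ks ! r)]) [0..<length ks])"

lemma set_cell_list: "set (cell_list ks) = {(r, j). r < length ks \<and> 1 \<le> j \<and> j \<le> ks ! r}"
  by (auto simp: cell_list_def less_Suc_eq_le simp del: upt_Suc)

lemma distinct_cell_list: "distinct (cell_list ks)"
proof -
  have "distinct (concat (map (\<lambda>r. map (Pair r) [1..<Suc (ks ! r)]) rs))" if "distinct rs" for rs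
    using that by (induction rs) (auto simp: distinct_map inj_on_def simp del: upt_Suc)
  then show ?thesis unfolding cell_list_def by simp
qed

lemma cell_list_C: "concat (virtual_C ks) = map (\<lambda>p. Pos (Suc (fst p))) (cell_list ks)"
  by (simp add: virtual_C_def cell_list_def map_concat comp_def map_replicate_const del: upt_Suc)

lemma cell_list_D: "concat (virtual_D ks) = map (\<lambda>p. Neg (snd p)) (cell_list ks)"
proof -
  have "virtual_D ks = map (\<lambda>r. map Neg [1..<Suc (ks ! r)]) [0..<length ks]"
    unfolding virtual_D_def by (rule nth_equalityI) auto
  then show ?thesis by (simp add: cell_list_def map_concat comp_def del: upt_Suc)
qed

lemma cell_list_T: "concat (standard_tableau ks) = map snd (cell_list ks)"
proof -
  have "standard_tableau ks = map (\<lambda>r. [1..<Suc (ks ! r)]) [0..<length ks]"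
    unfolding standard_tableau_def by (rule nth_equalityI) auto
  then show ?thesis by (simp add: cell_list_def map_concat comp_def del: upt_Suc)
qed

lemma zip_maps: "zip (map f xs) (map g xs) = map (\<lambda>x. (f x, g x)) xs"
  by (simp add: zip_map_map zip_same_conv_map)

lemma mset_standard_word:
  "mset (zip (concat (virtual_C ks)) (map Letter (concat (standard_tableau ks)))) =
   mset (reflection_word Pos Letter 1 ks)"
proof -
  let ?z = "map (\<lambda>p. (Pos (Suc (fst p)), Letter (snd p))) (cell_list ks)"
  have z: "zip (concat (virtual_C ks)) (map Letter (concat (standard_tableau ks))) = ?z"
    unfolding cell_list_C cell_list_T map_map zip_maps by (simp add: comp_def)
  have "distinct ?z" using distinct_cell_list[of ks] by (auto simp: distinct_map inj_on_def)
  moreover have "distinct (reflection_word Pos Letter 1 ks)" by (intro distinct_reflection_word) (auto simp: inj_def)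
  moreover have "set ?z = set (reflection_word Pos Letter 1 ks)"
    unfolding set_reflection_word set_map set_cell_list by force
  ultimately show ?thesis unfolding z using set_eq_iff_mset_eq_distinct by blast
qed

text \<open>The cell in row r and column j gives the letter \<open>(Neg j, Pos (Suc r))\<close>, in
  which column and row have changed places; so the reflections run over \<open>l\<close> itself and
  not over its conjugate.\<close>

lemma mset_conjugate_word:
  assumes "is_partition l"
  shows "mset (zip (concat (virtual_D (conj_partition l))) (concat (virtual_C (conj_partition l)))) =
   mset (reflection_word Neg Pos 1 l)"
proof -
  let ?ks = "conj_partition l"
  let ?z = "map (\<lambda>p. (Neg (snd p), Pos (Suc (fst p)))) (cell_list ?ks)"
  have z: "zip (concat (virtual_D ?ks)) (concat (virtual_C ?ks)) = ?z"
    unfolding cell_list_C cell_list_D zip_maps ..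
  have "distinct ?z" using distinct_cell_list[of ?ks] by (auto simp: distinct_map inj_on_def)
  moreover have "distinct (reflection_word Neg Pos 1 l)" by (intro distinct_reflection_word) (auto simp: inj_def)
  moreover have "set ?z = set (reflection_word Neg Pos 1 l)"
  proof (intro equalityI subsetI)
    fix x assume "x \<in> set ?z"
    then obtain r j where x: "x = (Neg j, Pos (Suc r))" "r < first_part l" "1 \<le> j" "j \<le> ?ks ! r"
      by (auto simp: set_cell_list)
    then have "j - 1 < length l" "r < l ! (j - 1)" using conj_nth_ge[OF assms x(2), of "j - 1"] by auto
    then show "x \<in> set (reflection_word Neg Pos 1 l)"
      unfolding set_reflection_word using x by (intro CollectI exI[of _ "j - 1"] exI[of _ "Suc r"]) auto
  next
    fix x assume "x \<in> set (reflection_word Neg Pos 1 l)"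
    then obtain q i where x: "x = (Neg (1 + q), Pos i)" "q < length l" "1 \<le> i" "i \<le> l ! q"
      unfolding set_reflection_word by blast
    have f: "i - 1 < first_part l" using x first_part_ge[OF assms x(2)] by linarith
    have "q < ?ks ! (i - 1)" using conj_nth_ge[OF assms f, of q] x by auto
    then show "x \<in> set ?z" using x f by (auto simp: set_cell_list intro!: image_eqI[of _ _ "(i - 1, Suc q)"])
  qed
  ultimately show ?thesis unfolding z using set_eq_iff_mset_eq_distinct by blast
qed

text \<open>Two rounds of reflections, from the letters to the \<alpha>'s and from these to the
  \<beta>'s. The words in row order consist of the same anticommuting letters as the reflection
  words, so they agree up to sign.\<close>

lemma standard_nonzero:
  assumes l: "l \<in> schur_index n" and v: "v \<in> HW n (part_weight l) k" "v \<noteq> 0"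
  shows "wact (zip (concat (virtual_D (conj_partition l))) (concat (virtual_C (conj_partition l))))
    (wact (zip (concat (virtual_C (conj_partition l))) (map Letter (concat (standard_tableau (conj_partition l))))) v) \<noteq> 0"
proof -
  let ?ks = "conj_partition l"
  let ?z1 = "zip (concat (virtual_C ?ks)) (map Letter (concat (standard_tableau ?ks)))"
  let ?z2 = "zip (concat (virtual_D ?ks)) (concat (virtual_C ?ks))"
  let ?u = "wact (reflection_word Pos Letter 1 ?ks) v"
  have p: "is_partition l" "length l \<le> n" using l by (auto simp: schur_index_iff)
  have kn: "k \<le> n" if "k \<in> set ?ks" for k using conj_le[OF that] first_part_conj[OF p(1)] p(2) by simp
  define B where "B = proper_symbols n \<union> Pos ` {1..length ?ks} \<union> Neg ` {1..length l}"
  have B: "finite B" by (simp add: B_def finite_proper)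
  have vV: "v \<in> Vec B k" using v(1) Vec_mono[of "proper_symbols n" B k] by (auto simp: HW_def B_def)
  have lack: "lacks (Pos j) v" "lacks (Neg j) v" for j
    using v(1) by (auto simp: lacks_def HW_def Vec_def proper_symbols_def)
  have u0: "?u \<noteq> 0"
  proof (rule reflection_word_nonzero[where N = n and B = B and k = k])
    show "hwt Letter n (\<lambda>i. length (filter (\<lambda>k. i \<le> k) ?ks)) v"
      using v(1) unfolding HW_def part_weight_def by simp
  qed (use v vV B lack kn sorted_conj in \<open>auto simp: inj_def B_def proper_symbols_def\<close>)
  have uV: "?u \<in> Vec B k"
    by (rule wact_Vec[OF vV]) (auto simp: set_reflection_word B_def)
  have hu: "hwt Pos (length ?ks) (\<lambda>r. ?ks ! (r - 1)) ?u"
    by (rule reflection_word_hwt) (use lack sorted_conj in \<open>auto simp: inj_def\<close>)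
  \<comment> \<open>The second round wants the weight described by its column lengths, and the
    columns of the conjugate shape are the rows of \<open>l\<close>.\<close>
  have hu': "hwt Pos (length ?ks) (\<lambda>i. length (filter (\<lambda>x. i \<le> x) l)) ?u"
  proof -
    have "?ks ! (r - 1) = length (filter (\<lambda>x. r \<le> x) l)" if "1 \<le> r" "r \<le> length ?ks" for r
    proof -
      have "(\<lambda>x. r - 1 < x) = (\<lambda>x. r \<le> x)" using that by (auto simp: fun_eq_iff)
      then show ?thesis using conj_nth[of "r - 1" l] that by simp
    qed
    then show ?thesis using hu unfolding hwt_def by auto
  qed
  have w0: "wact (reflection_word Neg Pos 1 l) ?u \<noteq> 0"
  proof (rule reflection_word_nonzero[where N = "length ?ks" and B = B and k = k])
    show "sorted_wrt (\<ge>) l" using p by (simp add: is_partition_def)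
    show "\<And>k. k \<in> set l \<Longrightarrow> k \<le> length ?ks" using first_part_ge[OF p(1)] by (auto simp: in_set_conv_nth)
    show "lacks (Neg j) ?u" for j by (rule lacks_wact[OF lack(2)]) (auto simp: set_reflection_word)
  qed (use u0 uV hu' B in \<open>auto simp: inj_def B_def\<close>)
  have a1: "anti_word ?z1" by (rule anti_capelli(1)[OF _ virtual_ranges]) auto
  have a2: "anti_word ?z2" by (rule anti_capelli(2)[OF _ virtual_ranges, of "[]"]) auto
  have "wact ?z1 v = ?u \<or> wact ?z1 v = - ?u" by (rule anti_word_perm[OF a1 mset_standard_word])
  moreover have "wact ?z2 ?u = wact (reflection_word Neg Pos 1 l) ?u \<or> wact ?z2 ?u = - wact (reflection_word Neg Pos 1 l) ?u"
    by (rule anti_word_perm[OF a2 mset_conjugate_word[OF p(1)]])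
  ultimately show ?thesis using w0 by auto
qed

lemma swap_zip: "map prod.swap (zip xs ys) = zip ys xs"
  by (induction xs ys rule: list_induct2') auto

text \<open>A finite alphabet for the form that contains every symbol of the Capelli words of this
  shape.\<close>

definition form_symbols :: "nat \<Rightarrow> nat list \<Rightarrow> symbol set" where
  "form_symbols n ks = proper_symbols n \<union> set (concat (virtual_C ks)) \<union> set (concat (virtual_D ks))"

lemma finite_form_symbols: "finite (form_symbols n ks)"
  by (simp add: form_symbols_def finite_proper)

text \<open>The adjoint of \<open>e\<^bsub>D,C\<^esub> e\<^bsub>C,S\<^esub>\<close> is \<open>e\<^bsub>S,C\<^esub> e\<^bsub>C,D\<^esub>\<close> with both factors
  read backwards; the two reversals contribute the same sign.\<close>

lemma ip_capelli_word:
  assumes S: "S \<in> row_strict_tableaux n ks"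
  defines "X \<equiv> wact (zip (concat (virtual_D ks)) (concat (virtual_C ks)) @ zip (concat (virtual_C ks)) (map Letter (concat S)))"
  shows "ip (form_symbols n ks) k (wact (capelli_word ks S) v) v = ip (form_symbols n ks) k (X v) (X v)"
proof -
  let ?B = "form_symbols n ks"
  define s c d where "s = map Letter (concat S)" "c = concat (virtual_C ks)" "d = concat (virtual_D ks)"
  note defs = this
  have len: "length s = sum_list ks" "length c = sum_list ks" "length d = sum_list ks"
    using length_tableau[OF S] length_virtual_C[of ks] length_virtual_D[of ks] by (simp_all add: defs)
  have "set (concat S) \<subseteq> {1..n}" using S by (auto simp: row_strict_tableaux_def)
  then have "set s \<subseteq> proper_symbols n" unfolding defs proper_symbols_def set_map by (rule image_mono)
  then have sB: "set s \<subseteq> ?B" "set c \<subseteq> ?B" "set d \<subseteq> ?B"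
    by (auto simp: defs form_symbols_def)
  have a: "anti_word (zip c s)" "anti_word (zip d c)"
  proof -
    show "anti_word (zip c s)" unfolding defs by (rule anti_capelli(1)[OF _ virtual_ranges]) auto
    show "anti_word (zip d c)" unfolding defs by (rule anti_capelli(2)[OF _ virtual_ranges, of "[]"]) auto
  qed
  let ?w = "zip s c @ zip c d"
  have "fst ` set ?w \<subseteq> ?B" "snd ` set ?w \<subseteq> ?B"
    using sB set_zip_le[of s ?B c ?B] set_zip_le[of c ?B d ?B] by auto
  then have "ip ?B k (wact ?w (X v)) v = ip ?B k (X v) (wact (rev (map prod.swap ?w)) v)"
    by (rule ip_wact[OF finite_form_symbols])
  also have "rev (map prod.swap ?w) = rev (zip d c) @ rev (zip c s)" by (simp add: swap_zip)
  also have "wact (rev (zip d c) @ rev (zip c s)) v = X v"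
  proof -
    have "wact (rev (zip d c) @ rev (zip c s)) v =
      scl (rev_sign (sum_list ks) * rev_sign (sum_list ks)) (wact (zip d c) (wact (zip c s) v))"
      using len by (simp add: wact_append wact_rev[OF a(1)] wact_rev[OF a(2)])
    then show ?thesis unfolding X_def by (simp add: rev_sign_square wact_append defs)
  qed
  also have "wact ?w (X v) = wact (capelli_word ks S) v"
    unfolding X_def by (simp add: capelli_word_def Let_def defs wact_append)
  finally show ?thesis .
qed

text \<open>By \<open>ip_capelli_word\<close> the value is a sum of squared norms, and the one
  belonging to \<open>standard_tableau\<close> is positive by
  \<open>standard_nonzero\<close>.\<close>

lemma schur_op_diagonal:
  assumes l: "l \<in> schur_index n" and v: "v \<in> HW n (part_weight l) k" "v \<noteq> 0"
  shows "ip (form_symbols n (conj_partition l)) k (schur_op n l v) v \<noteq> 0"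
proof -
  let ?ks = "conj_partition l"
  let ?B = "form_symbols n ?ks"
  let ?X = "\<lambda>S. wact (zip (concat (virtual_D ?ks)) (concat (virtual_C ?ks)) @ zip (concat (virtual_C ?ks)) (map Letter (concat S)))"
  let ?R = "row_strict_tableaux n ?ks"
  let ?T = "standard_tableau ?ks"
  have p: "is_partition l" "length l \<le> n" using l by (auto simp: schur_index_iff)
  have kn: "k \<le> n" if "k \<in> set ?ks" for k using conj_le[OF that] first_part_conj[OF p(1)] p(2) by simp
  have T: "?T \<in> ?R" by (rule standard_tableau_row_strict[OF kn])
  have e: "ip ?B k (schur_op n l v) v = (\<Sum>S\<in>?R. ip ?B k (?X S v) (?X S v))"
    unfolding schur_op_def ip_sum by (intro sum.cong refl ip_capelli_word)
  have "?X ?T v \<noteq> 0" using standard_nonzero[OF l v] by (simp add: wact_append)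
  moreover have "?X ?T v \<in> Vec ?B k"
  proof (rule wact_Vec)
    show "v \<in> Vec ?B k" using v(1) Vec_mono[of "proper_symbols n" ?B k] by (auto simp: HW_def form_symbols_def)
    show "fst ` set (zip (concat (virtual_D ?ks)) (concat (virtual_C ?ks)) @ zip (concat (virtual_C ?ks)) (map Letter (concat ?T))) \<subseteq> ?B"
      using set_zip_le[OF subset_refl subset_refl, of "concat (virtual_D ?ks)" "concat (virtual_C ?ks)"]
        set_zip_le[OF subset_refl subset_refl, of "concat (virtual_C ?ks)" "map Letter (concat ?T)"]
      unfolding form_symbols_def by fastforce
  qed
  ultimately have "ip ?B k (?X ?T v) (?X ?T v) \<noteq> 0"
    using ip_definite[OF finite_form_symbols] by blast
  then have "Re (ip ?B k (?X ?T v) (?X ?T v)) > 0"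
    using ip_pos[OF finite_form_symbols, of n ?ks k "?X ?T v"] by (metis less_eq_real_def of_real_0)
  then have "Re (\<Sum>S\<in>?R. ip ?B k (?X S v) (?X S v)) > 0"
    unfolding Re_sum using T ip_pos[OF finite_form_symbols] finite_row_strict_tableaux
    by (intro sum_pos2[of _ ?T]) auto
  then have "Re (ip ?B k (schur_op n l v) v) > 0" unfolding e .
  then show ?thesis by (metis less_irrefl zero_complex.sel(1))
qed

text \<open>The squared norm of e_{i+1,i} v equals that of v times the difference of the two weight
  entries, by adjointness and the bracket.\<close>

lemma HW_weight_decreasing:
  assumes v: "v \<in> HW n \<mu> k" "v \<noteq> 0" and i: "1 \<le> i" "i < n"
  shows "\<mu> (Suc i) \<le> \<mu> i"
proof -
  let ?P = "proper_symbols n"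
  let ?u = "pol (Letter (Suc i)) (Letter i) v"
  have L: "Letter i \<in> ?P" "Letter (Suc i) \<in> ?P" using i by (auto simp: proper_iff)
  have d: "pol (Letter j) (Letter j) v = scl (of_nat (\<mu> j)) v" if "1 \<le> j" "j \<le> n" for j
    using v(1) that unfolding HW_def hwt_def by (intro diag_scl) auto
  have z: "pol (Letter i) (Letter (Suc i)) v = 0" using v(1) i unfolding HW_def hwt_def by auto
  have sgn: "super_sign (Letter i) (Letter (Suc i)) (Letter (Suc i)) (Letter i) = 1" by (simp add: super_sign_def)
  have "pol (Letter i) (Letter (Suc i)) ?u = scl (of_nat (\<mu> i)) v - scl (of_nat (\<mu> (Suc i))) v"
    using d[of i] d[of "Suc i"] i by (simp add: pol_pol[of "Letter i" "Letter (Suc i)" "Letter (Suc i)" "Letter i"] sgn z)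
  then have "ip ?P k ?u ?u = (of_nat (\<mu> i) - of_nat (\<mu> (Suc i))) * ip ?P k v v"
    using ip_pol[OF finite_proper L, of k ?u v, symmetric] ip_pol[OF finite_proper L, of k ?u v]
    by (simp add: left_diff_distrib)
  then have "Re (ip ?P k ?u ?u) = (of_nat (\<mu> i) - of_nat (\<mu> (Suc i))) * Re (ip ?P k v v)"
    by simp
  moreover have "Re (ip ?P k ?u ?u) \<ge> 0" using ip_pos[OF finite_proper] by blast
  moreover have "Re (ip ?P k v v) > 0"
    using ip_pos[OF finite_proper, of n k v] ip_definite[OF finite_proper, of n k v] v
    by (metis (no_types, lifting) HW_def less_eq_real_def mem_Collect_eq of_real_0)
  ultimately have "of_nat (\<mu> i) - of_nat (\<mu> (Suc i)) \<ge> (0 :: real)"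
    by (simp add: zero_le_mult_iff)
  then show ?thesis by simp
qed

lemma filter_pos_decreasing:
  "sorted_wrt (\<ge>) xs \<Longrightarrow> i < length xs \<Longrightarrow>
     (if i < length (filter (\<lambda>x. 0 < x) xs) then filter (\<lambda>x. 0 < x) xs ! i else 0) = (xs ! i :: nat)"
proof (induction xs arbitrary: i)
  case (Cons x xs)
  show ?case
  proof (cases "x = 0")
    case True
    then have "\<forall>y\<in>set (x # xs). y = 0" using Cons.prems(1) by auto
    then have "filter (\<lambda>x. 0 < x) (x # xs) = []" "(x # xs) ! i = 0"
      using Cons.prems(2) by (auto simp: filter_empty_conv simp del: nth_Cons_Suc) (metis nth_mem set_ConsD length_Cons)
    then show ?thesis by simp
  next
    case False
    show ?thesis
    proof (cases i)
      case (Suc j)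
      then have "(if j < length (filter (\<lambda>x. 0 < x) xs) then filter (\<lambda>x. 0 < x) xs ! j else 0) = xs ! j"
        using Cons by simp
      then show ?thesis using Suc False by (simp split: if_splits)
    qed (use False in simp)
  qed
qed simp

text \<open>Every weight that occurs is indexed by \<open>schur_index\<close>, so a central element
  can be tested on one highest weight vector per partition.\<close>

lemma HW_partition:
  assumes v: "v \<in> HW n \<mu> k" "v \<noteq> 0"
  shows "\<exists>l\<in>schur_index n. sum_list l = k \<and> (\<forall>i. 1 \<le> i \<and> i \<le> n \<longrightarrow> part_weight l i = \<mu> i)"
proof -
  let ?xs = "map \<mu> [1..<Suc n]"
  define l where "l = filter (\<lambda>x. 0 < x) ?xs"
  have mono: "\<mu> j \<le> \<mu> i" if "i \<le> j" "1 \<le> i" "j \<le> n" for i j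
    using that(1,3)
  proof (induction j rule: dec_induct)
    case (step m)
    then show ?case using HW_weight_decreasing[OF v, of m] that(2) by simp
  qed simp
  have s: "sorted_wrt (\<ge>) ?xs"
    unfolding sorted_wrt_iff_nth_less using mono by (auto simp del: upt_Suc)
  have "sorted_wrt (\<ge>) l" unfolding l_def by (rule sorted_wrt_filter[OF s])
  then have p: "is_partition l" by (auto simp: is_partition_def l_def)
  have "length l \<le> n" unfolding l_def using length_filter_le[of _ ?xs] by (simp del: upt_Suc)
  then have li: "l \<in> schur_index n" using p by (simp add: schur_index_iff)
  have w: "part_weight l i = \<mu> i" if "1 \<le> i" "i \<le> n" for i
  proof -
    have "i - 1 < length ?xs" "?xs ! (i - 1) = \<mu> i" "i - 1 < length l \<longleftrightarrow> i \<le> length l"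
      using that by (auto simp del: upt_Suc)
    then show ?thesis
      using filter_pos_decreasing[OF s, of "i - 1", folded l_def] part_weight_eq[OF p that(1)] by simp
  qed
  then have "sum_list l = k" using sum_part_weight[OF li] HW_sum[OF v] by simp
  with li w show ?thesis by blast
qed

section \<open>The center\<close>

text \<open>It is enough to commute with the generators, and a commutator vanishes in U(gl(n))
  exactly if it acts by zero on proper tensors.\<close>

lemma central_iff:
  assumes "f \<in> free_carrier (proper_symbols n)"
  shows "cl (proper_symbols n) f \<in> gl_center n \<longleftrightarrow> (\<forall>k. central_on n k f)"
proof
  let ?P = "proper_symbols n"
  assume z: "cl ?P f \<in> gl_center n"
  show "\<forall>k. central_on n k f"
    unfolding central_on_def
  proof (intro allI ballI)
    fix k i j t assume ij: "i \<in> {1..n}" "j \<in> {1..n}" and t: "t \<in> Vec ?P k"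
    let ?e = "free_gen (Letter i) (Letter j)"
    have e: "?e \<in> free_carrier ?P" using ij by (auto simp: proper_iff)
    have "cl ?P f \<otimes>\<^bsub>Ugl n\<^esub> cl ?P ?e = cl ?P ?e \<otimes>\<^bsub>Ugl n\<^esub> cl ?P f"
      using z e unfolding gl_center_def by blast
    then have "f * ?e - ?e * f \<in> enveloping_ideal ?P" using assms e by (simp add: cl_mult cl_eq_iff)
    from enveloping_ideal_act[OF this, of t]
    show "pol (Letter i) (Letter j) (act f t) = act f (pol (Letter i) (Letter j) t)"
      by (simp add: act_diff act_mult)
  qed
next
  let ?P = "proper_symbols n"
  assume c: "\<forall>k. central_on n k f"
  have w: "act f (wact w t) = wact w (act f t)" if "set w \<subseteq> ?P \<times> ?P" "t \<in> Vec ?P k" for w t k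
    using that(1)
  proof (induction w)
    case (Cons p w)
    obtain i j where p: "p = (Letter i, Letter j)" "i \<in> {1..n}" "j \<in> {1..n}"
      using Cons.prems by (auto simp: proper_symbols_def)
    have "fst ` set w \<subseteq> ?P" using Cons.prems by auto
    then have "wact w t \<in> Vec ?P k" using that(2) by (rule wact_Vec[rotated])
    then have "act f (wact (p # w) t) = pol (Letter i) (Letter j) (act f (wact w t))"
      using c p unfolding central_on_def by simp
    moreover have "act f (wact w t) = wact w (act f t)" using Cons by simp
    ultimately show "act f (wact (p # w) t) = wact (p # w) (act f t)" by (simp add: p)
  qed simp
  have "cl ?P f \<otimes>\<^bsub>Ugl n\<^esub> x = x \<otimes>\<^bsub>Ugl n\<^esub> cl ?P f" if x: "x \<in> carrier (Ugl n)" for x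
  proof -
    obtain h where h: "h \<in> free_carrier ?P" "x = cl ?P h" using x by (auto simp: carrier_enveloping)
    have "f * h - h * f \<in> enveloping_ideal ?P"
    proof (subst proper_ideal_iff)
      show "f * h - h * f \<in> free_carrier ?P" using h assms by auto
      show "\<forall>k. \<forall>t\<in>Vec ?P k. act (f * h - h * f) t = 0"
      proof (intro allI ballI)
        fix k t assume t: "t \<in> Vec ?P k"
        have "act f (act h t) = (\<Sum>w\<in>Poly_Mapping.keys h. scl (Poly_Mapping.lookup h w) (act f (wact w t)))"
          by (simp add: act_def[of h])
        also have "\<dots> = (\<Sum>w\<in>Poly_Mapping.keys h. scl (Poly_Mapping.lookup h w) (wact w (act f t)))"
          using h(1) t by (intro sum.cong refl) (subst w, auto simp: free_carrier_iff)
        also have "\<dots> = act h (act f t)" by (simp add: act_def[of h])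
        finally show "act (f * h - h * f) t = 0" by (simp add: act_diff act_mult)
      qed
    qed
    then show ?thesis using h assms by (simp add: cl_mult cl_eq_iff)
  qed
  then show "cl ?P f \<in> gl_center n" using assms unfolding gl_center_def by auto
qed

lemma central_on_schur:
  assumes "g \<in> free_carrier (proper_symbols n)"
    "\<And>t. t \<in> Vec (proper_symbols n) k \<Longrightarrow> act g t = scl c (schur_op n l t)"
  shows "central_on n k g"
  unfolding central_on_def
proof (intro ballI)
  fix i j t assume ij: "i \<in> {1..n}" "j \<in> {1..n}" and t: "t \<in> Vec (proper_symbols n) k"
  have "pol (Letter i) (Letter j) t \<in> Vec (proper_symbols n) k"
    using t ij by (intro pol_Vec) (auto simp: proper_iff)
  moreover have "pol (Letter i) (Letter j) (schur_op n l t) = schur_op n l (pol (Letter i) (Letter j) t)"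
    using invariant_schur_op[of n l] ij unfolding invariant_def by blast
  ultimately show "pol (Letter i) (Letter j) (act g t) = act g (pol (Letter i) (Letter j) t)"
    using assms(2) t by simp
qed

text \<open>Every hook contains its own corner cell.\<close>

lemma hook_product_pos: "hook_product l \<noteq> 0"
proof -
  have fin: "finite (cells l)"
    by (rule finite_subset[of _ "SIGMA i:{..<length l}. {..<l ! i}"]) (auto simp: cells_def)
  have "card (hook l i j) \<noteq> 0" if "(i, j) \<in> cells l" for i j
  proof -
    have "(i, j) \<in> hook l i j" using that by (simp add: hook_def)
    moreover have "finite (hook l i j)" by (rule finite_subset[OF _ fin]) (auto simp: hook_def)
    ultimately show ?thesis by auto
  qed
  then show ?thesis unfolding hook_product_def using fin by (auto simp: prod_zero_iff)
qed

section \<open>Bases of subspaces of the enveloping algebra\<close>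

lemma vectorspace_sub:
  assumes W: "W \<subseteq> carrier (enveloping A)"
    and add: "\<And>f g. f \<in> free_carrier A \<Longrightarrow> g \<in> free_carrier A \<Longrightarrow> cl A f \<in> W \<Longrightarrow> cl A g \<in> W \<Longrightarrow> cl A (f + g) \<in> W"
    and scale: "\<And>c f. f \<in> free_carrier A \<Longrightarrow> cl A f \<in> W \<Longrightarrow> cl A (free_scale c f) \<in> W"
    and zero: "cl A 0 \<in> W"
  shows "vectorspace class_ring ((enveloping A)\<lparr>carrier := W\<rparr>)"
proof -
  let ?V = "(enveloping A)\<lparr>carrier := W\<rparr>"
  have rep: "\<exists>f. f \<in> free_carrier A \<and> cl A f \<in> W \<and> x = cl A f" if "x \<in> W" for x
    using that W carrier_enveloping[of A] by auto
  have "abelian_group ?V"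
  proof (rule abelian_groupI; simp)
    fix x y assume "x \<in> W" "y \<in> W"
    then show "x \<oplus>\<^bsub>enveloping A\<^esub> y \<in> W" using add rep by (metis cl_add)
    show "x \<oplus>\<^bsub>enveloping A\<^esub> y = y \<oplus>\<^bsub>enveloping A\<^esub> x"
      using rep[OF \<open>x \<in> W\<close>] rep[OF \<open>y \<in> W\<close>] by (auto simp: cl_add add.commute)
    fix z assume "z \<in> W"
    show "x \<oplus>\<^bsub>enveloping A\<^esub> y \<oplus>\<^bsub>enveloping A\<^esub> z = x \<oplus>\<^bsub>enveloping A\<^esub> (y \<oplus>\<^bsub>enveloping A\<^esub> z)"
      using rep[OF \<open>x \<in> W\<close>] rep[OF \<open>y \<in> W\<close>] rep[OF \<open>z \<in> W\<close>] by (auto simp: cl_add add.assoc)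
  next
    show "\<zero>\<^bsub>enveloping A\<^esub> \<in> W" using zero by (simp add: cl_zero)
  next
    fix x assume "x \<in> W"
    then obtain f where f: "f \<in> free_carrier A" "cl A f \<in> W" "x = cl A f" using rep by blast
    then show "\<zero>\<^bsub>enveloping A\<^esub> \<oplus>\<^bsub>enveloping A\<^esub> x = x" by (simp add: cl_add cl_zero)
    have "free_scale (- 1) f + f = 0"
      using free_scale_simps(2)[of "- 1" 1 f] free_scale_simps(4)[of f] by (simp add: free_scale_eq)
    then show "\<exists>y\<in>W. y \<oplus>\<^bsub>enveloping A\<^esub> x = \<zero>\<^bsub>enveloping A\<^esub>"
      using scale[OF f(1,2), of "- 1"] f(3) by (intro bexI[of _ "cl A (free_scale (- 1) f)"]) (simp_all add: cl_add cl_zero)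
  qed
  moreover have "cring (class_ring :: complex ring)" by (rule class_cring.cring_axioms)
  ultimately have "module class_ring ?V"
  proof (intro moduleI)
    fix a b :: complex and x y assume "x \<in> carrier ?V" "y \<in> carrier ?V"
    then obtain f h where f: "f \<in> free_carrier A" "cl A f \<in> W" "x = cl A f"
      and h: "h \<in> free_carrier A" "cl A h \<in> W" "y = cl A h"
      using rep[of x] rep[of y] by auto
    show "a \<odot>\<^bsub>?V\<^esub> x \<in> carrier ?V" using f scale by (simp add: cl_smult)
    show "(a \<oplus>\<^bsub>class_ring\<^esub> b) \<odot>\<^bsub>?V\<^esub> x = a \<odot>\<^bsub>?V\<^esub> x \<oplus>\<^bsub>?V\<^esub> b \<odot>\<^bsub>?V\<^esub> x"
      using f by (simp add: cl_smult cl_add class_ring_simps free_scale_simps)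
    show "a \<odot>\<^bsub>?V\<^esub> (x \<oplus>\<^bsub>?V\<^esub> y) = a \<odot>\<^bsub>?V\<^esub> x \<oplus>\<^bsub>?V\<^esub> a \<odot>\<^bsub>?V\<^esub> y"
      using f h by (simp add: cl_smult cl_add free_scale_simps)
    show "(a \<otimes>\<^bsub>class_ring\<^esub> b) \<odot>\<^bsub>?V\<^esub> x = a \<odot>\<^bsub>?V\<^esub> (b \<odot>\<^bsub>?V\<^esub> x)"
      using f by (simp add: cl_smult class_ring_simps free_scale_simps)
    show "\<one>\<^bsub>class_ring\<^esub> \<odot>\<^bsub>?V\<^esub> x = x"
      using f by (simp add: cl_smult class_ring_simps free_scale_simps)
  qed
  then show ?thesis
    unfolding vectorspace_def using class_field by blast
qed

lemma lincomb_cl: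
  assumes "vectorspace class_ring ((enveloping A)\<lparr>carrier := W\<rparr>)"
    and "finite J" "inj_on (\<lambda>l. cl A (g l)) J" "\<And>l. l \<in> J \<Longrightarrow> cl A (g l) \<in> W"
  shows "LinearCombinations.module.lincomb ((enveloping A)\<lparr>carrier := W\<rparr>) a ((\<lambda>l. cl A (g l)) ` J) =
    cl A (\<Sum>l\<in>J. free_scale (a (cl A (g l))) (g l))"
proof -
  let ?V = "(enveloping A)\<lparr>carrier := W\<rparr>"
  interpret vectorspace class_ring ?V by (rule assms(1))
  show ?thesis using assms(2-4)
  proof (induction J rule: finite_induct)
    case empty
    show ?case by (simp add: lincomb_def cl_zero)
  next
    case (insert x F)
    let ?s = "\<lambda>l. cl A (g l)"
    have n: "?s x \<notin> ?s ` F" using insert.prems(1) insert.hyps(2) by (auto simp: inj_on_def)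
    have c: "a v \<odot>\<^bsub>?V\<^esub> v \<in> carrier ?V" if "v \<in> ?s ` insert x F" for v
      using that insert.prems(2) by (intro smult_closed) (auto simp: class_ring_simps)
    have IH: "lincomb a (?s ` F) = cl A (\<Sum>l\<in>F. free_scale (a (?s l)) (g l))"
      using insert by (intro insert.IH) (auto simp: inj_on_def)
    have "lincomb a (insert (?s x) (?s ` F)) = a (?s x) \<odot>\<^bsub>?V\<^esub> ?s x \<oplus>\<^bsub>?V\<^esub> lincomb a (?s ` F)"
      unfolding lincomb_def using insert.hyps(1) n c by (intro finsum_insert) auto
    also have "\<dots> = cl A (free_scale (a (?s x)) (g x) + (\<Sum>l\<in>F. free_scale (a (?s l)) (g l)))"
      unfolding IH by (simp add: cl_smult cl_add)
    finally show ?case using insert.hyps by simp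
  qed
qed

text \<open>Translates the basis property into statements about representatives in the free algebra.
  Independence, applied to two indices with coefficients 1 and -1, also yields injectivity of the
  family.\<close>

lemma basis_ofI:
  assumes vs: "vectorspace class_ring ((enveloping A)\<lparr>carrier := W\<rparr>)"
    and s: "\<And>l. l \<in> I \<Longrightarrow> s l = cl A (g l)" "\<And>l. l \<in> I \<Longrightarrow> cl A (g l) \<in> W"
    and ind: "\<And>J c. finite J \<Longrightarrow> J \<subseteq> I \<Longrightarrow> (\<Sum>l\<in>J. free_scale (c l) (g l)) \<in> enveloping_ideal A \<Longrightarrow> \<forall>l\<in>J. c l = 0"
    and span: "\<And>z. z \<in> W \<Longrightarrow> \<exists>J c. finite J \<and> J \<subseteq> I \<and> z = cl A (\<Sum>l\<in>J. free_scale (c l) (g l))"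
  shows "basis_of (enveloping A) W I s"
proof -
  let ?V = "(enveloping A)\<lparr>carrier := W\<rparr>"
  interpret V: vectorspace class_ring ?V by (rule vs)
  let ?t = "\<lambda>l. cl A (g l)"
  have inj: "inj_on ?t I"
  proof (rule inj_onI, rule ccontr)
    fix l l' assume l: "l \<in> I" "l' \<in> I" "?t l = ?t l'" "l \<noteq> l'"
    then have d: "g l - g l' \<in> enveloping_ideal A" by (simp add: cl_eq_iff)
    have "free_scale (- 1) (g l') = - g l'"
      using free_scale_simps(2)[of 1 "-1" "g l'"] free_scale_simps(4)[of "g l'"]
      by (simp add: free_scale_eq eq_neg_iff_add_eq_0 add.commute)
    then have "(\<Sum>x\<in>{l, l'}. free_scale (if x = l then 1 else - 1) (g x)) = g l - g l'"
      using l(4) by (simp add: free_scale_simps)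
    with ind[of "{l, l'}" "\<lambda>x. if x = l then 1 else - 1"] d l show False by auto
  qed
  have im: "s ` I = ?t ` I" using s(1) by auto
  have "inj_on s I" using inj s(1) by (simp add: inj_on_def)
  moreover have "V.basis (s ` I)"
    unfolding V.basis_def im
  proof (intro conjI)
    show "?t ` I \<subseteq> carrier ?V" using s(2) by auto
    show "V.lin_indpt (?t ` I)"
    proof
      assume "V.lin_dep (?t ` I)"
      then obtain A' a v where *: "finite A'" "A' \<subseteq> ?t ` I" "V.lincomb a A' = \<zero>\<^bsub>?V\<^esub>" "v \<in> A'" "a v \<noteq> 0"
        unfolding V.lin_dep_def by (auto simp: class_ring_simps)
      obtain J where J: "J \<subseteq> I" "A' = ?t ` J" using *(2) by (metis subset_image_iff)
      have injJ: "inj_on ?t J" using inj J(1) by (rule inj_on_subset)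
      have fJ: "finite J" using *(1) J(2) injJ by (simp add: finite_image_iff)
      have "cl A (\<Sum>l\<in>J. free_scale (a (?t l)) (g l)) = cl A 0"
        using *(3) lincomb_cl[OF vs fJ injJ, of a] s(2) J by (auto simp: cl_zero)
      then have "(\<Sum>l\<in>J. free_scale (a (?t l)) (g l)) \<in> enveloping_ideal A" by (simp add: cl_eq_iff)
      from ind[OF fJ J(1) this] *(4,5) J(2) show False by auto
    qed
    show "V.span (?t ` I) = carrier ?V"
    proof (intro equalityI subsetI)
      fix x assume "x \<in> V.span (?t ` I)"
      then obtain a A' where "x = V.lincomb a A'" "A' \<subseteq> ?t ` I" "a \<in> A' \<rightarrow> carrier class_ring"
        unfolding V.span_def by auto
      moreover from this have "A' \<subseteq> carrier ?V" using s(2) by auto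
      ultimately show "x \<in> carrier ?V" using V.lincomb_closed by simp
    next
      fix z assume "z \<in> carrier ?V"
      then obtain J c where J: "finite J" "J \<subseteq> I" "z = cl A (\<Sum>l\<in>J. free_scale (c l) (g l))" using span[of z] by auto
      have injJ: "inj_on ?t J" using inj J(2) by (rule inj_on_subset)
      \<comment> \<open>\<open>lincomb\<close> indexes its coefficients by vectors, so the
        coefficients are transported along the injection.\<close>
      define a where "a x = c (the_inv_into J ?t x)" for x
      have "a (?t l) = c l" if "l \<in> J" for l unfolding a_def using the_inv_into_f_f[OF injJ that] by simp
      then have "z = V.lincomb a (?t ` J)"
        using lincomb_cl[OF vs J(1) injJ, of a] s(2) J by (auto intro!: arg_cong[of _ _ "cl A"] sum.cong)
      moreover have "finite (?t ` J)" "?t ` J \<subseteq> ?t ` I" "a \<in> ?t ` J \<rightarrow> carrier class_ring"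
        using J by (auto simp: class_ring_simps)
      ultimately show "z \<in> V.span (?t ` I)" unfolding V.span_def by blast
    qed
  qed
  ultimately show ?thesis unfolding basis_of_def by blast
qed

lemma gl_center_carrier: "gl_center n \<subseteq> carrier (Ugl n)"
  by (auto simp: gl_center_def)

lemma central_on_add: "central_on n k f \<Longrightarrow> central_on n k g \<Longrightarrow> central_on n k (f + g)"
  by (simp add: central_on_def act_add)

lemma central_on_scale: "central_on n k f \<Longrightarrow> central_on n k (free_scale c f)"
  by (simp add: central_on_def act_free_scale)

lemma central_on_zero: "central_on n k 0"
  by (simp add: central_on_def)

lemma filtration_iff: "x \<in> filtration A m \<longleftrightarrow> (\<exists>f\<in>short A (Suc m). x = cl A f)"
  by (auto simp: filtration_def short_def cl_def less_Suc_eq_le)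

lemma center_vectorspace: "vectorspace class_ring ((Ugl n)\<lparr>carrier := gl_center n\<rparr>)"
  by (rule vectorspace_sub)
     (auto simp: gl_center_carrier central_iff central_on_add central_on_scale central_on_zero free_carrier_intros)

lemma center_filtration_vectorspace:
  "vectorspace class_ring ((Ugl n)\<lparr>carrier := gl_center_filtration n m\<rparr>)"
proof (rule vectorspace_sub)
  let ?P = "proper_symbols n"
  show "gl_center_filtration n m \<subseteq> carrier (Ugl n)" using gl_center_carrier by (auto simp: gl_center_filtration_def)
  fix f g assume *: "f \<in> free_carrier ?P" "g \<in> free_carrier ?P"
    "cl ?P f \<in> gl_center_filtration n m" "cl ?P g \<in> gl_center_filtration n m"
  then obtain f' g' where fg: "f' \<in> short ?P (Suc m)" "cl ?P f = cl ?P f'" "g' \<in> short ?P (Suc m)" "cl ?P g = cl ?P g'"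
    unfolding gl_center_filtration_def Int_iff filtration_iff by blast
  have "cl ?P (f + g) = cl ?P (f' + g')" using fg by (simp flip: cl_add)
  then have "cl ?P (f + g) \<in> filtration ?P m" unfolding filtration_iff using short_add[OF fg(1,3)] by blast
  then show "cl ?P (f + g) \<in> gl_center_filtration n m"
    using * by (auto simp: gl_center_filtration_def central_iff central_on_add free_carrier_intros)
next
  let ?P = "proper_symbols n"
  fix c f assume *: "f \<in> free_carrier ?P" "cl ?P f \<in> gl_center_filtration n m"
  then obtain f' where f: "f' \<in> short ?P (Suc m)" "cl ?P f = cl ?P f'"
    unfolding gl_center_filtration_def Int_iff filtration_iff by blast
  have "cl ?P (free_scale c f) = cl ?P (free_scale c f')" using f by (simp flip: cl_smult)
  then have "cl ?P (free_scale c f) \<in> filtration ?P m" unfolding filtration_iff using short_scale[OF f(1)] by blast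
  then show "cl ?P (free_scale c f) \<in> gl_center_filtration n m"
    using * by (auto simp: gl_center_filtration_def central_iff central_on_scale free_carrier_intros)
next
  show "cl (proper_symbols n) 0 \<in> gl_center_filtration n m"
    unfolding gl_center_filtration_def Int_iff filtration_iff using short_zero
    by (auto simp: central_iff central_on_zero free_carrier_intros)
qed

section \<open>Triangular systems\<close>

text \<open>Evaluate at an index of least rank among those with nonzero coefficient; only the
  diagonal term is left.\<close>

lemma triangular_independent:
  fixes \<phi> :: "'i \<Rightarrow> 'i \<Rightarrow> complex" and \<kappa> :: "'i \<Rightarrow> nat"
  assumes tri: "\<And>l \<mu>. l \<in> J \<Longrightarrow> \<mu> \<in> J \<Longrightarrow> \<phi> \<mu> l \<noteq> 0 \<Longrightarrow> l = \<mu> \<or> \<kappa> l < \<kappa> \<mu>"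
    and diag: "\<And>l. l \<in> J \<Longrightarrow> \<phi> l l \<noteq> 0"
    and J: "finite J" "\<And>\<mu>. \<mu> \<in> J \<Longrightarrow> (\<Sum>l\<in>J. c l * \<phi> \<mu> l) = 0"
  shows "\<forall>l\<in>J. c l = 0"
proof (rule ccontr)
  assume "\<not> (\<forall>l\<in>J. c l = 0)"
  then obtain l0 where "l0 \<in> J \<and> c l0 \<noteq> 0" by blast
  then obtain \<mu> where \<mu>: "\<mu> \<in> J" "c \<mu> \<noteq> 0" "\<And>l. l \<in> J \<Longrightarrow> c l \<noteq> 0 \<Longrightarrow> \<kappa> \<mu> \<le> \<kappa> l"
    using ex_has_least_nat[of "\<lambda>l. l \<in> J \<and> c l \<noteq> 0" l0 \<kappa>] by blast
  have "(\<Sum>l\<in>J. c l * \<phi> \<mu> l) = (\<Sum>l\<in>J. if l = \<mu> then c \<mu> * \<phi> \<mu> \<mu> else 0)"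
    using tri[OF _ \<mu>(1)] \<mu>(3) by (intro sum.cong refl) (fastforce simp: not_less)
  also have "\<dots> = c \<mu> * \<phi> \<mu> \<mu>" using J(1) \<mu>(1) by simp
  finally show False using J(2)[OF \<mu>(1)] \<mu>(2) diag[OF \<mu>(1)] by simp
qed

text \<open>The indices are added by increasing rank. A new one does not enter the equations already
  solved, and its own equation is solved by division by the diagonal entry.\<close>

lemma triangular_solve:
  fixes \<phi> :: "'i \<Rightarrow> 'i \<Rightarrow> complex" and \<kappa> :: "'i \<Rightarrow> nat"
  assumes "\<And>l \<mu>. l \<in> J \<Longrightarrow> \<mu> \<in> J \<Longrightarrow> \<phi> \<mu> l \<noteq> 0 \<Longrightarrow> l = \<mu> \<or> \<kappa> l < \<kappa> \<mu>"
    and "\<And>l. l \<in> J \<Longrightarrow> \<phi> l l \<noteq> 0" and "finite J"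
  shows "\<exists>c. \<forall>\<mu>\<in>J. (\<Sum>l\<in>J. c l * \<phi> \<mu> l) = y \<mu>"
  using assms(3,1,2)
proof (induction J rule: finite_ranking_induct[where f = \<kappa>])
  case (insert x S)
  show ?case
  proof (cases "x \<in> S")
    case True
    then show ?thesis using insert by (simp add: insert_absorb)
  next
    case False
    have "\<exists>c. \<forall>\<mu>\<in>S. (\<Sum>l\<in>S. c l * \<phi> \<mu> l) = y \<mu>" by (rule insert.IH) (use insert.prems in auto)
    then obtain c where c: "\<And>\<mu>. \<mu> \<in> S \<Longrightarrow> (\<Sum>l\<in>S. c l * \<phi> \<mu> l) = y \<mu>" by blast
    define c' where "c' = c(x := (y x - (\<Sum>l\<in>S. c l * \<phi> x l)) / \<phi> x x)"
    have 1: "(\<Sum>l\<in>insert x S. c' l * \<phi> \<mu> l) = c' x * \<phi> \<mu> x + (\<Sum>l\<in>S. c l * \<phi> \<mu> l)" for \<mu>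
      using insert.hyps(1) False by (simp add: c'_def) (intro sum.cong, auto)
    have "\<phi> \<mu> x = 0" if "\<mu> \<in> S" for \<mu>
      using insert.prems(1)[of x \<mu>] insert.hyps(2)[OF that] that False by force
    then have "(\<Sum>l\<in>insert x S. c' l * \<phi> \<mu> l) = y \<mu>" if "\<mu> \<in> insert x S" for \<mu>
      using that c insert.prems(2)[of x] unfolding 1 by (auto simp: c'_def)
    then show ?thesis by blast
  qed
qed simp

section \<open>The Schur elements form a basis\<close>

lemma finite_schur_index: "finite {l \<in> schur_index n. sum_list l \<le> m}"
proof -
  have "{l \<in> schur_index n. sum_list l \<le> m} \<subseteq> {l. set l \<subseteq> {..m} \<and> length l \<le> n}"
    using member_le_sum_list by (force simp: schur_index_iff)
  then show ?thesis by (rule finite_subset) (intro finite_lists_length_le finite_atMost)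
qed

text \<open>Orders the partitions by size first: \<open>letter_sum n (part_weight l)\<close> is at most \<open>n\<close> times the size,
  which is less than \<open>n\<close> times the gap between consecutive squares.\<close>

definition schur_rank :: "nat \<Rightarrow> nat list \<Rightarrow> nat" where
  "schur_rank n l = n * (sum_list l)\<^sup>2 + letter_sum n (part_weight l)"

lemma schur_rank_less:
  assumes "l \<in> schur_index n" "l' \<in> schur_index n"
    and "sum_list l < sum_list l' \<or> sum_list l = sum_list l' \<and> letter_sum n (part_weight l) < letter_sum n (part_weight l')"
  shows "schur_rank n l < schur_rank n l'"
  using assms(3)
proof
  assume lt: "sum_list l < sum_list l'"
  have "n > 0"
  proof (rule ccontr)
    assume "\<not> n > 0"
    then have "l' = []" using assms(2) by (simp add: schur_index_iff)
    then show False using lt by simp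
  qed
  have "letter_sum n (part_weight l) \<le> (\<Sum>i=1..n. n * part_weight l i)"
    unfolding letter_sum_def by (intro sum_mono) auto
  also have "\<dots> = n * sum_list l" using sum_part_weight[OF assms(1)] by (simp flip: sum_distrib_left)
  finally have "schur_rank n l \<le> n * ((sum_list l)\<^sup>2 + sum_list l)" by (simp add: schur_rank_def algebra_simps)
  also have "\<dots> < n * (Suc (sum_list l))\<^sup>2" using \<open>n > 0\<close> by (intro mult_less_mono2) (simp_all add: power2_eq_square)
  also have "\<dots> \<le> n * (sum_list l')\<^sup>2" using lt by (intro mult_le_mono2 power_mono) auto
  finally show ?thesis by (simp add: schur_rank_def)
qed (simp add: schur_rank_def)

text \<open>The supplies of virtual symbols may vary with the shape: a Schur element is determined
  by its action on proper tensors, in which \<open>m0\<close> and \<open>m1\<close> no longer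
  appear.\<close>

theorem theorem4p4:
  fixes n :: nat and m0 m1 :: "nat list \<Rightarrow> nat"
  assumes "\<And>l. is_partition l \<Longrightarrow> length (conj_partition l) \<le> m0 l"
    and "\<And>l. is_partition l \<Longrightarrow> first_part (conj_partition l) \<le> m1 l"
  shows "(\<forall>m>0. basis_of (Ugl n) (gl_center_filtration n m)
            {l \<in> schur_index n. sum_list l \<le> m} (\<lambda>l. schur_element (m0 l) (m1 l) n l)) \<and>
         basis_of (Ugl n) (gl_center n)
            (schur_index n) (\<lambda>l. schur_element (m0 l) (m1 l) n l)"
proof -
  let ?P = "proper_symbols n" and ?I = "schur_index n"
  let ?s = "\<lambda>l. schur_element (m0 l) (m1 l) n l"
  let ?h = "\<lambda>l. 1 / of_nat (hook_product (conj_partition l)) :: complex"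
  have part: "is_partition l" if "l \<in> ?I" for l using that by (simp add: schur_index_iff)
  have "\<exists>g. g \<in> short ?P (Suc (sum_list l)) \<and> ?s l = cl ?P g \<and>
      (\<forall>k. \<forall>t\<in>Vec ?P k. act g t = scl (?h l) (schur_op n l t))" if "l \<in> ?I" for l
    using schur_element_act[of l "m0 l" "m1 l" n] assms[OF part[OF that]] conj_le sum_list_conj[OF part[OF that]]
    by (metis le_trans)
  then obtain g where g: "\<And>l. l \<in> ?I \<Longrightarrow> g l \<in> short ?P (Suc (sum_list l))"
    "\<And>l. l \<in> ?I \<Longrightarrow> ?s l = cl ?P (g l)"
    "\<And>l k t. l \<in> ?I \<Longrightarrow> t \<in> Vec ?P k \<Longrightarrow> act (g l) t = scl (?h l) (schur_op n l t)"
    by metis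
  have gc: "g l \<in> free_carrier ?P" if "l \<in> ?I" for l using g(1)[OF that] by (simp add: short_def)
  have gcen: "central_on n k (g l)" if "l \<in> ?I" for l k
    by (rule central_on_schur[OF gc[OF that] g(3)[OF that]])
  have "\<exists>v. v \<noteq> 0 \<and> v \<in> HW n (part_weight l) (sum_list l)" if "l \<in> ?I" for l
  proof -
    have "k \<le> n" if "k \<in> set (conj_partition l)" for k
      using conj_le[OF that] first_part_conj[OF part[OF \<open>l \<in> ?I\<close>]] \<open>l \<in> ?I\<close> by (simp add: schur_index_iff)
    from HW_exists[OF sorted_conj[of l] this] show ?thesis
      using sum_list_conj[OF part[OF that]] unfolding part_weight_def[abs_def] by auto
  qed
  then obtain v where v: "\<And>l. l \<in> ?I \<Longrightarrow> v l \<noteq> 0" "\<And>l. l \<in> ?I \<Longrightarrow> v l \<in> HW n (part_weight l) (sum_list l)"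
    by metis
  have vV: "v l \<in> Vec ?P (sum_list l)" if "l \<in> ?I" for l using v(2)[OF that] by (simp add: HW_def)
  \<comment> \<open>For a central element this is the scalar at the weight \<open>l\<close> times
    the squared norm of \<open>v l\<close>; in this form it is defined for all \<open>f\<close> and
    linear in \<open>f\<close>.\<close>
  define ev where "ev l f = ip (form_symbols n (conj_partition l)) (sum_list l) (act f (v l)) (v l)" for l f
  have ev_add: "ev l (f + f') = ev l f + ev l f'" and ev_scale: "ev l (free_scale c f) = c * ev l f" for l f f' c
    by (simp_all add: ev_def act_add act_free_scale)
  have ev_sum: "ev l (\<Sum>i\<in>J. free_scale (c i) (g i)) = (\<Sum>i\<in>J. c i * ev l (g i))" for l J c
    by (simp add: ev_def act_sum act_free_scale ip_sum)
  have hnz: "?h l \<noteq> 0" for l using hook_product_pos[of "conj_partition l"] by simp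
  have tri: "l = \<mu> \<or> schur_rank n l < schur_rank n \<mu>" if "l \<in> ?I" "\<mu> \<in> ?I" "ev \<mu> (g l) \<noteq> 0" for l \<mu>
  proof -
    have "schur_op n l (v \<mu>) \<noteq> 0"
    proof
      assume "schur_op n l (v \<mu>) = 0"
      then have "ev \<mu> (g l) = 0" using g(3)[OF that(1) vV[OF that(2)]] by (simp add: ev_def)
      then show False using that(3) by simp
    qed
    from schur_op_triangular[OF that(1) v(2)[OF that(2)] this]
    show ?thesis using schur_rank_less[OF that(1,2)] part_weight_inj[OF that(1,2)] by auto
  qed
  have diag: "ev l (g l) \<noteq> 0" if "l \<in> ?I" for l
    using schur_op_diagonal[OF that v(2)[OF that] v(1)[OF that]] g(3)[OF that vV[OF that]] hnz[of l]
    by (simp add: ev_def)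
  have ind: "\<forall>l\<in>J. c l = 0"
    if "finite J" "J \<subseteq> ?I" "(\<Sum>l\<in>J. free_scale (c l) (g l)) \<in> enveloping_ideal ?P" for J c
  proof (rule triangular_independent[where \<phi> = "\<lambda>\<mu> l. ev \<mu> (g l)" and \<kappa> = "schur_rank n"])
    fix \<mu> assume "\<mu> \<in> J"
    have "ev \<mu> (\<Sum>l\<in>J. free_scale (c l) (g l)) = 0"
      using enveloping_ideal_act[OF that(3)] by (simp add: ev_def)
    then show "(\<Sum>l\<in>J. c l * ev \<mu> (g l)) = 0" by (simp add: ev_sum)
  qed (use that tri diag in blast)+
  \<comment> \<open>An element of degree at most \<open>m\<close> is determined by its action on
    tensors of degree at most \<open>m\<close>, and the highest weights there are partitions of size
    at most \<open>m\<close>.\<close>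
  have vanish: "f \<in> enveloping_ideal ?P"
    if f: "f \<in> short ?P (Suc m)" "\<And>k. central_on n k f" "\<And>l. l \<in> ?I \<Longrightarrow> sum_list l \<le> m \<Longrightarrow> ev l f = 0" for f m
  proof (rule faithful[OF proper_odd f(1)])
    have fc: "f \<in> free_carrier ?P" using f(1) by (simp add: short_def)
    fix k t assume k: "k < Suc m" and t: "t \<in> Vec ?P k"
    show "act f t = 0"
    proof (rule central_vanishes[OF fc f(2) _ t])
      fix \<mu> u assume u: "u \<in> HW n \<mu> k"
      show "act f u = 0"
      proof (cases "u = 0")
        case False
        obtain l where l: "l \<in> ?I" "sum_list l = k" "\<And>i. 1 \<le> i \<Longrightarrow> i \<le> n \<Longrightarrow> part_weight l i = \<mu> i"
          using HW_partition[OF u False] by blast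
        have "HW n \<mu> k = HW n (part_weight l) k" unfolding HW_def hwt_def using l(3) by auto
        with central_scalar[OF fc f(2), where k = k and \<mu> = "part_weight l"] obtain c where
          c: "\<And>u. u \<in> HW n \<mu> k \<Longrightarrow> act f u = scl c u" and vl: "v l \<in> HW n \<mu> k"
          using v(2)[OF l(1)] l(2) by auto
        let ?B = "form_symbols n (conj_partition l)"
        have "v l \<in> Vec ?B k" using vV[OF l(1)] l(2) Vec_mono[of ?P ?B k] by (auto simp: form_symbols_def)
        then have "ip ?B k (v l) (v l) \<noteq> 0"
          using ip_definite[OF finite_form_symbols] v(1)[OF l(1)] by blast
        moreover have "c * ip ?B k (v l) (v l) = 0"
          using f(3)[OF l(1)] l(2) k c[OF vl] by (simp add: ev_def)
        ultimately have "c = 0" by simp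
        then show ?thesis using c[OF u] by simp
      qed (simp add: lin_0)
    qed
  qed
  have span: "\<exists>c. z = cl ?P (\<Sum>l | l \<in> ?I \<and> sum_list l \<le> m. free_scale (c l) (g l))"
    if z: "z \<in> gl_center_filtration n m" for z m
  proof -
    let ?J = "{l \<in> ?I. sum_list l \<le> m}"
    obtain f where f: "f \<in> short ?P (Suc m)" "z = cl ?P f"
      using z by (auto simp: gl_center_filtration_def filtration_iff)
    have fc: "f \<in> free_carrier ?P" using f(1) by (simp add: short_def)
    have fcen: "\<forall>k. central_on n k f" using z f(2) fc by (simp add: gl_center_filtration_def central_iff)
    \<comment> \<open>The coefficients match the values of \<open>ev\<close> at all partitions of
      size at most \<open>m\<close>. The difference to \<open>f\<close> again has degree at most
      \<open>m\<close> and is central, so \<open>vanish\<close> applies to it.\<close>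
    obtain c where c: "\<And>\<mu>. \<mu> \<in> ?J \<Longrightarrow> (\<Sum>l\<in>?J. c l * ev \<mu> (g l)) = ev \<mu> f"
      using triangular_solve[of ?J "\<lambda>\<mu> l. ev \<mu> (g l)" "schur_rank n" "\<lambda>\<mu>. ev \<mu> f"] tri diag finite_schur_index by blast
    define d where "d = (\<lambda>l. - c l)"
    let ?f = "f + (\<Sum>l\<in>?J. free_scale (d l) (g l))"
    have neg: "(\<Sum>l\<in>?J. free_scale (d l) (g l)) = - (\<Sum>l\<in>?J. free_scale (c l) (g l))"
    proof -
      have "free_scale (- a) h = - free_scale a h" for a h
        using free_scale_simps(2)[of "- a" a h] by (simp add: free_scale_eq eq_neg_iff_add_eq_0)
      then show ?thesis by (simp add: d_def sum_negf)
    qed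
    have "?f \<in> enveloping_ideal ?P"
    proof (rule vanish)
      show "?f \<in> short ?P (Suc m)"
        using f(1) g(1) by (intro short_add short_sum short_scale) (auto intro: short_mono)
      show "central_on n k ?f" for k
        using fcen gcen by (auto simp: central_on_def act_add act_sum act_free_scale)
      show "ev l ?f = 0" if "l \<in> ?I" "sum_list l \<le> m" for l
        unfolding ev_add ev_sum using c[of l] that by (simp add: d_def sum_negf)
    qed
    then have "z = cl ?P (\<Sum>l\<in>?J. free_scale (c l) (g l))"
      unfolding f(2) cl_eq_iff neg by simp
    then show ?thesis by blast
  qed
  have gW: "cl ?P (g l) \<in> gl_center_filtration n m" if "l \<in> ?I" "sum_list l \<le> m" for l m
  proof -
    have "cl ?P (g l) \<in> gl_center n" using gcen[OF that(1)] gc[OF that(1)] by (simp add: central_iff)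
    moreover have "cl ?P (g l) \<in> filtration ?P m"
      unfolding filtration_iff using short_mono[OF g(1)[OF that(1)], of "Suc m"] that(2) by auto
    ultimately show ?thesis by (simp add: gl_center_filtration_def)
  qed
  have "basis_of (Ugl n) (gl_center_filtration n m) {l \<in> ?I. sum_list l \<le> m} ?s" for m
  proof (rule basis_ofI[OF center_filtration_vectorspace])
    show "?s l = cl ?P (g l)" "cl ?P (g l) \<in> gl_center_filtration n m" if "l \<in> {l \<in> ?I. sum_list l \<le> m}" for l
      using that g(2) gW by auto
    show "\<forall>l\<in>J. c l = 0" if "finite J" "J \<subseteq> {l \<in> ?I. sum_list l \<le> m}"
      "(\<Sum>l\<in>J. free_scale (c l) (g l)) \<in> enveloping_ideal ?P" for J c
      using ind[OF that(1) _ that(3)] that(2) by blast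
    show "\<exists>J c. finite J \<and> J \<subseteq> {l \<in> ?I. sum_list l \<le> m} \<and> z = cl ?P (\<Sum>l\<in>J. free_scale (c l) (g l))"
      if "z \<in> gl_center_filtration n m" for z
      using span[OF that] finite_schur_index[of n m] by blast
  qed
  moreover have "basis_of (Ugl n) (gl_center n) ?I ?s"
  proof (rule basis_ofI[OF center_vectorspace])
    show "?s l = cl ?P (g l)" "cl ?P (g l) \<in> gl_center n" if "l \<in> ?I" for l
      using that g(2) gW[OF that order_refl] by (auto simp: gl_center_filtration_def)
    show "\<forall>l\<in>J. c l = 0" if "finite J" "J \<subseteq> ?I"
      "(\<Sum>l\<in>J. free_scale (c l) (g l)) \<in> enveloping_ideal ?P" for J c
      using ind[OF that] .
    show "\<exists>J c. finite J \<and> J \<subseteq> ?I \<and> z = cl ?P (\<Sum>l\<in>J. free_scale (c l) (g l))" if z: "z \<in> gl_center n" for z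
    proof -
      obtain f where f: "f \<in> free_carrier ?P" "z = cl ?P f"
        using z by (auto simp: gl_center_def carrier_enveloping)
      \<comment> \<open>Every central element has some finite degree, so the statement for the
        filtration yields the spanning property of the whole family.\<close>
      obtain m where "f \<in> short ?P m" using short_exists[OF f(1)] by blast
      then have "f \<in> short ?P (Suc m)" by (rule short_mono) simp
      then have "z \<in> gl_center_filtration n m"
        using z f(2) by (auto simp: gl_center_filtration_def filtration_iff)
      from span[OF this] obtain c where "z = cl ?P (\<Sum>l | l \<in> ?I \<and> sum_list l \<le> m. free_scale (c l) (g l))" by blast
      then show ?thesis using finite_schur_index[of n m] by (intro exI[of _ "{l \<in> ?I. sum_list l \<le> m}"] exI[of _ c]) auto
    qed
  qed
  ultimately show ?thesis by blast
qed

end
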